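(* Let $n\ge 2$. There is an isomorphism of algebras $\phi_n:\mathfrak{U}_n^+\xrightarrow{\ \simeq\ }\mathrm{KHA}_{A_{n-1}}$ between the positive part of the $0$-affine quantum group and the K-theoretic Hall algebra of the type $A_{n-1}$ Dynkin quiver, given on generators by $\phi_n(e_{i,r})=x_{i,1}^{-r}$ for all $1\le i\le n-1$ and $r\in\mathbb{Z}$, where $x_{i,1}^{-r}$ is regarded as an element of the graded piece $K(\mathrm{Rep}_{\omega_i}Q(A_{n-1}))\cong\mathbb{C}[x_{i,1}^{\pm1}]$ and $\omega_i$ is the dimension vector with $1$ at vertex $i$ and $0$ elsewhere.
   Context: All algebras are associative algebras over $\mathbb{C}$. Positive part of the $0$-affine quantum group: $\mathfrak{U}_n^+$ is the algebra generated by $e_{i,r}$ ($1\le i\le n-1$, $r\in\mathbb{Z}$) subject to the relations, for all $r,s\in\mathbb{Z}$: (i) $e_{i,r}e_{i,s}=-e_{i,s-1}e_{i,r+1}$ for $1\le i\le n-1$; (ii) $e_{i+1,s}e_{i,r}=e_{i,r}e_{i+1,s}-e_{i,r+1}e_{i+1,s-1}$ for $1\le i\le n-2$; (iii) $e_{i,r}e_{j,s}=e_{j,s}e_{i,r}$ for $1\le i,j\le n-1$, $|i-j|\ge2$. K-theoretic Hall algebra: for a quiver $Q$ with vertex set $I$ and a dimension vector $\alpha=(\alpha^i)\in\mathbb{Z}_{\ge0}^I$, let $\mathrm{Rep}_\alpha Q=[R_\alpha Q/G_\alpha Q]$ be the stack of representations of dimension $\alpha$, where $R_\alpha Q=\prod_{e}\mathrm{Hom}(\mathbb{C}^{\alpha^{s(e)}},\mathbb{C}^{\alpha^{t(e)}})$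 (product over the arrows $e$, with source $s(e)$ and target $t(e)$) and $G_\alpha Q=\prod_i \mathrm{GL}_{\alpha^i}(\mathbb{C})$. Let $K$ denote the complexified Grothendieck group. Let $\mathrm{Fl}_{\alpha,\beta}Q$ be the stack of pairs (representation $V^\bullet$ of dimension $\alpha+\beta$, subrepresentation $W^\bullet\subset V^\bullet$ of dimension $\alpha$), with maps $q:(W^\bullet\subset V^\bullet)\mapsto(W^\bullet,V^\bullet/W^\bullet)$ and $p:(W^\bullet\subset V^\bullet)\mapsto V^\bullet$. The K-theoretic Hall algebra is $\mathrm{KHA}_Q=\bigoplus_\alpha K(\mathrm{Rep}_\alpha Q)$ with the product $p_*q^*:K(\mathrm{Rep}_\alpha Q)\otimes K(\mathrm{Rep}_\beta Q)\to K(\mathrm{Rep}_{\alpha+\beta}Q)$. One identifies $K(\mathrm{Rep}_\alpha Q)\cong\mathbb{C}[x_{ij}^{\pm1}: i\in I,\,1\le j\le\alpha^i]^{\mathfrak{S}_\alpha}$ with $\mathfrak{S}_\alpha=\prod_i\mathfrak{S}_{\alpha^i}$ permuting the variables $x_{i1},\dots,x_{i\alpha^i}$ for each $i$. Under this identification the product of $f\in K(\mathrm{Rep}_\alpha Q)$ and $g\in K(\mathrm{Rep}_\beta Q)$ is (known shuffle formula) $$f*g=\frac{1}{|\mathfrak{S}_\alpha||\mathfrak{S}_\beta|}\mathrm{Sym}\Biggl(f(x_{ij})_{1\le j\le\alpha^i}\; g(x_{i'j'})_{\alpha^{i'}<j'\le\alpha^{i'}+\beta^{i'}}\;\frac{\prod_{i,i'\in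 I}\prod_{1\le j\le\alpha^i}\prod_{\alpha^{i'}<j'\le\alpha^{i'}+\beta^{i'}}(1-x_{ij}x_{i'j'}^{-1})^{c(i,i')}}{\prod_{i\in I}\prod_{1\le j\le\alpha^i<j'\le\alpha^i+\beta^i}(1-x_{ij}x_{ij'}^{-1})}\Biggr),$$ where $c(i,i')$ is the number of arrows from $i$ to $i'$ and $\mathrm{Sym}$ is the sum over all permutations of the variables by $\mathfrak{S}_{\alpha+\beta}$. The quiver $Q(A_{m})$ has vertices $1,\dots,m$ and exactly one arrow from $i+1$ to $i$ for each $1\le i\le m-1$, and no other arrows; $\mathrm{KHA}_{A_m}:=\mathrm{KHA}_{Q(A_m)}$. *)

theory Defs
  imports
    Complex_Main
    "HOL-Library.Poly_Mapping"
    "HOL-Library.Product_Lexorder"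
    "HOL-Combinatorics.Permutations"
    "HOL-Computational_Algebra.Fraction_Field"
    "HOL-Algebra.QuotRing"
    "HOL-Algebra.Module"
    "Graph_Theory.Digraph"
begin

section \<open>Algebras over the complex numbers\<close>

text \<open>
  A unital associative algebra over \<open>\<complex>\<close> is carried by a record of type \<open>(complex, 'a) module\<close>, which
  has the ring operations together with a scalar multiplication. (The locale \<^locale>\<open>algebra\<close> of the
  library is about commutative algebras only.)
\<close>

definition alg_iso :: "(complex, 'a) module \<Rightarrow> (complex, 'b) module \<Rightarrow> ('a \<Rightarrow> 'b) set" where
  "alg_iso A B =
     {h \<in> ring_iso A B. \<forall>c. \<forall>x \<in> carrier A. h (c \<odot>\<^bsub>A\<^esub> x) = c \<odot>\<^bsub>B\<^esub> h x}"


section \<open>Algebras given by generators and relations\<close>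

datatype 'x word = Word (letters: "'x list")

instantiation word :: (type) monoid_add
begin

definition zero_word :: "'a word" where
  "0 = Word []"

definition plus_word :: "'a word \<Rightarrow> 'a word \<Rightarrow> 'a word" where
  "u + v = Word (letters u @ letters v)"

instance
  by standard (simp_all add: zero_word_def plus_word_def)

end

text \<open>
  Words under concatenation are written additively, so that the convolution product of
  \<^theory>\<open>HOL-Library.Poly_Mapping\<close> is the product of noncommutative polynomials.
\<close>

type_synonym 'x ncpoly = "'x word \<Rightarrow>\<^sub>0 complex"

definition nc_var :: "'x \<Rightarrow> 'x ncpoly" where
  "nc_var x = Poly_Mapping.single (Word [x]) 1"

definition free_algebra :: "'x set \<Rightarrow> 'x ncpoly ring" where
  "free_algebra X =
     \<lparr>carrier = {p. \<forall>w \<in> Poly_Mapping.keys p. set (letters w) \<subseteq> X},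
      mult = (*), one = 1, zero = 0, add = (+)\<rparr>"

text \<open>
  \<open>presented_algebra X R\<close> is the quotient of the free algebra on \<open>X\<close> by the two-sided ideal generated
  by \<open>R\<close>. A scalar acts by multiplication with its class.
\<close>

definition presented_algebra ::
    "'x set \<Rightarrow> 'x ncpoly set \<Rightarrow> (complex, 'x ncpoly set) module" where
  "presented_algebra X R =
     (let F = free_algebra X; I = Idl\<^bsub>F\<^esub> R; A = F Quot I in
     \<lparr>carrier = carrier A, mult = mult A, one = one A, zero = zero A, add = add A,
      smult = (\<lambda>c a. (I +>\<^bsub>F\<^esub> Poly_Mapping.single 0 c) \<otimes>\<^bsub>A\<^esub> a)\<rparr>)"

definition presented_gen :: "'x set \<Rightarrow> 'x ncpoly set \<Rightarrow> 'x \<Rightarrow> 'x ncpoly set" where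
  "presented_gen X R x = (Idl\<^bsub>free_algebra X\<^esub> R) +>\<^bsub>free_algebra X\<^esub> nc_var x"


section \<open>The positive part of the 0-affine quantum group\<close>

abbreviation ee :: "nat \<Rightarrow> int \<Rightarrow> (nat \<times> int) ncpoly" where
  "ee i r \<equiv> nc_var (i, r)"

definition U_gens :: "nat \<Rightarrow> (nat \<times> int) set" where
  "U_gens n = {1..n - 1} \<times> UNIV"

definition U_rels :: "nat \<Rightarrow> (nat \<times> int) ncpoly set" where
  "U_rels n =
     {ee i r * ee i s - (- (ee i (s - 1) * ee i (r + 1))) | i r s. 1 \<le> i \<and> i \<le> n - 1} \<union>
     {ee (i + 1) s * ee i r - (ee i r * ee (i + 1) s - ee i (r + 1) * ee (i + 1) (s - 1)) | i r s.
        1 \<le> i \<and> i \<le> n - 2} \<union>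
     {ee i r * ee j s - ee j s * ee i r | i j r s.
        1 \<le> i \<and> i \<le> n - 1 \<and> 1 \<le> j \<and> j \<le> n - 1 \<and> \<bar>int i - int j\<bar> \<ge> 2}"

definition U_plus :: "nat \<Rightarrow> (complex, (nat \<times> int) ncpoly set) module" where
  "U_plus n = presented_algebra (U_gens n) (U_rels n)"

definition U_gen :: "nat \<Rightarrow> nat \<Rightarrow> int \<Rightarrow> (nat \<times> int) ncpoly set" where
  "U_gen n i r = presented_gen (U_gens n) (U_rels n) (i, r)"


section \<open>Laurent polynomials\<close>

text \<open>
  Laurent polynomials in the variables \<open>x\<^sub>i\<^sub>j\<close>, indexed by the pairs \<open>(i, j)\<close> of a vertex and a positive
  integer. The vertices are linearly ordered only because the library's integral domain instance for
  \<^typ>\<open>'a \<Rightarrow>\<^sub>0 'b\<close>, needed for the field of fractions, asks for ordered exponents.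
\<close>

type_synonym 'v laurent = "(('v \<times> nat) \<Rightarrow>\<^sub>0 int) \<Rightarrow>\<^sub>0 complex"

definition xpow :: "'v \<Rightarrow> nat \<Rightarrow> int \<Rightarrow> 'v laurent" where
  "xpow i j k = Poly_Mapping.single (Poly_Mapping.single (i, j) k) 1"

text \<open>The substitution \<open>x\<^sub>v \<mapsto> x\<^bsub>\<rho> v\<^esub>\<close>.\<close>

definition rename_vars :: "('v \<times> nat \<Rightarrow> 'v \<times> nat) \<Rightarrow> 'v laurent \<Rightarrow> 'v laurent" where
  "rename_vars \<rho> f =
     (\<Sum>m \<in> Poly_Mapping.keys f.
        Poly_Mapping.single
          (\<Sum>v \<in> Poly_Mapping.keys m. Poly_Mapping.single (\<rho> v) (Poly_Mapping.lookup m v))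
          (Poly_Mapping.lookup f m))"


section \<open>The K-theoretic Hall algebra of a quiver\<close>

type_synonym 'v dimvec = "'v \<Rightarrow>\<^sub>0 nat"

definition num_arrows :: "('v, 'e) pre_digraph \<Rightarrow> 'v \<Rightarrow> 'v \<Rightarrow> nat" where
  "num_arrows Q i i' = card {e \<in> arcs Q. tail Q e = i \<and> head Q e = i'}"

definition dim_vars :: "'v dimvec \<Rightarrow> ('v \<times> nat) set" where
  "dim_vars \<alpha> = (SIGMA i : Poly_Mapping.keys \<alpha>. {1..Poly_Mapping.lookup \<alpha> i})"

definition sym_group :: "'v dimvec \<Rightarrow> ('v \<times> nat \<Rightarrow> 'v \<times> nat) set" where
  "sym_group \<alpha> = {\<sigma>. \<sigma> permutes dim_vars \<alpha> \<and> (\<forall>v. fst (\<sigma> v) = fst v)}"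

text \<open>\<open>K(Rep\<^sub>\<alpha> Q)\<close>, identified with the Laurent polynomials invariant under the symmetric groups.\<close>

definition K_Rep :: "'v dimvec \<Rightarrow> 'v laurent set" where
  "K_Rep \<alpha> = {f. (\<forall>m \<in> Poly_Mapping.keys f. Poly_Mapping.keys m \<subseteq> dim_vars \<alpha>) \<and>
                 (\<forall>\<sigma> \<in> sym_group \<alpha>. rename_vars \<sigma> f = f)}"

definition shuffle_num ::
    "('v, 'e) pre_digraph \<Rightarrow> 'v dimvec \<Rightarrow> 'v dimvec \<Rightarrow> 'v laurent \<Rightarrow> 'v laurent \<Rightarrow> 'v laurent" where
  "shuffle_num Q \<alpha> \<beta> f g =
     (let a = Poly_Mapping.lookup \<alpha>; b = Poly_Mapping.lookup \<beta> in
      f * rename_vars (\<lambda>(i, j). (i, a i + j)) g *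
      (\<Prod>i \<in> verts Q. \<Prod>i' \<in> verts Q. \<Prod>j \<in> {1..a i}. \<Prod>j' \<in> {a i' + 1..a i' + b i'}.
         (1 - xpow i j 1 * xpow i' j' (-1)) ^ num_arrows Q i i'))"

definition shuffle_denom ::
    "('v, 'e) pre_digraph \<Rightarrow> 'v dimvec \<Rightarrow> 'v dimvec \<Rightarrow> 'v laurent" where
  "shuffle_denom Q \<alpha> \<beta> =
     (let a = Poly_Mapping.lookup \<alpha>; b = Poly_Mapping.lookup \<beta> in
      (\<Prod>i \<in> verts Q. \<Prod>j \<in> {1..a i}. \<Prod>j' \<in> {a i + 1..a i + b i}.
         (1 - xpow i j 1 * xpow i j' (-1))))"

text \<open>
  The shuffle formula is evaluated in the field of fractions of the Laurent polynomials. For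
  \<open>f \<in> K_Rep \<alpha>\<close> and \<open>g \<in> K_Rep \<beta>\<close> its value is a Laurent polynomial, since the simple poles along
  \<open>x\<^sub>i\<^sub>j = x\<^sub>i\<^sub>j\<^sub>'\<close> cancel under the symmetrization; the description operator picks that Laurent
  polynomial.
\<close>

definition shuffle_prod ::
    "('v::linorder, 'e) pre_digraph \<Rightarrow> 'v dimvec \<Rightarrow> 'v dimvec \<Rightarrow> 'v laurent \<Rightarrow> 'v laurent \<Rightarrow> 'v laurent"
  where
  "shuffle_prod Q \<alpha> \<beta> f g =
     (THE h. Fraction_Field.Fract h 1 =
        (\<Sum>\<sigma> \<in> sym_group (\<alpha> + \<beta>).
           Fraction_Field.Fract (rename_vars \<sigma> (shuffle_num Q \<alpha> \<beta> f g))
             (rename_vars \<sigma> (shuffle_denom Q \<alpha> \<beta>)))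
        / (of_nat (card (sym_group \<alpha>)) * of_nat (card (sym_group \<beta>))))"

text \<open>
  The direct sum over all dimension vectors consists of the finitely supported families of elements
  of the \<open>K(Rep\<^sub>\<alpha> Q)\<close>; \<open>Poly_Mapping.single \<alpha> f\<close> is \<open>f\<close> placed in the graded piece \<open>\<alpha>\<close>.
\<close>

definition KHA ::
    "('v::linorder, 'e) pre_digraph \<Rightarrow> (complex, 'v dimvec \<Rightarrow>\<^sub>0 'v laurent) module" where
  "KHA Q =
     \<lparr>carrier = {F. \<forall>\<alpha> \<in> Poly_Mapping.keys F.
                    Poly_Mapping.keys \<alpha> \<subseteq> verts Q \<and> Poly_Mapping.lookup F \<alpha> \<in> K_Rep \<alpha>},
      mult = (\<lambda>F G. \<Sum>\<alpha> \<in> Poly_Mapping.keys F. \<Sum>\<beta> \<in> Poly_Mapping.keys G.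
                Poly_Mapping.single (\<alpha> + \<beta>)
                  (shuffle_prod Q \<alpha> \<beta> (Poly_Mapping.lookup F \<alpha>) (Poly_Mapping.lookup G \<beta>))),
      one = Poly_Mapping.single 0 1,
      zero = 0,
      add = (+),
      smult = (\<lambda>c. Poly_Mapping.map ((*) (Poly_Mapping.single 0 c)))\<rparr>"

text \<open>The arrow \<open>i + 1 \<rightarrow> i\<close> is named \<open>i\<close>.\<close>

definition quiver_A :: "nat \<Rightarrow> (nat, nat) pre_digraph" where
  "quiver_A m = \<lparr>verts = {1..m}, arcs = {1..<m}, tail = Suc, head = (\<lambda>i. i)\<rparr>"

definition unit_dim :: "'v \<Rightarrow> 'v dimvec" where
  "unit_dim i = Poly_Mapping.single i 1"

end

theory Submission
  imports Defs
begin

text \<open>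
  A word in the generators is sent to the iterated shuffle product of its letters. Multiplied by the
  Vandermonde product this is an antisymmetrization, hence divisible by the Vandermonde product, so
  the value is a Laurent polynomial. No arrow goes from a vertex to a larger one; for a word sorted
  by vertex the antisymmetrized numerator is therefore a single monomial, and every monomial arises.
  This gives surjectivity: up to a scalar, a symmetric \<open>f\<close> times the Vandermonde product is its own
  antisymmetrization. For injectivity, the relations rewrite every word into words sorted by vertex
  and, at each vertex, weakly decreasing in the second index. The monomials of such words have
  strictly increasing exponents at each vertex, so their antisymmetrizations (the numerators of
  products of Schur functions) are linearly independent.
\<close>

section \<open>Renaming variables\<close>

text \<open>The value of \<open>shuffle_prod\<close> is a description over fractions, so a product
  is known only once a Laurent polynomial with the right fraction is exhibited. The elements
  \<open>shuffle_elt\<close> provide these: for two of them the shuffle formula, expanded over the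
  permutations of both blocks, consists of as many equal copies of the symmetrization for the
  concatenated word as there are block permutations, and the normalizing factors divide out exactly
  this number. Bilinearity then settles linear combinations, and these are all elements. The shifts
  by one have a common origin. Writing the denominators as \<open>x_v - x_u\<close> puts a factor
  \<open>x_v\<close> into the numerator for each earlier letter at the same vertex, so the j-th
  letter at a vertex, with second index r, carries the exponent -r + j - 1. This is the staircase of
  the bialternant formula for Schur functions. It turns weakly decreasing second indices into
  strictly increasing exponents, and it makes relation (i) the transposition of two exponents, to
  which an antisymmetrization responds with a sign.\<close>

lemma poly_mapping_sum_single:
  "p = (\<Sum>w\<in>Poly_Mapping.keys p. Poly_Mapping.single w (Poly_Mapping.lookup p w))"
  by (rule poly_mapping_eqI) (auto simp: lookup_sum lookup_single when_def in_keys_iff)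

text \<open>Reduces additive identities to single terms. The coefficient may be 0, which covers the
  zero mapping without a separate case.\<close>

lemma poly_mapping_add_induct [case_names single add]:
  fixes f :: "'a \<Rightarrow>\<^sub>0 'b::comm_monoid_add"
  assumes "\<And>k c. P (Poly_Mapping.single k c)"
    and "\<And>f g. P f \<Longrightarrow> P g \<Longrightarrow> P (f + g)"
  shows "P f"
proof -
  have fin: "P (\<Sum>k\<in>A. Poly_Mapping.single k (h k))" if "finite A" for A and h :: "'a \<Rightarrow> 'b"
    using that
  proof induction
    case empty
    have "P (Poly_Mapping.single undefined 0)" by (rule assms)
    then show ?case by simp
  qed (simp add: assms)
  show ?thesis
    by (subst poly_mapping_sum_single) (rule fin[OF finite_keys])
qed

text \<open>The effect of \<open>rename_vars\<close> on exponent vectors. For a non-injective \<rho>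
  the exponents of identified variables add up; the divisibility argument relies on this when it
  sets two variables equal.\<close>

definition ren :: "('x \<Rightarrow> 'y) \<Rightarrow> ('x \<Rightarrow>\<^sub>0 int) \<Rightarrow> ('y \<Rightarrow>\<^sub>0 int)" where
  "ren \<rho> m = (\<Sum>v \<in> Poly_Mapping.keys m. Poly_Mapping.single (\<rho> v) (Poly_Mapping.lookup m v))"

lemma ren_single [simp]: "ren \<rho> (Poly_Mapping.single v k) = Poly_Mapping.single (\<rho> v) k"
  by (simp add: ren_def)

lemma ren_zero [simp]: "ren \<rho> 0 = 0"
  by (simp add: ren_def)

lemma ren_add: "ren \<rho> (m + m') = ren \<rho> m + ren \<rho> m'"
  unfolding ren_def by (rule setsum_keys_plus_distrib) (simp_all add: single_add)

lemma ren_ren: "ren \<rho> (ren \<sigma> m) = ren (\<rho> \<circ> \<sigma>) m"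
  by (induction m rule: poly_mapping_add_induct) (simp_all add: ren_add)

lemma ren_cong: "(\<And>v. v \<in> Poly_Mapping.keys m \<Longrightarrow> \<rho> v = \<sigma> v) \<Longrightarrow> ren \<rho> m = ren \<sigma> m"
  by (simp add: ren_def)

lemma ren_id [simp]: "ren id m = m"
  by (induction m rule: poly_mapping_add_induct) (simp_all add: ren_add)

lemma keys_ren: "Poly_Mapping.keys (ren \<rho> m) \<subseteq> \<rho> ` Poly_Mapping.keys m"
proof -
  have "Poly_Mapping.keys (ren \<rho> m)
      \<subseteq> (\<Union>v\<in>Poly_Mapping.keys m.
          Poly_Mapping.keys (Poly_Mapping.single (\<rho> v) (Poly_Mapping.lookup m v)))"
    unfolding ren_def by (rule keys_sum)
  then show ?thesis by (auto split: if_splits)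
qed

lemma lookup_ren_inj:
  assumes "inj \<rho>"
  shows "Poly_Mapping.lookup (ren \<rho> m) (\<rho> v) = Poly_Mapping.lookup m v"
proof -
  have [simp]: "\<rho> a = \<rho> b \<longleftrightarrow> a = b" for a b using assms by (simp add: inj_eq)
  show ?thesis
    by (induction m rule: poly_mapping_add_induct)
      (simp_all add: ren_add lookup_add lookup_single when_def)
qed

lemma rename_vars_eq_ren:
  "rename_vars \<rho> f =
    (\<Sum>m \<in> Poly_Mapping.keys f. Poly_Mapping.single (ren \<rho> m) (Poly_Mapping.lookup f m))"
  by (simp add: rename_vars_def ren_def)

lemma rename_vars_single [simp]:
  "rename_vars \<rho> (Poly_Mapping.single m c) = Poly_Mapping.single (ren \<rho> m) c"
  by (simp add: rename_vars_eq_ren)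

lemma rename_vars_zero [simp]: "rename_vars \<rho> 0 = 0"
  by (simp add: rename_vars_eq_ren)

lemma rename_vars_one [simp]: "rename_vars \<rho> 1 = 1"
  using rename_vars_single[of \<rho> 0 1] by simp

lemma rename_vars_add: "rename_vars \<rho> (f + g) = rename_vars \<rho> f + rename_vars \<rho> g"
  unfolding rename_vars_eq_ren by (rule setsum_keys_plus_distrib) (simp_all add: single_add)

lemma rename_vars_uminus: "rename_vars \<rho> (- f) = - rename_vars \<rho> f"
  using rename_vars_add[of \<rho> f "- f"] by (simp add: eq_neg_iff_add_eq_0 add.commute)

lemma rename_vars_diff: "rename_vars \<rho> (f - g) = rename_vars \<rho> f - rename_vars \<rho> g"
  using rename_vars_add[of \<rho> f "- g"] by (simp add: rename_vars_uminus)

lemma rename_vars_sum: "rename_vars \<rho> (sum g A) = (\<Sum>a\<in>A. rename_vars \<rho> (g a))"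
  by (induction A rule: infinite_finite_induct) (simp_all add: rename_vars_add)

lemma rename_vars_mult: "rename_vars \<rho> (f * g) = rename_vars \<rho> f * rename_vars \<rho> g"
proof (induction f rule: poly_mapping_add_induct)
  case (single k c)
  show ?case
    by (induction g rule: poly_mapping_add_induct)
      (simp_all add: mult_single ren_add distrib_left rename_vars_add)
qed (simp add: distrib_right rename_vars_add)

lemma rename_vars_prod: "rename_vars \<rho> (prod g A) = (\<Prod>a\<in>A. rename_vars \<rho> (g a))"
  by (induction A rule: infinite_finite_induct) (simp_all add: rename_vars_mult)

lemma rename_vars_power: "rename_vars \<rho> (f ^ k) = rename_vars \<rho> f ^ k"
  by (induction k) (simp_all add: rename_vars_mult)

lemma rename_vars_rename_vars: "rename_vars \<rho> (rename_vars \<sigma> f) = rename_vars (\<rho> \<circ> \<sigma>) f"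
  by (induction f rule: poly_mapping_add_induct) (simp_all add: rename_vars_add ren_ren comp_def)

lemma rename_vars_id [simp]: "rename_vars id f = f"
  by (induction f rule: poly_mapping_add_induct)
    (simp_all add: rename_vars_add ren_id[unfolded id_def] del: ren_id)

definition vars_in :: "('v \<times> nat) set \<Rightarrow> 'v laurent set" where
  "vars_in X = {f. \<forall>m \<in> Poly_Mapping.keys f. Poly_Mapping.keys m \<subseteq> X}"

lemma rename_vars_cong:
  assumes "f \<in> vars_in X" "\<And>v. v \<in> X \<Longrightarrow> \<rho> v = \<sigma> v"
  shows "rename_vars \<rho> f = rename_vars \<sigma> f"
  unfolding rename_vars_eq_ren
proof (rule sum.cong)
  fix m assume "m \<in> Poly_Mapping.keys f"
  then have "ren \<rho> m = ren \<sigma> m"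
    using assms by (intro ren_cong) (auto simp: vars_in_def)
  then show "Poly_Mapping.single (ren \<rho> m) (Poly_Mapping.lookup f m) =
      Poly_Mapping.single (ren \<sigma> m) (Poly_Mapping.lookup f m)" by simp
qed simp

lemma inj_rename_vars:
  assumes "inj \<rho>"
  shows "inj (rename_vars \<rho>)"
proof (rule inj_on_inverseI)
  fix f :: "'a laurent"
  have "inv_into UNIV \<rho> \<circ> \<rho> = id" using assms by simp
  then show "rename_vars (inv_into UNIV \<rho>) (rename_vars \<rho> f) = f"
    by (simp add: rename_vars_rename_vars)
qed

lemma vars_in_single: "Poly_Mapping.keys m \<subseteq> X \<Longrightarrow> Poly_Mapping.single m c \<in> vars_in X"
  by (simp add: vars_in_def)

lemma vars_in_zero: "0 \<in> vars_in X"
  by (simp add: vars_in_def)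

lemma vars_in_one: "1 \<in> vars_in X"
  using vars_in_single[of 0 X 1] by simp

lemma vars_in_add: "f \<in> vars_in X \<Longrightarrow> g \<in> vars_in X \<Longrightarrow> f + g \<in> vars_in X"
  using keys_add[of f g] by (auto simp: vars_in_def)

lemma vars_in_diff: "f \<in> vars_in X \<Longrightarrow> g \<in> vars_in X \<Longrightarrow> f - g \<in> vars_in X"
  unfolding vars_in_def by (auto simp: in_keys_iff lookup_minus) (metis diff_0_right in_keys_iff subsetD)

lemma vars_in_mult:
  fixes f g :: "'v laurent"
  assumes "f \<in> vars_in X" "g \<in> vars_in X"
  shows "f * g \<in> vars_in X"
  unfolding vars_in_def
proof safe
  fix m i j assume "m \<in> Poly_Mapping.keys (f * g)" and v: "(i, j) \<in> Poly_Mapping.keys m"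
  then obtain a b where "m = a + b" "a \<in> Poly_Mapping.keys f" "b \<in> Poly_Mapping.keys g"
    using keys_mult[of f g] by auto
  moreover from this v have "(i, j) \<in> Poly_Mapping.keys a \<union> Poly_Mapping.keys b"
    using keys_add[of a b] by auto
  ultimately show "(i, j) \<in> X" using assms by (auto simp: vars_in_def)
qed

lemma vars_in_sum: "(\<And>a. a \<in> A \<Longrightarrow> g a \<in> vars_in X) \<Longrightarrow> sum g A \<in> vars_in X"
  by (induction A rule: infinite_finite_induct) (auto simp: vars_in_zero vars_in_add)

lemma vars_in_prod: "(\<And>a. a \<in> A \<Longrightarrow> g a \<in> vars_in X) \<Longrightarrow> prod g A \<in> vars_in X"
  by (induction A rule: infinite_finite_induct) (auto simp: vars_in_one vars_in_mult)

lemma vars_in_power: "f \<in> vars_in X \<Longrightarrow> f ^ k \<in> vars_in X"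
  by (induction k) (auto simp: vars_in_one vars_in_mult)

lemma vars_in_rename: 
  assumes "f \<in> vars_in X" shows "rename_vars \<rho> f \<in> vars_in (\<rho> ` X)"
  unfolding rename_vars_eq_ren
proof (intro vars_in_sum vars_in_single)
  fix m assume "m \<in> Poly_Mapping.keys f"
  then have "Poly_Mapping.keys m \<subseteq> X"
    using assms by (auto simp: vars_in_def)
  then show "Poly_Mapping.keys (ren \<rho> m) \<subseteq> \<rho> ` X"
    using keys_ren[of \<rho> m] by blast
qed

section \<open>Divisibility by differences of variables\<close>

definition xvar :: "'v \<times> nat \<Rightarrow> int \<Rightarrow> 'v laurent" where
  "xvar v k = Poly_Mapping.single (Poly_Mapping.single v k) 1"

lemma xpow_eq_xvar: "xpow i j k = xvar (i, j) k"
  by (simp add: xpow_def xvar_def)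

lemma rename_xvar [simp]: "rename_vars \<rho> (xvar v k) = xvar (\<rho> v) k"
  by (simp add: xvar_def)

lemma xvar_zero [simp]: "xvar v 0 = 1"
  by (simp add: xvar_def)

lemma xvar_mult: "xvar v j * xvar v k = xvar v (j + k)"
  by (simp add: xvar_def mult_single single_add)

lemma xvar_power: "xvar v 1 ^ k = xvar v (int k)"
  by (induction k) (simp_all add: xvar_mult)

lemma xvar_neq_0 [simp]: "xvar v k \<noteq> 0"
  by (metis xvar_def single_zero inj_single injD zero_neq_one lookup_single_eq lookup_zero)

lemma xvar_eq_iff: "xvar u 1 = xvar v 1 \<longleftrightarrow> u = v"
proof
  assume "xvar u 1 = xvar v 1"
  then have "Poly_Mapping.keys (xvar u 1) = Poly_Mapping.keys (xvar v 1)" by simp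
  then have "Poly_Mapping.single u (1::int) = Poly_Mapping.single v 1" by (simp add: xvar_def)
  then have "Poly_Mapping.keys (Poly_Mapping.single u (1::int))
      = Poly_Mapping.keys (Poly_Mapping.single v (1::int))" by simp
  then show "u = v" by simp
qed simp

lemma xvar_vars_in: "v \<in> X \<Longrightarrow> xvar v k \<in> vars_in X"
  unfolding xvar_def by (intro vars_in_single) auto

text \<open>For k \<ge> 0 this is the factorization of a difference of powers. A negative k reduces
  to it because the difference equals the unit \<open>xvar v k * xvar u k\<close> times a difference
  of positive powers.\<close>

lemma xvar_diff_dvd:
  fixes u v :: "'v \<times> nat"
  shows "(xvar v 1 - xvar u 1 :: 'v laurent) dvd xvar v k - xvar u k"
proof (cases "k \<ge> 0")
  case True
  then obtain m where k: "k = int m" using zero_le_imp_eq_int by blast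
  show ?thesis
    unfolding k xvar_power[symmetric]
    by (simp add: power_diff_sumr2)
next
  case False
  then obtain m where k: "k = - int m" by (metis int_cases3 linear of_nat_0_le_iff)
  have inv: "xvar w (int m) * xvar w k = 1" for w :: "'v \<times> nat"
    by (simp add: xvar_mult k)
  have "xvar v k - xvar u k
      = (xvar v k * xvar u k) * (xvar u (int m) - xvar v (int m))"
  proof -
    have "(xvar v k * xvar u k) * (xvar u (int m) - xvar v (int m))
        = xvar v k * (xvar u (int m) * xvar u k) - xvar u k * (xvar v (int m) * xvar v k)"
      by (simp only: algebra_simps)
    then show ?thesis by (simp add: inv)
  qed
  moreover have "(xvar v 1 - xvar u 1 :: 'v laurent) dvd xvar u (int m) - xvar v (int m)"
    unfolding xvar_power[symmetric]
    by (subst minus_diff_eq[symmetric], subst dvd_minus_iff) (simp add: power_diff_sumr2)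
  ultimately show ?thesis by (metis dvd_mult)
qed

text \<open>The factor theorem: modulo \<open>x_v - x_u\<close> a Laurent polynomial equals its
  value at \<open>x_v = x_u\<close>. Hence \<open>f\<close> is divisible by the difference as soon
  as the merging substitution kills it.\<close>

lemma merge_dvd:
  fixes f :: "'v laurent"
  shows "(xvar v 1 - xvar u 1) dvd f - rename_vars (id(v := u)) f"
proof (induction f rule: poly_mapping_add_induct)
  case (add f g)
  have "f + g - rename_vars (id(v := u)) (f + g)
      = (f - rename_vars (id(v := u)) f) + (g - rename_vars (id(v := u)) g)"
    by (simp add: rename_vars_add)
  with add show ?case by (metis dvd_add)
next
  case (single m c)
  \<comment> \<open>Only the power of \<open>x_v\<close> is touched by the merging; splitting it off
    leaves the difference of two pure powers.\<close>
  define k where "k = Poly_Mapping.lookup m v"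
  define m0 where "m0 = m - Poly_Mapping.single v k"
  have m: "m = m0 + Poly_Mapping.single v k" by (simp add: m0_def)
  have "v \<notin> Poly_Mapping.keys m0"
    by (simp add: m0_def k_def in_keys_iff lookup_minus)
  then have "ren (id(v := u)) m0 = ren id m0"
    by (intro ren_cong) auto
  then have "ren (id(v := u)) m = m0 + Poly_Mapping.single u k"
    by (simp add: m ren_add)
  then have "Poly_Mapping.single m c - rename_vars (id(v := u)) (Poly_Mapping.single m c)
      = Poly_Mapping.single m0 c * (xvar v k - xvar u k)"
    by (simp add: xvar_def right_diff_distrib mult_single m)
  then show ?case by (metis dvd_mult xvar_diff_dvd)
qed

section \<open>Renaming variables in fractions\<close>

abbreviation emb :: "'a::idom \<Rightarrow> 'a fract" where
  "emb f \<equiv> Fraction_Field.Fract f 1"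

lemma emb_sum:
  fixes g :: "'b \<Rightarrow> 'a::idom"
  shows "emb (sum g A) = (\<Sum>a\<in>A. emb (g a))"
proof -
  have "emb (f + h) = emb f + emb h" for f h :: 'a
    by simp
  then show ?thesis
    by (induction A rule: infinite_finite_induct) (simp_all add: fract_collapse del: add_fract)
qed

lemma Fract_prod:
  "Fraction_Field.Fract (\<Prod>a\<in>A. f a) (\<Prod>a\<in>A. g a) = (\<Prod>a\<in>A. Fraction_Field.Fract (f a) (g a))"
  by (induction A rule: infinite_finite_induct) (simp_all add: fract_collapse flip: mult_fract)

lemma emb_eq_iff: "emb f = emb g \<longleftrightarrow> f = g"
  by (simp add: eq_fract)

lemma Fract_sum_same:
  assumes "d \<noteq> 0"
  shows "(\<Sum>a\<in>A. Fraction_Field.Fract (g a) d) = Fraction_Field.Fract (sum g A) d"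
proof -
  have "(\<Sum>a\<in>A. Fraction_Field.Fract (g a) d) = (\<Sum>a\<in>A. emb (g a) * Fraction_Field.Fract 1 d)"
    by simp
  also have "\<dots> = emb (sum g A) * Fraction_Field.Fract 1 d"
    by (simp only: emb_sum sum_distrib_right)
  finally show ?thesis by simp
qed

lemma rename_eq_0_iff: "inj \<rho> \<Longrightarrow> rename_vars \<rho> f = 0 \<longleftrightarrow> f = 0"
  by (metis inj_rename_vars injD rename_vars_zero)

text \<open>Fractions are classes, so the extension is a description over all representatives. The
  value is unique for injective \<rho>, which keeps denominators nonzero; a merging substitution
  could send a denominator to 0.\<close>

definition fract_rename ::
    "('v::linorder \<times> nat \<Rightarrow> 'v \<times> nat) \<Rightarrow> 'v laurent fract \<Rightarrow> 'v laurent fract" where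
  "fract_rename \<rho> q = (THE r. \<exists>a b. b \<noteq> 0 \<and> q = Fraction_Field.Fract a b \<and>
      r = Fraction_Field.Fract (rename_vars \<rho> a) (rename_vars \<rho> b))"

lemma fract_rename_Fract:
  assumes "inj \<rho>" "b \<noteq> 0"
  shows "fract_rename \<rho> (Fraction_Field.Fract a b)
    = Fraction_Field.Fract (rename_vars \<rho> a) (rename_vars \<rho> b)"
  unfolding fract_rename_def
proof (rule the_equality)
  show "\<exists>a' b'. b' \<noteq> 0 \<and> Fraction_Field.Fract a b = Fraction_Field.Fract a' b' \<and>
      Fraction_Field.Fract (rename_vars \<rho> a) (rename_vars \<rho> b)
      = Fraction_Field.Fract (rename_vars \<rho> a') (rename_vars \<rho> b')"
    using assms by blast
next
  fix r
  assume "\<exists>a' b'. b' \<noteq> 0 \<and> Fraction_Field.Fract a b = Fraction_Field.Fract a' b' \<and>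
      r = Fraction_Field.Fract (rename_vars \<rho> a') (rename_vars \<rho> b')"
  then obtain a' b' where *: "b' \<noteq> 0" "Fraction_Field.Fract a b = Fraction_Field.Fract a' b'"
    "r = Fraction_Field.Fract (rename_vars \<rho> a') (rename_vars \<rho> b')" by blast
  then have "a * b' = a' * b" using assms by (simp add: eq_fract)
  then have "rename_vars \<rho> a * rename_vars \<rho> b' = rename_vars \<rho> a' * rename_vars \<rho> b"
    by (simp flip: rename_vars_mult)
  then show "r = Fraction_Field.Fract (rename_vars \<rho> a) (rename_vars \<rho> b)"
    using * assms by (simp add: eq_fract rename_eq_0_iff)
qed

lemma fract_rename_mult:
  assumes "inj \<rho>"
  shows "fract_rename \<rho> (p * q) = fract_rename \<rho> p * fract_rename \<rho> q"
proof -
  obtain a b c d where "p = Fraction_Field.Fract a b" "q = Fraction_Field.Fract c d" "b \<noteq> 0" "d \<noteq> 0"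
    by (metis Fract_cases)
  then show ?thesis using assms by (simp add: fract_rename_Fract rename_vars_mult)
qed

lemma fract_rename_add:
  assumes "inj \<rho>"
  shows "fract_rename \<rho> (p + q) = fract_rename \<rho> p + fract_rename \<rho> q"
proof -
  obtain a b c d where "p = Fraction_Field.Fract a b" "q = Fraction_Field.Fract c d" "b \<noteq> 0" "d \<noteq> 0"
    by (metis Fract_cases)
  then show ?thesis using assms
    by (simp add: fract_rename_Fract rename_vars_mult rename_vars_add rename_eq_0_iff)
qed

lemma fract_rename_emb: "inj \<rho> \<Longrightarrow> fract_rename \<rho> (emb f) = emb (rename_vars \<rho> f)"
  by (simp add: fract_rename_Fract)

lemma fract_rename_sum:
  assumes "inj \<rho>"
  shows "fract_rename \<rho> (sum g A) = (\<Sum>a\<in>A. fract_rename \<rho> (g a))"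
proof -
  have "fract_rename \<rho> 0 = 0"
    using fract_rename_emb[OF assms, of 0] by (simp add: fract_collapse)
  then show ?thesis
    by (induction A rule: infinite_finite_induct) (simp_all add: fract_rename_add assms)
qed

section \<open>Antisymmetrization\<close>

lemma finite_dim_vars [simp]: "finite (dim_vars \<alpha>)"
  by (simp add: dim_vars_def)

lemma mem_dim_vars: "(i, j) \<in> dim_vars \<alpha> \<longleftrightarrow> 1 \<le> j \<and> j \<le> Poly_Mapping.lookup \<alpha> i"
  by (auto simp: dim_vars_def in_keys_iff)

lemma sym_group_permutes: "\<sigma> \<in> sym_group \<alpha> \<Longrightarrow> \<sigma> permutes dim_vars \<alpha>"
  by (simp add: sym_group_def)

lemma sym_group_fst: "\<sigma> \<in> sym_group \<alpha> \<Longrightarrow> fst (\<sigma> v) = fst v"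
  unfolding sym_group_def by blast

lemma sym_group_inj: "\<sigma> \<in> sym_group \<alpha> \<Longrightarrow> inj \<sigma>"
  using permutes_inj sym_group_permutes by blast

lemma finite_sym_group [simp]: "finite (sym_group \<alpha>)"
  by (rule finite_subset[OF _ finite_permutations[of "dim_vars \<alpha>"]]) (auto simp: sym_group_def)

lemma id_in_sym_group [simp]: "id \<in> sym_group \<alpha>"
  by (simp add: sym_group_def permutes_id)

lemma sym_group_comp: "\<sigma> \<in> sym_group \<alpha> \<Longrightarrow> \<tau> \<in> sym_group \<alpha> \<Longrightarrow> \<sigma> \<circ> \<tau> \<in> sym_group \<alpha>"
proof -
  assume *: "\<sigma> \<in> sym_group \<alpha>" "\<tau> \<in> sym_group \<alpha>"
  then have "\<sigma> \<circ> \<tau> permutes dim_vars \<alpha>"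
    by (intro permutes_compose sym_group_permutes)
  moreover have "fst ((\<sigma> \<circ> \<tau>) v) = fst v" for v
    by (simp only: comp_apply sym_group_fst[OF *(1)] sym_group_fst[OF *(2)])
  ultimately show ?thesis unfolding sym_group_def by blast
qed

lemma sym_group_inv: "\<sigma> \<in> sym_group \<alpha> \<Longrightarrow> inv_into UNIV \<sigma> \<in> sym_group \<alpha>"
proof -
  assume \<sigma>: "\<sigma> \<in> sym_group \<alpha>"
  let ?i = "inv_into UNIV \<sigma>"
  have "?i permutes dim_vars \<alpha>"
    by (rule permutes_inv[OF sym_group_permutes[OF \<sigma>]])
  moreover have "fst (?i v) = fst v" for v
    using sym_group_fst[OF \<sigma>, of "?i v"] permutes_inverses(1)[OF sym_group_permutes[OF \<sigma>]] by simp
  ultimately show ?thesis unfolding sym_group_def by blast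
qed

lemma transpose_in_sym_group:
  assumes "u \<in> dim_vars \<alpha>" "v \<in> dim_vars \<alpha>" "fst u = fst v"
  shows "transpose u v \<in> sym_group \<alpha>"
proof -
  have "transpose u v permutes dim_vars \<alpha>"
    by (rule permutes_swap_id[OF assms(1,2)])
  moreover have "fst (transpose u v w) = fst w" for w
    using assms(3) unfolding transpose_def by (metis (full_types))
  ultimately show ?thesis unfolding sym_group_def by blast
qed

lemma card_sym_group_pos: "card (sym_group \<alpha>) > 0"
  by (metis card_gt_0_iff finite_sym_group id_in_sym_group empty_iff)

lemma sum_sym_group_comp:
  assumes "\<tau> \<in> sym_group \<alpha>"
  shows "(\<Sum>\<sigma>\<in>sym_group \<alpha>. g (\<sigma> \<circ> \<tau>)) = (\<Sum>\<sigma>\<in>sym_group \<alpha>. g \<sigma>)"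
proof -
  let ?i = "inv_into UNIV \<tau>"
  have i: "?i \<in> sym_group \<alpha>" by (rule sym_group_inv[OF assms])
  have 1: "\<tau> \<circ> ?i = id" "?i \<circ> \<tau> = id"
    using sym_group_permutes[OF assms] by (simp_all add: permutes_inv_o)
  show ?thesis
    by (rule sum.reindex_bij_witness[where i = "\<lambda>\<sigma>. \<sigma> \<circ> ?i" and j = "\<lambda>\<sigma>. \<sigma> \<circ> \<tau>"])
      (simp_all add: comp_assoc 1 i assms sym_group_comp)
qed

lemma sum_sym_group_comp_left:
  assumes "\<tau> \<in> sym_group \<alpha>"
  shows "(\<Sum>\<sigma>\<in>sym_group \<alpha>. g (\<tau> \<circ> \<sigma>)) = (\<Sum>\<sigma>\<in>sym_group \<alpha>. g \<sigma>)"
proof -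
  let ?i = "inv_into UNIV \<tau>"
  have i: "?i \<in> sym_group \<alpha>" by (rule sym_group_inv[OF assms])
  have 1: "\<tau> \<circ> ?i = id" "?i \<circ> \<tau> = id"
    using sym_group_permutes[OF assms] by (simp_all add: permutes_inv_o)
  show ?thesis
    by (rule sum.reindex_bij_witness[where i = "\<lambda>\<sigma>. ?i \<circ> \<sigma>" and j = "\<lambda>\<sigma>. \<tau> \<circ> \<sigma>"])
      (simp_all add: 1 i assms sym_group_comp flip: comp_assoc)
qed

section \<open>The Vandermonde product and the sign character\<close>

definition vpairs :: "('v \<times> nat) set \<Rightarrow> (('v \<times> nat) \<times> ('v \<times> nat)) set" where
  "vpairs X = {(u, v). u \<in> X \<and> v \<in> X \<and> fst u = fst v \<and> snd u < snd v}"

lemma finite_vpairs [simp]: "finite X \<Longrightarrow> finite (vpairs X)"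
  by (rule finite_subset[of _ "X \<times> X"]) (auto simp: vpairs_def)

text \<open>For \<open>X = dim_vars \<alpha>\<close> this is the product, over the vertices, of the
  Vandermonde determinants in the variables at each vertex.\<close>

definition vandermonde :: "('v \<times> nat) set \<Rightarrow> 'v laurent" where
  "vandermonde X = (\<Prod>p\<in>vpairs X. xvar (snd p) 1 - xvar (fst p) 1)"

lemma vandermonde_neq_0:
  fixes X :: "('v::linorder \<times> nat) set"
  assumes "finite X" shows "vandermonde X \<noteq> 0"
proof -
  have "fst p \<noteq> snd p" if "p \<in> vpairs X" for p
    using that by (auto simp: vpairs_def)
  then have "\<forall>p\<in>vpairs X. xvar (snd p) 1 - xvar (fst p) 1 \<noteq> (0 :: 'v laurent)"
    by (simp add: xvar_eq_iff) metis
  then show ?thesis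
    unfolding vandermonde_def using assms by (subst prod_zero_iff) auto
qed

lemma vandermonde_vars_in: "vandermonde X \<in> vars_in X"
  unfolding vandermonde_def by (auto simp: vpairs_def intro!: vars_in_prod vars_in_diff xvar_vars_in)

text \<open>An element of \<open>sym_group\<close> permutes the unordered pairs of variables at a
  common vertex, so each factor returns up to a sign.\<close>

lemma rename_vandermonde_cases:
  assumes s: "\<sigma> \<in> sym_group \<alpha>"
  shows "rename_vars \<sigma> (vandermonde (dim_vars \<alpha>)) = vandermonde (dim_vars \<alpha>) \<or>
    rename_vars \<sigma> (vandermonde (dim_vars \<alpha>)) = - vandermonde (dim_vars \<alpha>)"
proof -
  let ?P = "vpairs (dim_vars \<alpha>)"
  define up where "up p \<longleftrightarrow> snd (\<sigma> (fst p)) < snd (\<sigma> (snd p))" for p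
  \<comment> \<open>The image pair, put back into increasing order; \<open>up\<close> records
    whether a sign is lost in doing so.\<close>
  define \<pi> where "\<pi> p = (if up p then (\<sigma> (fst p), \<sigma> (snd p)) else (\<sigma> (snd p), \<sigma> (fst p)))" for p
  define d :: "('a \<times> nat) \<times> ('a \<times> nat) \<Rightarrow> 'a laurent"
    where "d p = xvar (snd p) 1 - xvar (fst p) 1" for p
  have inj: "\<sigma> a = \<sigma> b \<longleftrightarrow> a = b" for a b
    using sym_group_inj[OF s] by (simp add: inj_eq)
  have mem: "\<sigma> a \<in> dim_vars \<alpha>" if "a \<in> dim_vars \<alpha>" for a
    using that permutes_in_image[OF sym_group_permutes[OF s]] by blast
  have into: "\<pi> p \<in> ?P" if p: "p \<in> ?P" for p
  proof -
    obtain u v where uv: "p = (u, v)" by (cases p)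
    with p have "u \<noteq> v" "fst u = fst v" "u \<in> dim_vars \<alpha>" "v \<in> dim_vars \<alpha>"
      by (auto simp: vpairs_def)
    moreover have "snd (\<sigma> u) \<noteq> snd (\<sigma> v)"
      using calculation by (metis inj prod_eqI s sym_group_fst)
    ultimately show ?thesis
      by (auto simp: \<pi>_def up_def uv vpairs_def mem sym_group_fst[OF s])
  qed
  have "inj_on \<pi> ?P"
  proof (rule inj_onI)
    fix p q assume "p \<in> ?P" "q \<in> ?P" "\<pi> p = \<pi> q"
    then show "p = q"
      by (cases p; cases q) (auto simp: \<pi>_def inj vpairs_def split: if_splits)
  qed
  then have img: "\<pi> ` ?P = ?P"
    using into by (metis endo_inj_surj finite_dim_vars finite_vpairs image_subsetI)
  have "rename_vars \<sigma> (vandermonde (dim_vars \<alpha>)) = (\<Prod>p\<in>?P. (if up p then 1 else -1) * d (\<pi> p))"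
    unfolding vandermonde_def rename_vars_prod
    by (rule prod.cong) (auto simp: d_def \<pi>_def rename_vars_diff)
  also have "\<dots> = (\<Prod>p\<in>?P. if up p then 1 else -1) * (\<Prod>p\<in>?P. d (\<pi> p))"
    by (rule prod.distrib)
  also have "(\<Prod>p\<in>?P. d (\<pi> p)) = prod d (\<pi> ` ?P)"
    using \<open>inj_on \<pi> ?P\<close> by (simp add: prod.reindex)
  also have "\<dots> = vandermonde (dim_vars \<alpha>)"
    by (simp add: img vandermonde_def d_def)
  finally have *: "rename_vars \<sigma> (vandermonde (dim_vars \<alpha>))
      = (\<Prod>p\<in>?P. if up p then 1 else -1) * vandermonde (dim_vars \<alpha>)" .
  have "(\<Prod>p\<in>Z. if up p then 1 else -1 :: 'a laurent) \<in> {1, -1}" for Z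
    by (induction Z rule: infinite_finite_induct) auto
  with * show ?thesis by (metis (no_types, lifting) insert_iff mult_1 mult_minus1 singletonD)
qed

text \<open>The product of the signs of the permutations at the vertices, read off from the action
  on the Vandermonde product. In this form multiplicativity follows by cancelling the Vandermonde
  product, while the value at a transposition becomes a theorem. It takes values in the Laurent
  polynomials so that it can multiply them directly.\<close>

definition eps :: "'v dimvec \<Rightarrow> ('v \<times> nat \<Rightarrow> 'v \<times> nat) \<Rightarrow> 'v laurent" where
  "eps \<alpha> \<sigma> = (if rename_vars \<sigma> (vandermonde (dim_vars \<alpha>)) = vandermonde (dim_vars \<alpha>) then 1 else -1)"

lemma rename_vandermonde:
  assumes "\<sigma> \<in> sym_group \<alpha>"
  shows "rename_vars \<sigma> (vandermonde (dim_vars \<alpha>)) = eps \<alpha> \<sigma> * vandermonde (dim_vars \<alpha>)"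
  using rename_vandermonde_cases[OF assms] by (auto simp: eps_def)

lemma rename_eps [simp]: "rename_vars \<rho> (eps \<alpha> \<sigma>) = eps \<alpha> \<sigma>"
  by (simp add: eps_def rename_vars_uminus)

lemma eps_square [simp]: "eps \<alpha> \<sigma> * eps \<alpha> \<sigma> = 1"
  by (simp add: eps_def)

lemma eps_id [simp]: "eps \<alpha> id = 1"
  by (simp add: eps_def)

lemma eps_comp:
  fixes \<alpha> :: "'v::linorder dimvec"
  assumes "\<sigma> \<in> sym_group \<alpha>" "\<tau> \<in> sym_group \<alpha>"
  shows "eps \<alpha> (\<sigma> \<circ> \<tau>) = eps \<alpha> \<sigma> * eps \<alpha> \<tau>"
proof -
  have "eps \<alpha> (\<sigma> \<circ> \<tau>) * vandermonde (dim_vars \<alpha>)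
      = rename_vars \<sigma> (rename_vars \<tau> (vandermonde (dim_vars \<alpha>)))"
    by (simp add: rename_vandermonde[OF sym_group_comp[OF assms], symmetric] rename_vars_rename_vars)
  also have "\<dots> = eps \<alpha> \<sigma> * eps \<alpha> \<tau> * vandermonde (dim_vars \<alpha>)"
    by (simp add: rename_vandermonde assms rename_vars_mult mult_ac)
  finally show ?thesis by (simp add: vandermonde_neq_0)
qed

definition antisymmetrize :: "'v dimvec \<Rightarrow> 'v laurent \<Rightarrow> 'v laurent" where
  "antisymmetrize \<alpha> f = (\<Sum>\<sigma>\<in>sym_group \<alpha>. eps \<alpha> \<sigma> * rename_vars \<sigma> f)"

text \<open>Right translation of the group by \<tau>, together with the fact that
  \<open>eps \<alpha> \<tau>\<close> is its own inverse. The companion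
  \<open>rename_antisymmetrize\<close> uses left translation.\<close>

lemma antisymmetrize_rename:
  fixes \<alpha> :: "'v::linorder dimvec"
  assumes t: "\<tau> \<in> sym_group \<alpha>"
  shows "antisymmetrize \<alpha> (rename_vars \<tau> f) = eps \<alpha> \<tau> * antisymmetrize \<alpha> f"
proof -
  have "antisymmetrize \<alpha> (rename_vars \<tau> f)
      = (\<Sum>\<sigma>\<in>sym_group \<alpha>. eps \<alpha> \<tau> * (eps \<alpha> (\<sigma> \<circ> \<tau>) * rename_vars (\<sigma> \<circ> \<tau>) f))"
    unfolding antisymmetrize_def rename_vars_rename_vars
  proof (rule sum.cong)
    fix \<sigma> assume "\<sigma> \<in> sym_group \<alpha>"
    then have "eps \<alpha> \<tau> * eps \<alpha> (\<sigma> \<circ> \<tau>) = eps \<alpha> \<sigma> * (eps \<alpha> \<tau> * eps \<alpha> \<tau>)"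
      using t by (simp only: eps_comp mult_ac)
    then show "eps \<alpha> \<sigma> * rename_vars (\<sigma> \<circ> \<tau>) f
        = eps \<alpha> \<tau> * (eps \<alpha> (\<sigma> \<circ> \<tau>) * rename_vars (\<sigma> \<circ> \<tau>) f)"
      by (simp flip: mult.assoc)
  qed simp
  also have "\<dots> = (\<Sum>\<sigma>\<in>sym_group \<alpha>. eps \<alpha> \<tau> * (eps \<alpha> \<sigma> * rename_vars \<sigma> f))"
    by (rule sum_sym_group_comp[OF t])
  finally show ?thesis by (simp add: antisymmetrize_def sum_distrib_left)
qed

lemma rename_antisymmetrize:
  fixes \<alpha> :: "'v::linorder dimvec"
  assumes t: "\<tau> \<in> sym_group \<alpha>"
  shows "rename_vars \<tau> (antisymmetrize \<alpha> f) = eps \<alpha> \<tau> * antisymmetrize \<alpha> f"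
proof -
  have "rename_vars \<tau> (antisymmetrize \<alpha> f)
      = (\<Sum>\<sigma>\<in>sym_group \<alpha>. eps \<alpha> \<tau> * (eps \<alpha> (\<tau> \<circ> \<sigma>) * rename_vars (\<tau> \<circ> \<sigma>) f))"
    unfolding antisymmetrize_def rename_vars_sum rename_vars_mult rename_vars_rename_vars rename_eps
  proof (rule sum.cong)
    fix \<sigma> assume "\<sigma> \<in> sym_group \<alpha>"
    then have "eps \<alpha> \<tau> * eps \<alpha> (\<tau> \<circ> \<sigma>) = eps \<alpha> \<sigma> * (eps \<alpha> \<tau> * eps \<alpha> \<tau>)"
      using t by (simp only: eps_comp mult_ac)
    then show "eps \<alpha> \<sigma> * rename_vars (\<tau> \<circ> \<sigma>) f
        = eps \<alpha> \<tau> * (eps \<alpha> (\<tau> \<circ> \<sigma>) * rename_vars (\<tau> \<circ> \<sigma>) f)"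
      by (simp flip: mult.assoc)
  qed simp
  also have "\<dots> = (\<Sum>\<sigma>\<in>sym_group \<alpha>. eps \<alpha> \<tau> * (eps \<alpha> \<sigma> * rename_vars \<sigma> f))"
    by (rule sum_sym_group_comp_left[OF t])
  finally show ?thesis by (simp add: antisymmetrize_def sum_distrib_left)
qed

lemma antisymmetrize_add: "antisymmetrize \<alpha> (f + g) = antisymmetrize \<alpha> f + antisymmetrize \<alpha> g"
  by (simp add: antisymmetrize_def rename_vars_add distrib_left sum.distrib)

lemma antisymmetrize_diff: "antisymmetrize \<alpha> (f - g) = antisymmetrize \<alpha> f - antisymmetrize \<alpha> g"
  by (simp add: antisymmetrize_def rename_vars_diff right_diff_distrib sum_subtractf)

lemma antisymmetrize_sum: "antisymmetrize \<alpha> (sum g A) = (\<Sum>a\<in>A. antisymmetrize \<alpha> (g a))"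
  by (induction A rule: infinite_finite_induct) (simp_all add: antisymmetrize_add, simp_all add: antisymmetrize_def)

lemma antisymmetrize_scale: "antisymmetrize \<alpha> (Poly_Mapping.single 0 c * f) = Poly_Mapping.single 0 c * antisymmetrize \<alpha> f"
  by (simp add: antisymmetrize_def rename_vars_mult sum_distrib_left mult_ac)

lemma antisymmetrize_vars_in:
  assumes "f \<in> vars_in (dim_vars \<alpha>)"
  shows "antisymmetrize \<alpha> f \<in> vars_in (dim_vars \<alpha>)"
proof -
  have "rename_vars \<sigma> f \<in> vars_in (dim_vars \<alpha>)" if "\<sigma> \<in> sym_group \<alpha>" for \<sigma>
    using vars_in_rename[OF assms, of \<sigma>] permutes_image[OF sym_group_permutes[OF that]] by simp
  moreover have "eps \<alpha> \<sigma> \<in> vars_in (dim_vars \<alpha>)" for \<sigma>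
    using vars_in_diff[OF vars_in_zero vars_in_one, of "dim_vars \<alpha>"] by (simp add: eps_def vars_in_one)
  ultimately show ?thesis
    unfolding antisymmetrize_def by (intro vars_in_sum vars_in_mult)
qed

section \<open>Divisibility of antisymmetrizations by the Vandermonde product\<close>

lemma laurent_eq_uminus_self: 
  fixes f :: "'v::linorder laurent"
  assumes "f = - f" shows "f = 0"
proof -
  have "2 * f = 0" using assms by (metis add.right_inverse mult_2)
  moreover have "(2 :: 'v laurent) \<noteq> 0"
    by (metis lookup_numeral lookup_zero when_simps(1) zero_neq_numeral)
  ultimately show ?thesis by (metis mult_eq_0_iff)
qed

text \<open>Swapping u and v is invisible once the two are merged, so the merged polynomial equals
  its own negative.\<close>

lemma merge_eq_0:
  fixes f :: "'v::linorder laurent"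
  assumes "rename_vars (transpose u v) f = - f"
  shows "rename_vars (id(v := u)) f = 0"
proof -
  have "id(v := u) \<circ> transpose u v = id(v := u)"
    by (auto simp: fun_eq_iff transpose_def)
  then have "rename_vars (id(v := u)) f = rename_vars (id(v := u)) (rename_vars (transpose u v) f)"
    by (simp add: rename_vars_rename_vars)
  also have "\<dots> = - rename_vars (id(v := u)) f"
    by (simp add: assms rename_vars_uminus)
  finally show ?thesis by (rule laurent_eq_uminus_self)
qed

text \<open>Merging v into u identifies only these two variables, and \<open>vpairs\<close> contains
  them in one order only; every factor other than the one of (u, v) therefore survives.\<close>

lemma merge_prod_neq_0:
  fixes X :: "('v::linorder \<times> nat) set"
  assumes "finite X" "Z \<subseteq> vpairs X" "(u, v) \<in> vpairs X" "(u, v) \<notin> Z"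
  shows "rename_vars (id(v := u)) (\<Prod>p\<in>Z. xvar (snd p) 1 - xvar (fst p) 1) \<noteq> 0"
proof -
  have "finite Z" using assms finite_subset finite_vpairs by blast
  moreover have "(id(v := u)) (snd p) \<noteq> (id(v := u)) (fst p)" if "p \<in> Z" for p
    using that assms by (cases p) (auto simp: vpairs_def)
  ultimately show ?thesis
    by (simp add: rename_vars_prod rename_vars_diff xvar_eq_iff)
qed

text \<open>
  If the sign were \<open>1\<close>, the cofactor of \<open>x\<^sub>v - x\<^sub>u\<close> in the Vandermonde product would be antisymmetric in
  \<open>u\<close> and \<open>v\<close>, hence vanish at \<open>x\<^sub>v = x\<^sub>u\<close>.
\<close>

lemma eps_transpose:
  fixes \<alpha> :: "'v::linorder dimvec"
  assumes uv: "(u, v) \<in> vpairs (dim_vars \<alpha>)"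
  shows "eps \<alpha> (transpose u v) = -1"
proof (rule ccontr)
  let ?D = "vandermonde (dim_vars \<alpha>)" and ?t = "transpose u v"
  let ?R = "\<Prod>p\<in>vpairs (dim_vars \<alpha>) - {(u, v)}. xvar (snd p) 1 - xvar (fst p) 1 :: 'v laurent"
  assume "eps \<alpha> ?t \<noteq> -1"
  then have inv: "rename_vars ?t ?D = ?D" by (auto simp: eps_def split: if_splits)
  have D: "?D = (xvar v 1 - xvar u 1) * ?R"
    unfolding vandermonde_def using uv by (subst prod.remove[of _ "(u, v)"]) auto
  have neq: "u \<noteq> v" using uv by (auto simp: vpairs_def)
  have "(xvar v 1 - xvar u 1) * (- rename_vars ?t ?R) = rename_vars ?t ?D"
  proof -
    have *: "(a - b) * c = (b - a) * (- c)" for a b c :: "'v laurent"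
      by (simp add: algebra_simps)
    have "rename_vars ?t ?D = (xvar u 1 - xvar v 1) * rename_vars ?t ?R"
      unfolding D rename_vars_mult rename_vars_diff by simp
    also have "\<dots> = (xvar v 1 - xvar u 1) * (- rename_vars ?t ?R)"
      by (rule *)
    finally show ?thesis ..
  qed
  then have "(xvar v 1 - xvar u 1) * (- rename_vars ?t ?R) = (xvar v 1 - xvar u 1) * ?R"
    by (rule trans[OF _ trans[OF inv D]])
  then have "- rename_vars ?t ?R = ?R"
    by (rule mult_left_cancel[THEN iffD1, rotated]) (use neq in \<open>simp add: xvar_eq_iff\<close>)
  then have "rename_vars ?t ?R = - ?R"
    unfolding equation_minus_iff[of "rename_vars ?t ?R"] by (rule sym)
  then have "rename_vars (id(v := u)) ?R = 0" by (rule merge_eq_0)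
  then show False using merge_prod_neq_0[OF _ _ uv, of "vpairs (dim_vars \<alpha>) - {(u, v)}"] by simp
qed

text \<open>
  The factors are split off one at a time: setting \<open>x\<^sub>v = x\<^sub>u\<close> kills an antisymmetrization but none of
  the other factors, so it kills the remaining quotient.
\<close>

lemma vandermonde_dvd_antisymmetrize:
  fixes \<alpha> :: "'v::linorder dimvec"
  shows "vandermonde (dim_vars \<alpha>) dvd antisymmetrize \<alpha> f"
proof -
  let ?P = "vpairs (dim_vars \<alpha>)" and ?G = "antisymmetrize \<alpha> f"
  have "(\<Prod>p\<in>Z. xvar (snd p) 1 - xvar (fst p) 1) dvd ?G" if "finite Z" "Z \<subseteq> ?P" for Z
    using that
  proof induction
    case (insert p Z)
    obtain u v where p: "p = (u, v)" by (cases p)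
    with insert have uv: "(u, v) \<in> ?P" by simp
    then have "rename_vars (transpose u v) ?G = - ?G"
      by (subst rename_antisymmetrize)
        (auto simp: eps_transpose vpairs_def intro!: transpose_in_sym_group)
    then have 0: "rename_vars (id(v := u)) ?G = 0" by (rule merge_eq_0)
    obtain h where h: "?G = (\<Prod>p\<in>Z. xvar (snd p) 1 - xvar (fst p) 1) * h"
      using insert by (auto elim: dvdE)
    have "rename_vars (id(v := u)) h = 0"
      using 0 merge_prod_neq_0[OF finite_dim_vars _ uv, of Z] insert p
      unfolding h rename_vars_mult by simp
    then have "(xvar v 1 - xvar u 1) dvd h"
      using merge_dvd[of v u h] by simp
    then show ?case using insert by (simp add: h p mult.commute mult_dvd_mono)
  qed simp
  then show ?thesis unfolding vandermonde_def by simp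
qed

section \<open>Shuffle elements of words\<close>

definition wt :: "'v list \<Rightarrow> 'v dimvec" where
  "wt xs = (\<Sum>i\<leftarrow>xs. unit_dim i)"

text \<open>The substitution that \<open>shuffle_num\<close> applies to its second factor.\<close>

definition shift :: "'v dimvec \<Rightarrow> 'v \<times> nat \<Rightarrow> 'v \<times> nat" where
  "shift \<alpha> = (\<lambda>(i, j). (i, Poly_Mapping.lookup \<alpha> i + j))"

text \<open>The \<open>p\<close>-th letter of a word, when it is the \<open>j\<close>-th occurrence of the vertex \<open>i\<close>, carries \<open>x\<^sub>i\<^sub>j\<close>.\<close>

fun pos :: "'v list \<Rightarrow> ('v \<times> nat) list" where
  "pos [] = []"
| "pos (i # xs) = (i, 1) # map (shift (unit_dim i)) (pos xs)"

text \<open>The second index is negated because the generator with index r is sent to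
  \<open>x_{i,1}^{-r}\<close>.\<close>

definition lab :: "('v \<times> int) list \<Rightarrow> (('v \<times> nat) \<times> int) list" where
  "lab w = zip (pos (map fst w)) (map (\<lambda>p. - snd p) w)"

lemma wt_simps [simp]: "wt [] = 0" "wt (i # xs) = unit_dim i + wt xs" "wt (xs @ ys) = wt xs + wt ys"
  by (simp_all add: wt_def)

lemma lookup_unit_dim: "Poly_Mapping.lookup (unit_dim i) k = (if k = i then 1 else 0)"
  by (simp add: unit_dim_def lookup_single when_def)

lemma lookup_wt: "Poly_Mapping.lookup (wt xs) i = count_list xs i"
  by (induction xs) (simp_all add: lookup_add lookup_unit_dim)

lemma shift_simps [simp]:
  "fst (shift \<alpha> v) = fst v" "snd (shift \<alpha> v) = Poly_Mapping.lookup \<alpha> (fst v) + snd v"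
  by (simp_all add: shift_def split_def)

lemma shift_comp: "shift \<alpha> \<circ> shift \<beta> = shift (\<alpha> + \<beta>)"
  by (simp add: shift_def fun_eq_iff lookup_add)

lemma shift_zero [simp]: "shift 0 = id"
  by (simp add: shift_def fun_eq_iff)

lemma inj_shift [simp]: "inj (shift \<alpha>)"
  by (rule injI) (metis add_left_cancel prod_eqI shift_simps)

lemma dim_vars_add: "dim_vars (\<alpha> + \<beta>) = dim_vars \<alpha> \<union> shift \<alpha> ` dim_vars \<beta>"
proof (rule Set.set_eqI)
  fix v :: "'a \<times> nat"
  obtain i j where v: "v = (i, j)" by (cases v)
  have "v \<in> shift \<alpha> ` dim_vars \<beta> \<longleftrightarrow>
      Poly_Mapping.lookup \<alpha> i < j \<and> j \<le> Poly_Mapping.lookup \<alpha> i + Poly_Mapping.lookup \<beta> i"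
  proof
    assume R: "Poly_Mapping.lookup \<alpha> i < j \<and> j \<le> Poly_Mapping.lookup \<alpha> i + Poly_Mapping.lookup \<beta> i"
    then have "(i, j - Poly_Mapping.lookup \<alpha> i) \<in> dim_vars \<beta>"
      unfolding mem_dim_vars by linarith
    moreover have "v = shift \<alpha> (i, j - Poly_Mapping.lookup \<alpha> i)"
      using R by (simp add: v shift_def)
    ultimately show "v \<in> shift \<alpha> ` dim_vars \<beta>" by blast
  qed (auto simp: v shift_def mem_dim_vars)
  then show "v \<in> dim_vars (\<alpha> + \<beta>) \<longleftrightarrow> v \<in> dim_vars \<alpha> \<union> shift \<alpha> ` dim_vars \<beta>"
    unfolding v Un_iff mem_dim_vars lookup_add by linarith
qed

lemma dim_vars_zero [simp]: "dim_vars 0 = {}"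
  by (simp add: dim_vars_def)

lemma dim_vars_unit [simp]: "dim_vars (unit_dim i) = {(i, 1)}"
  by (auto simp: dim_vars_def unit_dim_def)

lemma length_pos [simp]: "length (pos xs) = length xs"
  by (induction xs) simp_all

lemma map_fst_pos [simp]: "map fst (pos xs) = xs"
  by (induction xs) (simp_all add: comp_def)

lemma set_pos: "set (pos xs) = dim_vars (wt xs)"
  by (induction xs) (simp_all add: dim_vars_add)

lemma snd_pos_pos: "v \<in> set (pos xs) \<Longrightarrow> snd v > 0"
  by (cases v) (simp add: set_pos mem_dim_vars)

lemma sorted_pos: "sorted_wrt (\<lambda>u v. fst u = fst v \<longrightarrow> snd u < snd v) (pos xs)"
proof (induction xs)
  case (Cons i xs)
  then show ?case
    by (auto simp: sorted_wrt_map lookup_unit_dim dest: snd_pos_pos elim!: sorted_wrt_mono_rel[rotated])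
qed simp

lemma distinct_pos: "distinct (pos xs)"
  using sorted_pos[of xs] by (induction "pos xs" arbitrary: xs rule: rev_induct; 
      simp add: distinct_conv_nth sorted_wrt_iff_nth_less) (metis less_irrefl nat_neq_iff)

definition relabel :: "('v \<times> nat \<Rightarrow> 'v \<times> nat) \<Rightarrow> (('v \<times> nat) \<times> int) list \<Rightarrow> (('v \<times> nat) \<times> int) list" where
  "relabel \<rho> l = map (map_prod \<rho> id) l"

lemma relabel_simps [simp]:
  "relabel \<rho> [] = []"
  "relabel \<rho> ((u, r) # l) = (\<rho> u, r) # relabel \<rho> l"
  "relabel \<rho> (l @ l') = relabel \<rho> l @ relabel \<rho> l'"
  "map fst (relabel \<rho> l) = map \<rho> (map fst l)"
  by (simp_all add: relabel_def)

lemma relabel_relabel: "relabel \<rho> (relabel \<sigma> l) = relabel (\<rho> \<circ> \<sigma>) l"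
  by (auto simp: relabel_def)

lemma relabel_id [simp]: "relabel id l = l" "relabel (\<lambda>v. v) l = l"
  by (induction l) auto

lemma relabel_cong: "(\<And>u. u \<in> set (map fst l) \<Longrightarrow> \<rho> u = \<sigma> u) \<Longrightarrow> relabel \<rho> l = relabel \<sigma> l"
  by (induction l) force+

lemma map_fst_lab [simp]: "map fst (lab w) = pos (map fst w)"
  by (simp add: lab_def)

lemma lab_Nil [simp]: "lab [] = []"
  by (simp add: lab_def)

lemma lab_Cons: "lab ((i, r) # w) = ((i, 1), - r) # relabel (shift (unit_dim i)) (lab w)"
  by (simp add: lab_def relabel_def zip_map1) (simp add: split_def map_prod_def)

text \<open>The occurrence numbers of the second word continue those of the first; this is the same
  shift that the shuffle product performs.\<close>

lemma lab_append: "lab (u @ v) = lab u @ relabel (shift (wt (map fst u))) (lab v)"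
proof (induction u)
  case (Cons p u)
  then show ?case by (cases p) (simp add: lab_Cons relabel_relabel shift_comp)
qed simp

text \<open>
  The denominators \<open>1 - x\<^sub>u / x\<^sub>v\<close> of the shuffle formula are replaced by \<open>x\<^sub>v - x\<^sub>u\<close>, whose product is a
  Vandermonde product; this puts the additional factor \<open>x\<^sub>v\<close> into the numerator.
\<close>

definition kern_num :: "('v, 'e) pre_digraph \<Rightarrow> 'v \<times> nat \<Rightarrow> 'v \<times> nat \<Rightarrow> 'v laurent" where
  "kern_num Q u v = (1 - xvar u 1 * xvar v (-1)) ^ num_arrows Q (fst u) (fst v)
     * (if fst u = fst v then xvar v 1 else 1)"

definition kern_den :: "'v \<times> nat \<Rightarrow> 'v \<times> nat \<Rightarrow> 'v laurent" where
  "kern_den u v = (if fst u = fst v then xvar v 1 - xvar u 1 else 1)"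

text \<open>The numerator of the iterated shuffle product before symmetrization: one kernel factor
  for each pair of letters, with the left letter as first argument.\<close>

fun word_num :: "('v, 'e) pre_digraph \<Rightarrow> (('v \<times> nat) \<times> int) list \<Rightarrow> 'v laurent" where
  "word_num Q [] = 1"
| "word_num Q ((u, r) # l) = xvar u r * (\<Prod>v\<leftarrow>map fst l. kern_num Q u v) * word_num Q l"

fun word_den :: "('v \<times> nat) list \<Rightarrow> 'v laurent" where
  "word_den [] = 1"
| "word_den (u # us) = (\<Prod>v\<leftarrow>us. kern_den u v) * word_den us"

lemma word_num_append:
  "word_num Q (l @ l') = word_num Q l * word_num Q l' *
    (\<Prod>u\<leftarrow>map fst l. \<Prod>v\<leftarrow>map fst l'. kern_num Q u v)"
  by (induction l) (auto simp: mult_ac)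

lemma word_den_append:
  "word_den (us @ vs) = word_den us * word_den vs * (\<Prod>u\<leftarrow>us. \<Prod>v\<leftarrow>vs. kern_den u v)"
  by (induction us) (auto simp: mult_ac)

lemma rename_prod_list: "rename_vars \<rho> (\<Prod>a\<leftarrow>as. g a) = (\<Prod>a\<leftarrow>as. rename_vars \<rho> (g a))"
  by (induction as) (simp_all add: rename_vars_mult)

lemma rename_kern_num: "(\<And>v. fst (\<rho> v) = fst v) \<Longrightarrow> rename_vars \<rho> (kern_num Q u v) = kern_num Q (\<rho> u) (\<rho> v)"
  by (simp add: kern_num_def rename_vars_mult rename_vars_diff rename_vars_power del: split_paired_All)

lemma rename_kern_den: "(\<And>v. fst (\<rho> v) = fst v) \<Longrightarrow> rename_vars \<rho> (kern_den u v) = kern_den (\<rho> u) (\<rho> v)"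
  by (simp add: kern_den_def rename_vars_diff del: split_paired_All)

lemma rename_word_num:
  assumes "\<And>v. fst (\<rho> v) = fst v"
  shows "rename_vars \<rho> (word_num Q l) = word_num Q (relabel \<rho> l)"
proof (induction l)
  case (Cons p l)
  obtain u r where p: "p = (u, r)" by (cases p)
  have "(\<Prod>v\<leftarrow>map fst l. kern_num Q (\<rho> u) (\<rho> v)) = (\<Prod>v\<leftarrow>map \<rho> (map fst l). kern_num Q (\<rho> u) v)"
    by (simp only: map_map comp_def)
  then show ?case
    unfolding p word_num.simps relabel_simps rename_vars_mult rename_prod_list
      rename_kern_num[OF assms] rename_xvar Cons by (simp only:)
qed simp

lemma rename_word_den:
  assumes "\<And>v. fst (\<rho> v) = fst v"
  shows "rename_vars \<rho> (word_den us) = word_den (map \<rho> us)"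
  by (induction us) (simp_all add: rename_vars_mult rename_prod_list rename_kern_den[OF assms] comp_def)

lemma kern_den_neq_0: "u \<noteq> v \<Longrightarrow> kern_den u v \<noteq> 0"
  by (simp add: kern_den_def xvar_eq_iff)

lemma word_den_neq_0:
  fixes us :: "('v::linorder \<times> nat) list"
  shows "distinct us \<Longrightarrow> word_den us \<noteq> 0"
proof (induction us)
  case (Cons u us)
  then have "kern_den u v \<noteq> 0" if "v \<in> set us" for v
    using that by (intro kern_den_neq_0) auto
  with Cons show ?case
    unfolding word_den.simps mult_eq_0_iff prod_list_zero_iff set_map image_iff
    by (metis distinct.simps(2))
qed simp

text \<open>At each vertex the list meets the variables in increasing order, so every factor of
  \<open>word_den\<close> has the sign that \<open>vpairs\<close> prescribes.\<close>

lemma word_den_eq_vandermonde: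
  "sorted_wrt (\<lambda>u v. fst u = fst v \<longrightarrow> snd u < snd v) us \<Longrightarrow> distinct us \<Longrightarrow>
    word_den us = vandermonde (set us)"
proof (induction us)
  case Nil
  show ?case by (simp add: vandermonde_def vpairs_def)
next
  case (Cons u us)
  let ?V = "{v \<in> set us. fst u = fst v}"
  \<comment> \<open>The new pairs join u to the later variables at its vertex; u comes first in each
    of them since the list is sorted.\<close>
  have P: "vpairs (set (u # us)) = Pair u ` ?V \<union> vpairs (set us)"
    using Cons.prems by (fastforce simp: vpairs_def)
  have "vandermonde (set (u # us))
      = (\<Prod>p\<in>Pair u ` ?V. xvar (snd p) 1 - xvar (fst p) 1) * vandermonde (set us)"
    unfolding vandermonde_def P
  proof (rule prod.union_disjoint)
    show "Pair u ` ?V \<inter> vpairs (set us) = {}" using Cons.prems by (auto simp: vpairs_def)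
  qed simp_all
  also have "(\<Prod>p\<in>Pair u ` ?V. xvar (snd p) 1 - xvar (fst p) 1) = (\<Prod>v\<in>?V. kern_den u v)"
    by (subst prod.reindex) (auto simp: inj_on_def kern_den_def)
  also have "\<dots> = (\<Prod>v\<in>set us. kern_den u v)"
    by (rule prod.mono_neutral_left) (auto simp: kern_den_def)
  also have "\<dots> = (\<Prod>v\<leftarrow>us. kern_den u v)"
    using Cons.prems by (simp add: prod.distinct_set_conv_list)
  finally show ?case using Cons by simp
qed

lemma word_den_pos: "word_den (pos xs) = vandermonde (dim_vars (wt xs))"
  using word_den_eq_vandermonde[OF sorted_pos distinct_pos] by (simp add: set_pos)

text \<open>A bialternant: an antisymmetrization divided by the Vandermonde product. The choice is
  harmless, since the quotient exists by \<open>vandermonde_dvd_antisymmetrize\<close> and is unique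
  because the Vandermonde product is nonzero.\<close>

definition shuffle_elt :: "('v, 'e) pre_digraph \<Rightarrow> ('v \<times> int) list \<Rightarrow> 'v laurent" where
  "shuffle_elt Q w = (SOME h. vandermonde (dim_vars (wt (map fst w))) * h =
     antisymmetrize (wt (map fst w)) (word_num Q (lab w)))"

lemma vandermonde_shuffle_elt:
  fixes w :: "('v::linorder \<times> int) list"
  shows "vandermonde (dim_vars (wt (map fst w))) * shuffle_elt Q w =
    antisymmetrize (wt (map fst w)) (word_num Q (lab w))"
  unfolding shuffle_elt_def
  by (rule someI_ex) (metis vandermonde_dvd_antisymmetrize dvdE)

lemma shuffle_elt_eqI:
  fixes w :: "('v::linorder \<times> int) list"
  assumes "vandermonde (dim_vars (wt (map fst w))) * h =
    antisymmetrize (wt (map fst w)) (word_num Q (lab w))"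
  shows "shuffle_elt Q w = h"
proof -
  have "vandermonde (dim_vars (wt (map fst w))) * shuffle_elt Q w
      = vandermonde (dim_vars (wt (map fst w))) * h"
    by (simp add: vandermonde_shuffle_elt assms)
  then show ?thesis
    using mult_left_cancel[OF vandermonde_neq_0[OF finite_dim_vars]] by blast
qed

section \<open>Shuffle elements as symmetrized fractions\<close>

definition word_frac :: "('v::linorder, 'e) pre_digraph \<Rightarrow> (('v \<times> nat) \<times> int) list \<Rightarrow> 'v laurent fract" where
  "word_frac Q l = Fraction_Field.Fract (word_num Q l) (word_den (map fst l))"

lemma fract_rename_word_frac:
  assumes "inj \<rho>" "\<And>v. fst (\<rho> v) = fst v" "distinct (map fst l)"
  shows "fract_rename \<rho> (word_frac Q l) = word_frac Q (relabel \<rho> l)"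
  unfolding word_frac_def
  using assms by (simp only: fract_rename_Fract word_den_neq_0 rename_word_num rename_word_den relabel_simps
       not_False_eq_True simp_thms)

lemma Fract_prod_list:
  "(\<Prod>a\<leftarrow>as. Fraction_Field.Fract (f a) (g a)) = Fraction_Field.Fract (\<Prod>a\<leftarrow>as. f a) (\<Prod>a\<leftarrow>as. g a)"
  by (induction as) (simp_all add: fract_collapse)

text \<open>The double product over letters of both words is the kernel of the shuffle formula, so
  concatenation already has the shape of one summand of a shuffle product.\<close>

lemma word_frac_append:
  "word_frac Q (l @ l') = word_frac Q l * word_frac Q l' *
    (\<Prod>u\<leftarrow>map fst l. \<Prod>v\<leftarrow>map fst l'. Fraction_Field.Fract (kern_num Q u v) (kern_den u v))"
  by (simp only: word_frac_def word_num_append map_append word_den_append Fract_prod_list mult_fract)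

text \<open>Passes from antisymmetrized numerators to plain symmetrization of fractions: the
  denominator of the word is the Vandermonde product, and renaming it by \<sigma> produces the sign
  \<open>eps\<close>, which moves to the numerator because it squares to 1.\<close>

lemma emb_shuffle_elt:
  fixes w :: "('v::linorder \<times> int) list"
  defines "\<gamma> \<equiv> wt (map fst w)"
  shows "emb (shuffle_elt Q w) = (\<Sum>\<sigma>\<in>sym_group \<gamma>. word_frac Q (relabel \<sigma> (lab w)))"
proof -
  let ?V = "vandermonde (dim_vars \<gamma>)"
  have V: "?V \<noteq> 0" by (simp add: vandermonde_neq_0)
  have "word_frac Q (relabel \<sigma> (lab w)) = Fraction_Field.Fract (eps \<gamma> \<sigma> * rename_vars \<sigma> (word_num Q (lab w))) ?V"
    if \<sigma>: "\<sigma> \<in> sym_group \<gamma>" for \<sigma>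
  proof -
    have "word_num Q (relabel \<sigma> (lab w)) = rename_vars \<sigma> (word_num Q (lab w))"
      by (rule rename_word_num[symmetric]) (rule sym_group_fst[OF \<sigma>])
    moreover have "word_den (map fst (relabel \<sigma> (lab w))) = rename_vars \<sigma> ?V"
      unfolding \<gamma>_def word_den_pos[symmetric] relabel_simps map_fst_lab
      by (rule rename_word_den[symmetric]) (rule sym_group_fst[OF \<sigma>])
    moreover have "eps \<gamma> \<sigma> \<noteq> 0" by (simp add: eps_def)
    ultimately show ?thesis
      by (simp add: word_frac_def rename_vandermonde[OF \<sigma>] eq_fract V)
  qed
  then have "(\<Sum>\<sigma>\<in>sym_group \<gamma>. word_frac Q (relabel \<sigma> (lab w)))
      = Fraction_Field.Fract (antisymmetrize \<gamma> (word_num Q (lab w))) ?V"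
    by (simp add: Fract_sum_same V antisymmetrize_def)
  also have "\<dots> = emb (shuffle_elt Q w)"
    unfolding vandermonde_shuffle_elt[of w Q, folded \<gamma>_def, symmetric]
    by (simp add: eq_fract V)
  finally show ?thesis ..
qed

section \<open>The shuffle product of shuffle elements\<close>

text \<open>\<open>glue \<alpha> \<sigma> \<tau>\<close> is the block permutation \<open>\<sigma> \<times> \<tau>\<close>, with \<open>\<tau>\<close> acting on the shifted variables.\<close>

definition glue ::
    "'v dimvec \<Rightarrow> ('v \<times> nat \<Rightarrow> 'v \<times> nat) \<Rightarrow> ('v \<times> nat \<Rightarrow> 'v \<times> nat) \<Rightarrow> 'v \<times> nat \<Rightarrow> 'v \<times> nat" where
  "glue \<alpha> \<sigma> \<tau> v = (if snd v \<le> Poly_Mapping.lookup \<alpha> (fst v) then \<sigma> v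
     else shift \<alpha> (\<tau> (fst v, snd v - Poly_Mapping.lookup \<alpha> (fst v))))"

lemma glue_left: "v \<in> dim_vars \<alpha> \<Longrightarrow> glue \<alpha> \<sigma> \<tau> v = \<sigma> v"
  by (cases v) (simp add: glue_def mem_dim_vars)

lemma glue_right: "v \<in> dim_vars \<beta> \<Longrightarrow> glue \<alpha> \<sigma> \<tau> (shift \<alpha> v) = shift \<alpha> (\<tau> v)"
  by (cases v) (simp add: glue_def mem_dim_vars)

lemma fst_glue:
  assumes "\<sigma> \<in> sym_group \<alpha>" "\<tau> \<in> sym_group \<beta>"
  shows "fst (glue \<alpha> \<sigma> \<tau> v) = fst v"
  by (simp add: glue_def sym_group_fst[OF assms(1)] sym_group_fst[OF assms(2)])

lemma glue_in_sym_group: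
  assumes \<sigma>: "\<sigma> \<in> sym_group \<alpha>" and \<tau>: "\<tau> \<in> sym_group \<beta>"
  shows "glue \<alpha> \<sigma> \<tau> \<in> sym_group (\<alpha> + \<beta>)"
proof -
  let ?g = "glue \<alpha> \<sigma> \<tau>"
  note perm = sym_group_permutes[OF \<sigma>] sym_group_permutes[OF \<tau>]
  have s: "\<sigma> v \<in> dim_vars \<alpha> \<longleftrightarrow> v \<in> dim_vars \<alpha>" "\<tau> v \<in> dim_vars \<beta> \<longleftrightarrow> v \<in> dim_vars \<beta>" for v
    using permutes_in_image perm by metis+
  have img: "?g ` dim_vars (\<alpha> + \<beta>) = dim_vars (\<alpha> + \<beta>)"
  proof -
    have "?g ` dim_vars \<alpha> = \<sigma> ` dim_vars \<alpha>"
      by (rule image_cong) (simp_all add: glue_left)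
    moreover have "?g ` shift \<alpha> ` dim_vars \<beta> = shift \<alpha> ` \<tau> ` dim_vars \<beta>"
      unfolding image_image by (rule image_cong) (simp_all add: glue_right)
    ultimately show ?thesis
      by (simp only: dim_vars_add image_Un permutes_image[OF perm(1)] permutes_image[OF perm(2)])
  qed
  then have "bij_betw ?g (dim_vars (\<alpha> + \<beta>)) (dim_vars (\<alpha> + \<beta>))"
    by (simp add: bij_betw_def eq_card_imp_inj_on)
  moreover have "?g v = v" if v: "v \<notin> dim_vars (\<alpha> + \<beta>)" for v
  proof (cases "snd v \<le> Poly_Mapping.lookup \<alpha> (fst v)")
    \<comment> \<open>Only second component 0 is left here: occurrence numbers start at 1, and
      \<sigma> fixes everything outside its block.\<close>
    case True
    moreover have "v \<notin> dim_vars \<alpha>" using v by (simp add: dim_vars_add)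
    ultimately show ?thesis using permutes_not_in[OF perm(1)] by (simp add: glue_def)
  next
    case False
    let ?w = "(fst v, snd v - Poly_Mapping.lookup \<alpha> (fst v))"
    have w: "shift \<alpha> ?w = v" using False by (intro prod_eqI) simp_all
    then have "?w \<notin> dim_vars \<beta>" using v unfolding dim_vars_add by (metis UnI2 imageI)
    then have "\<tau> ?w = ?w" using permutes_not_in[OF perm(2)] by blast
    then show ?thesis using False w by (simp add: glue_def)
  qed
  ultimately have "?g permutes dim_vars (\<alpha> + \<beta>)" by (rule bij_imp_permutes)
  moreover have "fst (?g v) = fst v" for v by (rule fst_glue[OF assms])
  ultimately show ?thesis unfolding sym_group_def by blast
qed

section \<open>The shuffle formula as a product over pairs of variables\<close>

lemma dim_vars_verts:
  assumes "Poly_Mapping.keys \<alpha> \<subseteq> I"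
  shows "dim_vars \<alpha> = (SIGMA i:I. {1..Poly_Mapping.lookup \<alpha> i})"
  using assms by (force simp: dim_vars_def in_keys_iff)

text \<open>Brings the fourfold products of the definitions into the form in which they can be
  compared with products over pairs of letters.\<close>

lemma prod_blocks:
  assumes fin: "finite I" and a: "Poly_Mapping.keys \<alpha> \<subseteq> I" and b: "Poly_Mapping.keys \<beta> \<subseteq> I"
  shows "(\<Prod>i\<in>I. \<Prod>i'\<in>I. \<Prod>j\<in>{1..Poly_Mapping.lookup \<alpha> i}.
      \<Prod>j'\<in>{Poly_Mapping.lookup \<alpha> i' + 1..Poly_Mapping.lookup \<alpha> i' + Poly_Mapping.lookup \<beta> i'}.
        F (i, j) (i', j'))
    = (\<Prod>u\<in>dim_vars \<alpha>. \<Prod>v\<in>shift \<alpha> ` dim_vars \<beta>. F u v)"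
proof -
  let ?a = "Poly_Mapping.lookup \<alpha>" and ?b = "Poly_Mapping.lookup \<beta>"
  have img: "shift \<alpha> ` dim_vars \<beta> = (SIGMA i:I. {?a i + 1..?a i + ?b i})"
  proof (rule Set.set_eqI)
    fix v :: "'a \<times> nat"
    obtain i j where v: "v = (i, j)" by (cases v)
    show "v \<in> shift \<alpha> ` dim_vars \<beta> \<longleftrightarrow> v \<in> (SIGMA i:I. {?a i + 1..?a i + ?b i})"
    proof
      assume "v \<in> (SIGMA i:I. {?a i + 1..?a i + ?b i})"
      then have "(i, j - ?a i) \<in> dim_vars \<beta>" "shift \<alpha> (i, j - ?a i) = v"
        by (auto simp: v mem_dim_vars shift_def)
      then show "v \<in> shift \<alpha> ` dim_vars \<beta>" by blast
    qed (auto simp: v shift_def dim_vars_verts[OF b])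
  qed
  have "(\<Prod>i\<in>I. \<Prod>i'\<in>I. \<Prod>j\<in>{1..?a i}. \<Prod>j'\<in>{?a i' + 1..?a i' + ?b i'}. F (i, j) (i', j'))
      = (\<Prod>i\<in>I. \<Prod>j\<in>{1..?a i}. \<Prod>i'\<in>I. \<Prod>j'\<in>{?a i' + 1..?a i' + ?b i'}. F (i, j) (i', j'))"
    by (intro prod.cong refl prod.swap)
  also have "\<dots> = (\<Prod>i\<in>I. \<Prod>j\<in>{1..?a i}. \<Prod>v\<in>shift \<alpha> ` dim_vars \<beta>. F (i, j) v)"
    unfolding img by (intro prod.cong refl) (simp add: prod.Sigma fin)
  also have "\<dots> = (\<Prod>u\<in>dim_vars \<alpha>. \<Prod>v\<in>shift \<alpha> ` dim_vars \<beta>. F u v)"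
    unfolding dim_vars_verts[OF a] by (subst prod.Sigma) (simp_all add: fin split_def)
  finally show ?thesis .
qed

text \<open>Introduces a second, independent vertex index into the denominator, so that
  \<open>prod_blocks\<close> applies to it as well.\<close>

lemma prod_diag:
  assumes "finite I"
  shows "(\<Prod>i\<in>I. G i i) = (\<Prod>i\<in>I. \<Prod>i'\<in>I. if i = i' then G i i' else 1)"
proof (rule prod.cong)
  fix i assume "i \<in> I"
  then show "G i i = (\<Prod>i'\<in>I. if i = i' then G i i' else 1)"
    using assms by (subst prod.delta') auto
qed simp

definition shuffle_kern :: "('v, 'e) pre_digraph \<Rightarrow> 'v dimvec \<Rightarrow> 'v dimvec \<Rightarrow> 'v laurent" where
  "shuffle_kern Q \<alpha> \<beta> = (\<Prod>u\<in>dim_vars \<alpha>. \<Prod>v\<in>shift \<alpha> ` dim_vars \<beta>.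
     (1 - xvar u 1 * xvar v (-1)) ^ num_arrows Q (fst u) (fst v))"

lemma shuffle_num_eq:
  assumes "finite (verts Q)" "Poly_Mapping.keys \<alpha> \<subseteq> verts Q" "Poly_Mapping.keys \<beta> \<subseteq> verts Q"
  shows "shuffle_num Q \<alpha> \<beta> f g = f * rename_vars (shift \<alpha>) g * shuffle_kern Q \<alpha> \<beta>"
  unfolding shuffle_num_def Let_def shuffle_kern_def shift_def[symmetric] prod_blocks[OF assms, symmetric]
  by (simp add: xpow_eq_xvar)

lemma shuffle_denom_eq:
  assumes "finite (verts Q)" "Poly_Mapping.keys \<alpha> \<subseteq> verts Q" "Poly_Mapping.keys \<beta> \<subseteq> verts Q"
  shows "shuffle_denom Q \<alpha> \<beta> = (\<Prod>u\<in>dim_vars \<alpha>. \<Prod>v\<in>shift \<alpha> ` dim_vars \<beta>.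
     if fst u = fst v then 1 - xvar u 1 * xvar v (-1) else 1)"
  unfolding shuffle_denom_def Let_def prod_blocks[OF assms, symmetric]
  by (subst prod_diag[OF assms(1)]) (auto simp: xpow_eq_xvar intro!: prod.cong)

lemma shift_neq: "u \<in> dim_vars \<alpha> \<Longrightarrow> v \<in> shift \<alpha> ` dim_vars \<beta> \<Longrightarrow> u \<noteq> v"
  by (auto simp: shift_def mem_dim_vars)

lemma one_minus_xvar_neq_0:
  assumes "u \<noteq> v"
  shows "1 - xvar u 1 * xvar v (-1) \<noteq> 0"
proof
  assume "1 - xvar u 1 * xvar v (-1) = 0"
  then have "xvar u 1 * xvar v (-1) = 1" by simp
  then have "xvar u 1 * xvar v (-1) * xvar v 1 = xvar v 1" by (simp only: mult_1)
  then have "xvar u 1 * (xvar v (-1) * xvar v 1) = xvar v 1" by (simp only: mult.assoc)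
  then show False using assms by (simp add: xvar_mult xvar_eq_iff)
qed

lemma shuffle_denom_neq_0:
  fixes Q :: "('v::linorder, 'e) pre_digraph"
  assumes "finite (verts Q)" "Poly_Mapping.keys \<alpha> \<subseteq> verts Q" "Poly_Mapping.keys \<beta> \<subseteq> verts Q"
  shows "shuffle_denom Q \<alpha> \<beta> \<noteq> 0"
proof -
  have "(if fst u = fst v then 1 - xvar u 1 * xvar v (-1) else 1) \<noteq> (0 :: 'v laurent)"
    if "u \<in> dim_vars \<alpha>" "v \<in> shift \<alpha> ` dim_vars \<beta>" for u v
    using one_minus_xvar_neq_0[OF shift_neq[OF that]] 
    by (cases "fst u = fst v") (simp_all only: if_True if_False one_neq_zero not_False_eq_True simp_thms)
  then show ?thesis
    unfolding shuffle_denom_eq[OF assms] prod_zero_iff[OF finite_dim_vars]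
      prod_zero_iff[OF finite_imageI[OF finite_dim_vars]] by blast
qed

text \<open>If the vertices agree, the fraction is extended by \<open>x_v\<close>; otherwise the two
  sides have the same numerator and denominator 1.\<close>

lemma kern_frac:
  fixes u v :: "'v::linorder \<times> nat"
  assumes "u \<noteq> v"
  shows "Fraction_Field.Fract ((1 - xvar u 1 * xvar v (-1)) ^ num_arrows Q (fst u) (fst v))
      (if fst u = fst v then 1 - xvar u 1 * xvar v (-1) else 1)
    = Fraction_Field.Fract (kern_num Q u v) (kern_den u v)"
proof -
  have "xvar v 1 * (1 - xvar u 1 * xvar v (-1)) = xvar v 1 - xvar u 1 * (xvar v 1 * xvar v (-1))"
    by (simp add: algebra_simps)
  then have "xvar v 1 * (1 - xvar u 1 * xvar v (-1)) = xvar v 1 - xvar u 1"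
    by (simp add: xvar_mult)
  then have *: "xvar v 1 - xvar u 1 = xvar v 1 * (1 - xvar u 1 * xvar v (-1))" ..
  show ?thesis
    unfolding kern_num_def kern_den_def *
    using one_minus_xvar_neq_0[OF assms]
    by (cases "fst u = fst v") (simp_all only: simp_thms if_True if_False mult_1_right mult_fract_cancel[OF xvar_neq_0]
        mult.commute[of _ "xvar v 1"])
qed

lemma shuffle_kern_frac:
  fixes Q :: "('v::linorder, 'e) pre_digraph"
  assumes "finite (verts Q)" "Poly_Mapping.keys \<alpha> \<subseteq> verts Q" "Poly_Mapping.keys \<beta> \<subseteq> verts Q"
  shows "Fraction_Field.Fract (shuffle_kern Q \<alpha> \<beta>) (shuffle_denom Q \<alpha> \<beta>)
    = (\<Prod>u\<in>dim_vars \<alpha>. \<Prod>v\<in>shift \<alpha> ` dim_vars \<beta>.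
        Fraction_Field.Fract (kern_num Q u v) (kern_den u v))"
  unfolding shuffle_denom_eq[OF assms] shuffle_kern_def Fract_prod
  by (intro prod.cong refl kern_frac) (rule shift_neq)

text \<open>The right-hand side of the equation described in \<open>shuffle_prod\<close>. Products
  are computed with it in the field and transferred by \<open>shuffle_prod_eqI\<close>.\<close>

definition shuffle_frac ::
    "('v::linorder, 'e) pre_digraph \<Rightarrow> 'v dimvec \<Rightarrow> 'v dimvec \<Rightarrow> 'v laurent \<Rightarrow> 'v laurent \<Rightarrow> 'v laurent fract" where
  "shuffle_frac Q \<alpha> \<beta> f g =
     (\<Sum>\<sigma> \<in> sym_group (\<alpha> + \<beta>).
        Fraction_Field.Fract (rename_vars \<sigma> (shuffle_num Q \<alpha> \<beta> f g)) (rename_vars \<sigma> (shuffle_denom Q \<alpha> \<beta>)))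
     / (of_nat (card (sym_group \<alpha>)) * of_nat (card (sym_group \<beta>)))"

lemma shuffle_prod_eqI: "emb h = shuffle_frac Q \<alpha> \<beta> f g \<Longrightarrow> shuffle_prod Q \<alpha> \<beta> f g = h"
  unfolding shuffle_prod_def shuffle_frac_def[symmetric]
  by (rule the_equality) (metis emb_eq_iff)+

text \<open>Both factors are expanded by \<open>emb_shuffle_elt\<close>. A permutation of the first
  block and one of the second act together as the single permutation \<open>glue\<close> on the
  concatenated word.\<close>

lemma shuffle_summand:
  fixes Q :: "('v::linorder, 'e) pre_digraph"
  assumes Q: "finite (verts Q)" "Poly_Mapping.keys \<alpha> \<subseteq> verts Q" "Poly_Mapping.keys \<beta> \<subseteq> verts Q"
    and u: "wt (map fst u) = \<alpha>" and v: "wt (map fst v) = \<beta>"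
    and s: "\<sigma> \<in> sym_group (\<alpha> + \<beta>)"
  shows "Fraction_Field.Fract (rename_vars \<sigma> (shuffle_num Q \<alpha> \<beta> (shuffle_elt Q u) (shuffle_elt Q v)))
      (rename_vars \<sigma> (shuffle_denom Q \<alpha> \<beta>))
    = (\<Sum>\<sigma>1\<in>sym_group \<alpha>. \<Sum>\<sigma>2\<in>sym_group \<beta>.
        word_frac Q (relabel (\<sigma> \<circ> glue \<alpha> \<sigma>1 \<sigma>2) (lab (u @ v))))"
proof -
  let ?\<kappa> = "Fraction_Field.Fract (shuffle_kern Q \<alpha> \<beta>) (shuffle_denom Q \<alpha> \<beta>)"
  have inj: "inj \<sigma>" by (rule sym_group_inj[OF s])
  have dlab: "distinct (map fst (relabel \<rho> (lab w)))" if "inj \<rho>" for \<rho> and w :: "('v \<times> int) list"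
    unfolding relabel_simps map_fst_lab distinct_map
    using distinct_pos that by (metis inj_on_subset subset_UNIV)
  have summand: "word_frac Q (relabel \<sigma>1 (lab u)) * fract_rename (shift \<alpha>) (word_frac Q (relabel \<sigma>2 (lab v))) * ?\<kappa>
      = word_frac Q (relabel (glue \<alpha> \<sigma>1 \<sigma>2) (lab (u @ v)))"
    if 1: "\<sigma>1 \<in> sym_group \<alpha>" and 2: "\<sigma>2 \<in> sym_group \<beta>" for \<sigma>1 \<sigma>2
  proof -
    let ?L = "relabel \<sigma>1 (lab u)" and ?R = "relabel (shift \<alpha> \<circ> \<sigma>2) (lab v)"
    have "inj (shift \<alpha> \<circ> \<sigma>2)" using sym_group_inj[OF 2] by (simp add: inj_compose)
    note dist = dlab[OF sym_group_inj[OF 1], of u] dlab[OF this, of v]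
    have sets: "set (map fst ?L) = dim_vars \<alpha>" "set (map fst ?R) = shift \<alpha> ` dim_vars \<beta>"
      unfolding relabel_simps map_fst_lab set_map set_pos u v image_comp[symmetric]
        permutes_image[OF sym_group_permutes[OF 1]] permutes_image[OF sym_group_permutes[OF 2]]
      by (rule refl)+
    \<comment> \<open>The kernel is a product over two sets of variables, so permuting the variables
      inside each block leaves it unchanged.\<close>
    have \<kappa>: "?\<kappa> = (\<Prod>u\<leftarrow>map fst ?L. \<Prod>v\<leftarrow>map fst ?R. Fraction_Field.Fract (kern_num Q u v) (kern_den u v))"
      unfolding shuffle_kern_frac[OF Q] sets[symmetric]
      by (simp only: prod.distinct_set_conv_list[OF dist(1)] prod.distinct_set_conv_list[OF dist(2)])
    have "fract_rename (shift \<alpha>) (word_frac Q (relabel \<sigma>2 (lab v))) = word_frac Q ?R"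
      unfolding relabel_relabel[symmetric]
      by (rule fract_rename_word_frac[OF inj_shift _ dlab[OF sym_group_inj[OF 2]]]) simp
    then have "word_frac Q (relabel \<sigma>1 (lab u)) * fract_rename (shift \<alpha>) (word_frac Q (relabel \<sigma>2 (lab v))) * ?\<kappa>
        = word_frac Q (?L @ ?R)"
      unfolding word_frac_append \<kappa> by (simp only:)
    moreover have L: "?L = relabel (glue \<alpha> \<sigma>1 \<sigma>2) (lab u)"
    proof (rule relabel_cong)
      fix x assume "x \<in> set (map fst (lab u))"
      then show "\<sigma>1 x = glue \<alpha> \<sigma>1 \<sigma>2 x"
        by (simp only: map_fst_lab set_pos u glue_left)
    qed
    moreover have R: "?R = relabel (glue \<alpha> \<sigma>1 \<sigma>2 \<circ> shift \<alpha>) (lab v)"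
    proof (rule relabel_cong)
      fix x assume "x \<in> set (map fst (lab v))"
      then show "(shift \<alpha> \<circ> \<sigma>2) x = (glue \<alpha> \<sigma>1 \<sigma>2 \<circ> shift \<alpha>) x"
        by (simp only: map_fst_lab set_pos v glue_right comp_apply)
    qed
    ultimately show ?thesis by (simp only: lab_append u relabel_simps relabel_relabel L R)
  qed
  have glue_inj: "inj (glue \<alpha> \<sigma>1 \<sigma>2)" if "\<sigma>1 \<in> sym_group \<alpha>" "\<sigma>2 \<in> sym_group \<beta>" for \<sigma>1 \<sigma>2
    using glue_in_sym_group[OF that] by (rule sym_group_inj)
  have "Fraction_Field.Fract (rename_vars \<sigma> (shuffle_num Q \<alpha> \<beta> (shuffle_elt Q u) (shuffle_elt Q v)))
      (rename_vars \<sigma> (shuffle_denom Q \<alpha> \<beta>))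
      = fract_rename \<sigma> (emb (shuffle_elt Q u) * fract_rename (shift \<alpha>) (emb (shuffle_elt Q v)) * ?\<kappa>)"
    by (simp add: shuffle_num_eq[OF Q] fract_rename_emb fract_rename_Fract[OF inj shuffle_denom_neq_0[OF Q]])
  also have "\<dots> = fract_rename \<sigma> (\<Sum>\<sigma>1\<in>sym_group \<alpha>. \<Sum>\<sigma>2\<in>sym_group \<beta>.
      word_frac Q (relabel \<sigma>1 (lab u)) * fract_rename (shift \<alpha>) (word_frac Q (relabel \<sigma>2 (lab v))) * ?\<kappa>)"
    unfolding emb_shuffle_elt u v fract_rename_sum[OF inj_shift] sum_product
    by (simp only: sum_distrib_right)
  also have "\<dots> = fract_rename \<sigma> (\<Sum>\<sigma>1\<in>sym_group \<alpha>. \<Sum>\<sigma>2\<in>sym_group \<beta>.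
      word_frac Q (relabel (glue \<alpha> \<sigma>1 \<sigma>2) (lab (u @ v))))"
    by (intro arg_cong[where f = "fract_rename \<sigma>"] sum.cong refl summand)
  also have "\<dots> = (\<Sum>\<sigma>1\<in>sym_group \<alpha>. \<Sum>\<sigma>2\<in>sym_group \<beta>.
      word_frac Q (relabel (\<sigma> \<circ> glue \<alpha> \<sigma>1 \<sigma>2) (lab (u @ v))))"
    unfolding fract_rename_sum[OF inj] relabel_relabel[symmetric]
    by (intro sum.cong refl fract_rename_word_frac inj sym_group_fst[OF s] dlab glue_inj)
  finally show ?thesis .
qed

lemma of_nat_fract_neq_0: "k > 0 \<Longrightarrow> of_nat k \<noteq> (0 :: 'v::linorder laurent fract)"
  by (simp add: of_nat_fract Zero_fract_def eq_fract)

text \<open>For each fixed block permutation the outer sum over \<sigma> is the full symmetrization,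
  by right translation in \<open>sym_group (\<alpha> + \<beta>)\<close>. All block permutations thus
  contribute equally, and their number cancels against the normalization.\<close>

lemma shuffle_frac_shuffle_elt:
  fixes Q :: "('v::linorder, 'e) pre_digraph"
  assumes Q: "finite (verts Q)" "fst ` set u \<subseteq> verts Q" "fst ` set v \<subseteq> verts Q"
  shows "shuffle_frac Q (wt (map fst u)) (wt (map fst v)) (shuffle_elt Q u) (shuffle_elt Q v)
    = emb (shuffle_elt Q (u @ v))"
proof -
  define \<alpha> \<beta> where ab: "\<alpha> = wt (map fst u)" "\<beta> = wt (map fst v)"
  have keys: "Poly_Mapping.keys (wt xs) \<subseteq> set xs" for xs :: "'v list"
    by (auto simp: in_keys_iff lookup_wt count_list_0_iff)
  have Q': "finite (verts Q)" "Poly_Mapping.keys \<alpha> \<subseteq> verts Q" "Poly_Mapping.keys \<beta> \<subseteq> verts Q"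
    using Q keys[of "map fst u"] keys[of "map fst v"] by (auto simp: ab)
  let ?a = "of_nat (card (sym_group \<alpha>)) :: 'v laurent fract"
  let ?b = "of_nat (card (sym_group \<beta>)) :: 'v laurent fract"
  have "(\<Sum>\<sigma> \<in> sym_group (\<alpha> + \<beta>).
        Fraction_Field.Fract (rename_vars \<sigma> (shuffle_num Q \<alpha> \<beta> (shuffle_elt Q u) (shuffle_elt Q v)))
          (rename_vars \<sigma> (shuffle_denom Q \<alpha> \<beta>)))
      = (\<Sum>\<sigma> \<in> sym_group (\<alpha> + \<beta>). \<Sum>\<sigma>1\<in>sym_group \<alpha>. \<Sum>\<sigma>2\<in>sym_group \<beta>.
        word_frac Q (relabel (\<sigma> \<circ> glue \<alpha> \<sigma>1 \<sigma>2) (lab (u @ v))))"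
    by (intro sum.cong refl shuffle_summand Q' ab[symmetric])
  also have "\<dots> = (\<Sum>\<sigma>1\<in>sym_group \<alpha>. \<Sum>\<sigma>2\<in>sym_group \<beta>. \<Sum>\<sigma> \<in> sym_group (\<alpha> + \<beta>).
        word_frac Q (relabel (\<sigma> \<circ> glue \<alpha> \<sigma>1 \<sigma>2) (lab (u @ v))))"
    by (subst sum.swap) (intro sum.cong refl sum.swap)
  also have "\<dots> = (\<Sum>\<sigma>1\<in>sym_group \<alpha>. \<Sum>\<sigma>2\<in>sym_group \<beta>. emb (shuffle_elt Q (u @ v)))"
  proof (intro sum.cong refl)
    fix \<sigma>1 \<sigma>2 assume "\<sigma>1 \<in> sym_group \<alpha>" "\<sigma>2 \<in> sym_group \<beta>"
    then have "glue \<alpha> \<sigma>1 \<sigma>2 \<in> sym_group (\<alpha> + \<beta>)" by (rule glue_in_sym_group)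
    from sum_sym_group_comp[OF this, of "\<lambda>\<sigma>. word_frac Q (relabel \<sigma> (lab (u @ v)))"]
    show "(\<Sum>\<sigma> \<in> sym_group (\<alpha> + \<beta>). word_frac Q (relabel (\<sigma> \<circ> glue \<alpha> \<sigma>1 \<sigma>2) (lab (u @ v))))
        = emb (shuffle_elt Q (u @ v))"
      by (simp add: emb_shuffle_elt ab)
  qed
  also have "\<dots> = ?a * (?b * emb (shuffle_elt Q (u @ v)))"
    by (simp only: sum_constant)
  finally show ?thesis
    unfolding ab[symmetric] shuffle_frac_def
    by (simp add: of_nat_fract_neq_0[OF card_sym_group_pos])
qed

section \<open>Bilinearity of the shuffle product\<close>

abbreviation cst :: "complex \<Rightarrow> 'v laurent" where
  "cst c \<equiv> Poly_Mapping.single 0 c"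

lemma shuffle_num_scale:
  "shuffle_num Q \<alpha> \<beta> (cst c * f) (cst d * g) = cst (c * d) * shuffle_num Q \<alpha> \<beta> f g"
proof -
  have "cst (c * d) = cst c * (cst d :: 'a laurent)" by (simp add: mult_single)
  then show ?thesis by (simp add: shuffle_num_def Let_def rename_vars_mult mult_ac)
qed

lemma shuffle_num_sum:
  "shuffle_num Q \<alpha> \<beta> (\<Sum>a\<in>A. F a) (\<Sum>b\<in>B. G b) = (\<Sum>a\<in>A. \<Sum>b\<in>B. shuffle_num Q \<alpha> \<beta> (F a) (G b))"
  unfolding shuffle_num_def Let_def rename_vars_sum sum_product by (simp only: sum_distrib_right)

lemma Fract_scale: "Fraction_Field.Fract (c * a) b = emb c * Fraction_Field.Fract a b"
  by simp

lemma shuffle_frac_scale: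
  "shuffle_frac Q \<alpha> \<beta> (cst c * f) (cst d * g) = emb (cst (c * d)) * shuffle_frac Q \<alpha> \<beta> f g"
  unfolding shuffle_frac_def shuffle_num_scale rename_vars_mult rename_vars_single ren_zero
  by (simp only: Fract_scale sum_distrib_left times_divide_eq_right)

lemma Fract_sum:
  fixes g :: "'b \<Rightarrow> 'a::idom"
  shows "Fraction_Field.Fract (sum g A) d = (\<Sum>a\<in>A. Fraction_Field.Fract (g a) d)"
proof (cases "d = 0")
  case False
  then show ?thesis by (simp add: Fract_sum_same)
next
  case True
  \<comment> \<open>The default value of a fraction with denominator 0; with it
    \<open>shuffle_frac\<close> is additive for arbitrary Q, \<alpha> and \<beta>.\<close>
  have "Fraction_Field.Fract a 0 = 0" for a :: 'a
    by (simp add: fract_collapse)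
  then show ?thesis using True by simp
qed

lemma shuffle_frac_sum:
  "shuffle_frac Q \<alpha> \<beta> (\<Sum>a\<in>A. F a) (\<Sum>b\<in>B. G b) = (\<Sum>a\<in>A. \<Sum>b\<in>B. shuffle_frac Q \<alpha> \<beta> (F a) (G b))"
  unfolding shuffle_frac_def shuffle_num_sum rename_vars_sum Fract_sum sum_divide_distrib[symmetric]
  by (rule arg_cong2[where f = "(/)", OF _ refl])
    (subst sum.swap, intro sum.cong refl, subst sum.swap, rule refl)

text \<open>A description is not additive by itself. Bilinearity holds for
  \<open>shuffle_frac\<close>, and it passes to \<open>shuffle_prod\<close> once every single
  product is known to be a Laurent polynomial.\<close>

lemma shuffle_prod_lincomb:
  assumes "\<And>a b. a \<in> A \<Longrightarrow> b \<in> B \<Longrightarrow> shuffle_frac Q \<alpha> \<beta> (F a) (G b) = emb (H a b)"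
  shows "shuffle_prod Q \<alpha> \<beta> (\<Sum>a\<in>A. cst (c a) * F a) (\<Sum>b\<in>B. cst (d b) * G b)
    = (\<Sum>a\<in>A. \<Sum>b\<in>B. cst (c a * d b) * H a b)"
proof (rule shuffle_prod_eqI)
  show "emb (\<Sum>a\<in>A. \<Sum>b\<in>B. cst (c a * d b) * H a b)
      = shuffle_frac Q \<alpha> \<beta> (\<Sum>a\<in>A. cst (c a) * F a) (\<Sum>b\<in>B. cst (d b) * G b)"
    unfolding shuffle_frac_sum shuffle_frac_scale emb_sum
    by (intro sum.cong refl) (simp add: assms)
qed

section \<open>Symmetry of shuffle elements\<close>

lemma vars_in_mono: "X \<subseteq> Y \<Longrightarrow> f \<in> vars_in X \<Longrightarrow> f \<in> vars_in Y"
  unfolding vars_in_def by blast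

lemma kern_num_vars_in: "u \<in> X \<Longrightarrow> v \<in> X \<Longrightarrow> kern_num Q u v \<in> vars_in X"
  unfolding kern_num_def
  by (auto intro!: vars_in_mult vars_in_power vars_in_diff vars_in_one xvar_vars_in)

lemma word_num_vars_in: "set (map fst l) \<subseteq> X \<Longrightarrow> word_num Q l \<in> vars_in X"
proof (induction l)
  case (Cons p l)
  obtain u r where p: "p = (u, r)" by (cases p)
  have "(\<Prod>v\<leftarrow>vs. kern_num Q u v) \<in> vars_in X" if "set vs \<subseteq> X" for vs
    using that Cons.prems
    by (induction vs) (auto simp: p vars_in_one intro!: vars_in_mult kern_num_vars_in)
  from this[of "map fst l"] show ?case
    using Cons by (auto simp: p intro!: vars_in_mult xvar_vars_in)
qed (simp add: vars_in_one)

lemma vars_in_cancel: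
  fixes g h :: "'v::linorder laurent"
  assumes g: "g \<in> vars_in X" "g \<noteq> 0" and gh: "g * h \<in> vars_in X" and X: "v0 \<in> X"
  shows "h \<in> vars_in X"
proof -
  \<comment> \<open>Substituting \<open>x\<^bsub>v0\<^esub>\<close> for all variables outside \<open>X\<close> fixes \<open>g\<close> and \<open>g * h\<close>, hence \<open>h\<close>.\<close>
  define \<zeta> where "\<zeta> v = (if v \<in> X then v else v0)" for v
  have id: "rename_vars \<zeta> f = f" if "f \<in> vars_in X" for f
    using rename_vars_cong[OF that, of \<zeta> id] by (simp add: \<zeta>_def del: split_paired_All)
  have "g * rename_vars \<zeta> h = g * h"
    using id[OF gh] by (simp add: rename_vars_mult id[OF g(1)])
  then have "rename_vars \<zeta> h = h" using g(2) by simp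
  moreover have "rename_vars \<zeta> h \<in> vars_in (\<zeta> ` UNIV)"
    by (rule vars_in_rename) (simp add: vars_in_def)
  moreover have "\<zeta> ` UNIV \<subseteq> X" using X by (auto simp: \<zeta>_def)
  ultimately show ?thesis using vars_in_mono by metis
qed

lemma K_Rep_iff: "f \<in> K_Rep \<alpha> \<longleftrightarrow> f \<in> vars_in (dim_vars \<alpha>) \<and> (\<forall>\<sigma>\<in>sym_group \<alpha>. rename_vars \<sigma> f = f)"
  unfolding K_Rep_def vars_in_def by blast

text \<open>Numerator and Vandermonde product change by the same sign, so their quotient is
  invariant; a foreign variable in the quotient would remain in its product with the Vandermonde
  product.\<close>

lemma shuffle_elt_K_Rep:
  fixes w :: "('v::linorder \<times> int) list"
  shows "shuffle_elt Q w \<in> K_Rep (wt (map fst w))"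
  unfolding K_Rep_iff
proof (intro conjI ballI)
  let ?\<gamma> = "wt (map fst w)"
  let ?V = "vandermonde (dim_vars ?\<gamma>)"
  have A: "?V * shuffle_elt Q w \<in> vars_in (dim_vars ?\<gamma>)"
    unfolding vandermonde_shuffle_elt
    by (intro antisymmetrize_vars_in word_num_vars_in) (simp add: set_pos del: set_map)
  show "shuffle_elt Q w \<in> vars_in (dim_vars ?\<gamma>)"
  proof (cases "dim_vars ?\<gamma> = {}")
    \<comment> \<open>\<open>vars_in_cancel\<close> needs some variable to substitute; without
      variables the Vandermonde product is 1.\<close>
    case True
    then have "?V = 1" by (simp add: vandermonde_def vpairs_def)
    with A show ?thesis by simp
  next
    case False
    then show ?thesis
      using vars_in_cancel[OF vandermonde_vars_in vandermonde_neq_0[OF finite_dim_vars] A] by blast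
  qed
  fix \<sigma> assume \<sigma>: "\<sigma> \<in> sym_group ?\<gamma>"
  have "(eps ?\<gamma> \<sigma> * ?V) * rename_vars \<sigma> (shuffle_elt Q w) = rename_vars \<sigma> (?V * shuffle_elt Q w)"
    by (simp only: rename_vars_mult rename_vandermonde[OF \<sigma>])
  also have "\<dots> = (eps ?\<gamma> \<sigma> * ?V) * shuffle_elt Q w"
    by (simp only: vandermonde_shuffle_elt rename_antisymmetrize[OF \<sigma>] mult.assoc)
  finally show "rename_vars \<sigma> (shuffle_elt Q w) = shuffle_elt Q w"
    using vandermonde_neq_0[OF finite_dim_vars, of ?\<gamma>] by (simp add: eps_def split: if_splits)
qed

lemma K_Rep_lincomb:
  assumes "\<And>a. a \<in> A \<Longrightarrow> F a \<in> K_Rep \<alpha>"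
  shows "(\<Sum>a\<in>A. cst (c a) * F a) \<in> K_Rep \<alpha>"
  using assms unfolding K_Rep_iff
  by (auto simp: rename_vars_sum rename_vars_mult vars_in_single
      intro!: vars_in_sum vars_in_mult sum.cong)

section \<open>The quiver of type A\<close>

lemma num_arrows_quiver_A:
  "num_arrows (quiver_A m) i i' = (if i = Suc i' \<and> 1 \<le> i' \<and> i' < m then 1 else 0)"
proof -
  have "{e \<in> arcs (quiver_A m). tail (quiver_A m) e = i \<and> head (quiver_A m) e = i'}
      = (if i = Suc i' \<and> 1 \<le> i' \<and> i' < m then {i'} else {})"
    by (auto simp: quiver_A_def)
  then show ?thesis by (simp add: num_arrows_def)
qed

lemma shuffle_elt_single:
  "shuffle_elt Q [(i, r)] = (xvar (i, 1) (- r) :: 'v::linorder laurent)"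
proof (rule shuffle_elt_eqI)
  let ?\<gamma> = "unit_dim i :: 'v dimvec"
  have "sym_group ?\<gamma> = {id}"
    using id_in_sym_group[of ?\<gamma>]
    by (auto simp: sym_group_def permutes_sing id_def simp del: id_in_sym_group)
  moreover have "vpairs {(i, 1::nat)} = {}" by (auto simp: vpairs_def)
  ultimately show "vandermonde (dim_vars (wt (map fst [(i, r)]))) * xvar (i, 1) (- r)
      = antisymmetrize (wt (map fst [(i, r)])) (word_num Q (lab [(i, r)]))"
    by (simp add: vandermonde_def antisymmetrize_def lab_Cons flip: id_def)
qed

lemma shuffle_elt_Nil: "shuffle_elt Q [] = (1 :: 'v::linorder laurent)"
proof (rule shuffle_elt_eqI)
  have "sym_group (0 :: 'v dimvec) = {id}"
    using id_in_sym_group[of "0 :: 'v dimvec"]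
    by (auto simp: sym_group_def id_def simp del: id_in_sym_group)
  then show "vandermonde (dim_vars (wt (map fst []))) * 1 = antisymmetrize (wt (map fst [])) (word_num Q (lab []))"
    by (simp add: vandermonde_def vpairs_def antisymmetrize_def flip: id_def)
qed

section \<open>The defining relations on words of two letters\<close>

lemma lab_two: "lab [(i, r), (j, s)] = [((i, 1), - r), ((j, if i = j then 2 else 1), - s)]"
  by (simp add: lab_Cons shift_def lookup_unit_dim)

text \<open>With the extra factor of \<open>kern_num\<close> the numerator is
  \<open>x_{i1}^{-r} x_{i2}^{1-s}\<close>. Transposing the two variables gives the numerator for the
  indices s - 1 and r + 1, whence the shifts in relation (i); the sign is that of the
  transposition.\<close>

lemma shuffle_elt_same_vertex:
  fixes i :: "'v::linorder"
  assumes "num_arrows Q i i = 0"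
  shows "shuffle_elt Q [(i, r), (i, s)] = - shuffle_elt Q [(i, s - 1), (i, r + 1)]"
proof (rule shuffle_elt_eqI)
  let ?\<gamma> = "wt (map fst [(i, r), (i, s)])" and ?t = "transpose (i, 1) (i, 2) :: 'v \<times> nat \<Rightarrow> 'v \<times> nat"
  have N: "word_num Q (lab [(i, r), (i, s)]) = xvar (i, 1) (- r) * xvar (i, 2) (1 - s)" for r s
    using assms by (simp add: lab_two kern_num_def mult.assoc xvar_mult)
  have d: "(i, 1) \<in> dim_vars ?\<gamma>" "(i, 2) \<in> dim_vars ?\<gamma>"
    by (simp_all only: mem_dim_vars lookup_wt) simp_all
  then have p: "((i, 1), (i, 2)) \<in> vpairs (dim_vars ?\<gamma>)" by (simp add: vpairs_def)
  have t: "?t \<in> sym_group ?\<gamma>" by (rule transpose_in_sym_group[OF d]) simp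
  have "word_num Q (lab [(i, r), (i, s)]) = rename_vars ?t (word_num Q (lab [(i, s - 1), (i, r + 1)]))"
    by (simp add: N rename_vars_mult mult.commute)
  then have "antisymmetrize ?\<gamma> (word_num Q (lab [(i, r), (i, s)]))
      = - antisymmetrize ?\<gamma> (word_num Q (lab [(i, s - 1), (i, r + 1)]))"
    by (simp only: antisymmetrize_rename[OF t] eps_transpose[OF p] mult_minus1)
  then show "vandermonde (dim_vars ?\<gamma>) * - shuffle_elt Q [(i, s - 1), (i, r + 1)]
      = antisymmetrize ?\<gamma> (word_num Q (lab [(i, r), (i, s)]))"
    using vandermonde_shuffle_elt[of "[(i, s - 1), (i, r + 1)]" Q] by simp
qed

text \<open>The identity holds for the numerators: the arrow contributes
  \<open>1 - x_j / x_i\<close> when j stands on the left, and multiplying this out gives the two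
  words with i on the left.\<close>

lemma shuffle_elt_arrow:
  fixes i j :: "'v::linorder"
  assumes "num_arrows Q j i = 1" "num_arrows Q i j = 0" "i \<noteq> j"
  shows "shuffle_elt Q [(j, s), (i, r)]
    = shuffle_elt Q [(i, r), (j, s)] - shuffle_elt Q [(i, r + 1), (j, s - 1)]"
proof (rule shuffle_elt_eqI)
  let ?\<gamma> = "wt (map fst [(j, s), (i, r)])"
  have \<gamma>: "wt (map fst [(i, r'), (j, s')]) = ?\<gamma>" for r' s' by (simp add: add.commute)
  have N: "word_num Q (lab [(j, s), (i, r)])
      = word_num Q (lab [(i, r), (j, s)]) - word_num Q (lab [(i, r + 1), (j, s - 1)])"
  proof -
    have "word_num Q (lab [(j, s), (i, r)])
        = xvar (i, 1) (- r) * xvar (j, 1) (- s)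
          - (xvar (i, 1) (-1) * xvar (i, 1) (- r)) * (xvar (j, 1) 1 * xvar (j, 1) (- s))"
      using assms by (simp add: lab_two kern_num_def algebra_simps del: xvar_mult)
    also have "\<dots> = word_num Q (lab [(i, r), (j, s)]) - word_num Q (lab [(i, r + 1), (j, s - 1)])"
    proof -
      have e: "- 1 - r = - r - 1" by simp
      show ?thesis using assms by (simp add: lab_two kern_num_def xvar_mult e)
    qed
    finally show ?thesis .
  qed
  show "vandermonde (dim_vars ?\<gamma>) *
      (shuffle_elt Q [(i, r), (j, s)] - shuffle_elt Q [(i, r + 1), (j, s - 1)])
      = antisymmetrize ?\<gamma> (word_num Q (lab [(j, s), (i, r)]))"
    unfolding N antisymmetrize_diff right_diff_distrib
    using vandermonde_shuffle_elt[of "[(i, r), (j, s)]" Q]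
      vandermonde_shuffle_elt[of "[(i, r + 1), (j, s - 1)]" Q]
    unfolding \<gamma> by (simp only:)
qed

lemma shuffle_elt_no_arrow:
  fixes i j :: "'v::linorder"
  assumes "num_arrows Q j i = 0" "num_arrows Q i j = 0" "i \<noteq> j"
  shows "shuffle_elt Q [(i, r), (j, s)] = shuffle_elt Q [(j, s), (i, r)]"
proof (rule shuffle_elt_eqI)
  let ?\<gamma> = "wt (map fst [(i, r), (j, s)])"
  have \<gamma>: "wt (map fst [(j, s), (i, r)]) = ?\<gamma>" by (simp add: add.commute)
  have "word_num Q (lab [(i, r), (j, s)]) = word_num Q (lab [(j, s), (i, r)])"
    using assms by (simp add: lab_two kern_num_def mult.commute)
  then show "vandermonde (dim_vars ?\<gamma>) * shuffle_elt Q [(j, s), (i, r)]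
      = antisymmetrize ?\<gamma> (word_num Q (lab [(i, r), (j, s)]))"
    using vandermonde_shuffle_elt[of "[(j, s), (i, r)]" Q] unfolding \<gamma> by (simp only:)
qed

section \<open>Words sorted by vertex\<close>

text \<open>The exponent vector of \<open>word_num\<close> when no arrow factor occurs. The middle
  sum collects the factors \<open>x_v\<close> that \<open>kern_num\<close> has for pairs at the same
  vertex.\<close>

fun expo :: "(('v \<times> nat) \<times> int) list \<Rightarrow> ('v \<times> nat) \<Rightarrow>\<^sub>0 int" where
  "expo [] = 0"
| "expo ((u, r) # l) = Poly_Mapping.single u r +
     (\<Sum>v\<leftarrow>map fst l. if fst u = fst v then Poly_Mapping.single v 1 else 0) + expo l"

lemma word_num_sorted:
  assumes "sorted (map (fst \<circ> fst) l)"
  shows "word_num (quiver_A m) l = Poly_Mapping.single (expo l) 1"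
  using assms
proof (induction l)
  case (Cons p l)
  obtain u r where p: "p = (u, r)" by (cases p)
  have "(\<Prod>v\<leftarrow>vs. kern_num (quiver_A m) u v)
      = Poly_Mapping.single (\<Sum>v\<leftarrow>vs. if fst u = fst v then Poly_Mapping.single v 1 else 0) 1"
    if "\<forall>v\<in>set vs. fst u \<le> fst v" for vs
    using that
    by (induction vs) (auto simp: kern_num_def num_arrows_quiver_A mult_single xvar_def)
  from this[of "map fst l"] show ?case
    using Cons by (auto simp: p mult_single xvar_def)
qed simp

lemma expo_relabel:
  assumes "\<And>v. fst (\<rho> v) = fst v"
  shows "expo (relabel \<rho> l) = ren \<rho> (expo l)"
proof (induction l)
  case (Cons p l)
  obtain u r where p: "p = (u, r)" by (cases p)
  have "ren \<rho> (\<Sum>v\<leftarrow>vs. if fst u = fst v then Poly_Mapping.single v 1 else 0)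
      = (\<Sum>v\<leftarrow>map \<rho> vs. if fst u = fst v then Poly_Mapping.single v 1 else 0)" for vs
    by (induction vs) (simp_all add: ren_add assms del: split_paired_All)
  then show ?case
    by (simp only: p relabel_simps expo.simps ren_add ren_single Cons assms)
qed simp

lemma keys_expo: "Poly_Mapping.keys (expo l) \<subseteq> set (map fst l)"
proof (induction l)
  case (Cons p l)
  obtain u r where p: "p = (u, r)" by (cases p)
  have *: "Poly_Mapping.keys (\<Sum>v\<leftarrow>vs. if fst u = fst v then Poly_Mapping.single v (1::int) else 0) \<subseteq> set vs" for vs
  proof (induction vs)
    case (Cons v vs)
    have "Poly_Mapping.keys (if fst u = fst v then Poly_Mapping.single v (1::int) else 0) \<subseteq> {v}" by simp
    with Cons show ?case
      using keys_add[of "if fst u = fst v then Poly_Mapping.single v (1::int) else 0"] by fastforce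
  qed simp
  let ?s = "\<Sum>v\<leftarrow>map fst l. if fst u = fst v then Poly_Mapping.single v (1::int) else 0"
  have "Poly_Mapping.keys (expo (p # l))
      \<subseteq> Poly_Mapping.keys (Poly_Mapping.single u r + ?s) \<union> Poly_Mapping.keys (expo l)"
    unfolding p expo.simps by (rule keys_add)
  also have "\<dots> \<subseteq> {u} \<union> set (map fst l) \<union> set (map fst l)"
    using keys_add[of "Poly_Mapping.single u r" ?s] *[of "map fst l"] Cons
    by (intro Un_mono) (force split: if_splits)+
  finally show ?case by (auto simp: p)
qed simp

text \<open>The j-th occurrence of a vertex receives 1 from each of the j - 1 earlier ones: the
  staircase shift.\<close>

lemma lookup_expo_lab:
  "(q, s) \<in> set (lab w) \<Longrightarrow> Poly_Mapping.lookup (expo (lab w)) q = s + int (snd q) - 1"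
proof (induction w arbitrary: q s)
  case (Cons p w)
  obtain i r where p: "p = (i, r)" by (cases p)
  let ?t = "shift (unit_dim i)" and ?xs = "map fst w"
  \<comment> \<open>The new first letter raises by 1 exactly the variables of the later letters at
    its vertex.\<close>
  have sum: "Poly_Mapping.lookup (\<Sum>v\<leftarrow>map ?t (pos ?xs). if i = fst v then Poly_Mapping.single v (1::int) else 0) q
      = (if i = fst q \<and> q \<in> ?t ` set (pos ?xs) then 1 else 0)" for q
  proof -
    have "distinct (map ?t (pos ?xs))"
      unfolding distinct_map using distinct_pos inj_shift by (metis inj_on_subset subset_UNIV)
    then have "(\<Sum>v\<leftarrow>map ?t (pos ?xs). if i = fst v then Poly_Mapping.single v (1::int) else 0)
      = (\<Sum>v\<in>set (map ?t (pos ?xs)). if i = fst v then Poly_Mapping.single v (1::int) else 0)"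
      by (rule sum_list_distinct_conv_sum_set)
    then show ?thesis
      by (simp add: lookup_sum lookup_single when_def if_distrib[of "\<lambda>x. Poly_Mapping.lookup x q"] 
          cong: if_cong) (auto simp: sum.If_cases)
  qed
  have lab: "expo (lab (p # w)) = Poly_Mapping.single (i, 1) (- r)
      + (\<Sum>v\<leftarrow>map ?t (pos ?xs). if i = fst v then Poly_Mapping.single v 1 else 0) + ren ?t (expo (lab w))"
    unfolding p lab_Cons expo.simps relabel_simps map_fst_lab fst_conv
    by (subst expo_relabel) simp_all
  have new: "(i, 1) \<noteq> ?t v" if "v \<in> set (pos ?xs)" for v
    using snd_pos_pos[OF that] by (cases v) (auto simp: shift_def lookup_unit_dim)
  have K: "Poly_Mapping.keys (expo (lab w)) \<subseteq> set (pos ?xs)"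
    using keys_expo[of "lab w"] by (simp only: map_fst_lab)
  from Cons.prems consider "q = (i, 1)" "s = - r"
    | q' where "q = ?t q'" "(q', s) \<in> set (lab w)"
    by (auto simp: p lab_Cons relabel_def)
  then show ?case
  proof cases
    case 1
    have "(i, 1) \<notin> Poly_Mapping.keys (ren ?t (expo (lab w)))"
      using keys_ren[of ?t "expo (lab w)"] K new by blast
    then have "Poly_Mapping.lookup (ren ?t (expo (lab w))) (i, 1) = 0"
      by (simp add: in_keys_iff)
    moreover have "(i, 1) \<notin> ?t ` set (pos ?xs)" using new by blast
    ultimately show ?thesis
      unfolding lab 1 lookup_add sum by simp
  next
    case 2
    have q': "q' \<in> set (pos ?xs)"
      using 2(2) by (metis fst_conv image_eqI set_map map_fst_lab)
    then have "q \<in> ?t ` set (pos ?xs)" using 2(1) by blast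
    moreover have "(i, 1) \<noteq> q" using new[OF q'] 2(1) by simp
    moreover have "Poly_Mapping.lookup (ren ?t (expo (lab w))) q = s + int (snd q') - 1"
      unfolding 2(1) lookup_ren_inj[OF inj_shift] by (rule Cons.IH[OF 2(2)])
    ultimately show ?thesis
      unfolding lab lookup_add sum by (simp add: lookup_single when_def 2(1) lookup_unit_dim)
  qed
qed simp

lemma sorted_lab: "sorted (map fst w) \<Longrightarrow> sorted (map (fst \<circ> fst) (lab w))"
  by (simp flip: map_map)

lemma ex_word_expo:
  assumes "Poly_Mapping.keys m \<subseteq> dim_vars (wt xs)"
  shows "\<exists>w. map fst w = xs \<and> expo (lab w) = m"
proof (intro exI conjI)
  \<comment> \<open>Solves the formula of \<open>lookup_expo_lab\<close> for the second index: the
    j-th occurrence with index r has exponent -r + j - 1.\<close>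
  define w where "w = map (\<lambda>q. (fst q, int (snd q) - 1 - Poly_Mapping.lookup m q)) (pos xs)"
  show fst: "map fst w = xs" by (simp add: w_def comp_def)
  have "lab w = map (\<lambda>q. (q, Poly_Mapping.lookup m q - int (snd q) + 1)) (pos xs)"
    unfolding lab_def fst by (simp add: w_def comp_def zip_map2 zip_same_conv_map)
  then have lab: "(q, Poly_Mapping.lookup m q - int (snd q) + 1) \<in> set (lab w)" if "q \<in> dim_vars (wt xs)" for q
    using that by (auto simp: set_pos)
  show "expo (lab w) = m"
  proof (rule poly_mapping_eqI)
    fix q show "Poly_Mapping.lookup (expo (lab w)) q = Poly_Mapping.lookup m q"
    proof (cases "q \<in> dim_vars (wt xs)")
      case True
      then show ?thesis using lookup_expo_lab[OF lab] by simp
    next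
      case False
      moreover have "Poly_Mapping.keys (expo (lab w)) \<subseteq> dim_vars (wt xs)"
        using keys_expo[of "lab w"] by (simp only: map_fst_lab fst set_pos)
      ultimately show ?thesis using assms by (metis in_keys_iff subsetD)
    qed
  qed
qed

lemma ex_sorted_wt: "\<exists>xs :: 'v::linorder list. sorted xs \<and> wt xs = \<gamma>"
proof -
  have "\<exists>ys. wt ys = \<gamma>"
  proof (induction \<gamma> rule: poly_mapping_add_induct)
    case (single k c)
    have "wt (replicate c k) = Poly_Mapping.single k c"
      by (rule poly_mapping_eqI) (auto simp: lookup_wt lookup_single when_def simp flip: count_mset)
    then show ?case by blast
  next
    case (add f g)
    then show ?case by (metis wt_simps(3))
  qed
  then obtain ys where "wt ys = \<gamma>" by blast
  moreover have "wt (sort ys) = wt ys"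
    by (rule poly_mapping_eqI) (simp add: lookup_wt flip: count_mset)
  ultimately show ?thesis by (metis sorted_sort)
qed

lemma K_Rep_lincomb_shuffle_elt:
  fixes f :: "nat laurent"
  assumes "f \<in> K_Rep \<gamma>"
  shows "\<exists>A c. finite A \<and> (\<forall>w\<in>A. wt (map fst w) = \<gamma>) \<and>
    f = (\<Sum>w\<in>A. cst (c w) * shuffle_elt (quiver_A m) w)"
proof -
  let ?V = "vandermonde (dim_vars \<gamma>)" and ?Q = "quiver_A m"
  obtain xs :: "nat list" where xs: "sorted xs" "wt xs = \<gamma>" using ex_sorted_wt by blast
  have VF: "?V * f \<in> vars_in (dim_vars \<gamma>)"
    using assms by (intro vars_in_mult vandermonde_vars_in) (simp add: K_Rep_iff)
  then have "\<forall>k\<in>Poly_Mapping.keys (?V * f). \<exists>w. map fst w = xs \<and> expo (lab w) = k"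
    using ex_word_expo[of _ xs] xs by (simp add: vars_in_def)
  then obtain W where W: "map fst (W k) = xs" "expo (lab (W k)) = k" if "k \<in> Poly_Mapping.keys (?V * f)" for k
    by metis
  \<comment> \<open>The scalar by which antisymmetrization acts on the antisymmetric polynomial
    \<open>?V * f\<close>; it is inverted at the end.\<close>
  define N :: complex where "N = of_nat (card (sym_group \<gamma>))"
  have N: "N \<noteq> 0" unfolding N_def of_nat_eq_0_iff using card_sym_group_pos[of \<gamma>] by (rule less_imp_neq[symmetric])
  have avg: "cst N * (?V * f) = antisymmetrize \<gamma> (?V * f)"
  proof -
    have "eps \<gamma> \<sigma> * rename_vars \<sigma> (?V * f) = ?V * f" if "\<sigma> \<in> sym_group \<gamma>" for \<sigma>
    proof -
      have "rename_vars \<sigma> f = f" using assms that by (simp add: K_Rep_iff)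
      then have "eps \<gamma> \<sigma> * rename_vars \<sigma> (?V * f) = (eps \<gamma> \<sigma> * eps \<gamma> \<sigma>) * (?V * f)"
        by (simp only: rename_vars_mult rename_vandermonde[OF that] mult.assoc)
      then show ?thesis by simp
    qed
    then show ?thesis
      by (simp add: antisymmetrize_def N_def single_of_nat)
  qed
  have expand: "?V * f = (\<Sum>k\<in>Poly_Mapping.keys (?V * f).
      cst (Poly_Mapping.lookup (?V * f) k) * Poly_Mapping.single k 1)"
    by (rule poly_mapping_eqI) (auto simp: mult_single lookup_sum lookup_single when_def in_keys_iff)
  have "antisymmetrize \<gamma> (\<Sum>k\<in>Poly_Mapping.keys (?V * f).
      cst (Poly_Mapping.lookup (?V * f) k) * Poly_Mapping.single k 1) = (\<Sum>k\<in>Poly_Mapping.keys (?V * f).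
      cst (Poly_Mapping.lookup (?V * f) k) * (?V * shuffle_elt ?Q (W k)))"
    unfolding antisymmetrize_sum antisymmetrize_scale
  proof (intro sum.cong refl)
    fix k assume k: "k \<in> Poly_Mapping.keys (?V * f)"
    have "?V * shuffle_elt ?Q (W k) = antisymmetrize \<gamma> (Poly_Mapping.single k 1)"
      using vandermonde_shuffle_elt[of "W k" ?Q] word_num_sorted[OF sorted_lab, of "W k" m]
      by (simp add: W[OF k] xs)
    then show "cst (Poly_Mapping.lookup (?V * f) k) * antisymmetrize \<gamma> (Poly_Mapping.single k 1) =
        cst (Poly_Mapping.lookup (?V * f) k) * (?V * shuffle_elt ?Q (W k))" by simp
  qed
  also have "\<dots> = ?V * (\<Sum>k\<in>Poly_Mapping.keys (?V * f).
      cst (Poly_Mapping.lookup (?V * f) k) * shuffle_elt ?Q (W k))"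
    by (simp only: sum_distrib_left mult.left_commute[of _ ?V])
  finally have "?V * (cst N * f) = ?V * (\<Sum>k\<in>Poly_Mapping.keys (?V * f).
      cst (Poly_Mapping.lookup (?V * f) k) * shuffle_elt ?Q (W k))"
    using avg unfolding expand[symmetric] mult.left_commute[of _ ?V] by (rule trans[rotated])
  then have Nf: "cst N * f = (\<Sum>k\<in>Poly_Mapping.keys (?V * f).
      cst (Poly_Mapping.lookup (?V * f) k) * shuffle_elt ?Q (W k))"
    using mult_left_cancel[OF vandermonde_neq_0[OF finite_dim_vars]] by blast
  have "f = cst (1 / N) * (cst N * f)"
    using N by (simp add: mult_single flip: mult.assoc)
  also have "\<dots> = (\<Sum>k\<in>Poly_Mapping.keys (?V * f).
      cst (Poly_Mapping.lookup (?V * f) k / N) * shuffle_elt ?Q (W k))"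
    unfolding Nf by (simp add: sum_distrib_left mult_single flip: mult.assoc)
  \<comment> \<open>The sum is reindexed from monomials to words; \<open>W\<close> is injective
    because \<open>expo (lab w)\<close> recovers the monomial.\<close>
  also have "\<dots> = (\<Sum>w\<in>W ` Poly_Mapping.keys (?V * f).
      cst (Poly_Mapping.lookup (?V * f) (expo (lab w)) / N) * shuffle_elt ?Q w)"
    by (subst sum.reindex) (auto simp: W intro!: inj_on_inverseI[where g = "\<lambda>w. expo (lab w)"])
  finally show ?thesis
    using W xs by (intro exI[of _ "W ` Poly_Mapping.keys (?V * f)"] exI) (auto simp del: map_eq_Cons_conv)
qed

section \<open>Linear independence of antisymmetrized monomials\<close>

definition strict_expo :: "('v \<times> nat) set \<Rightarrow> ('v \<times> nat \<Rightarrow>\<^sub>0 int) \<Rightarrow> bool" where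
  "strict_expo X \<mu> \<longleftrightarrow> (\<forall>(u, v)\<in>vpairs X. Poly_Mapping.lookup \<mu> u < Poly_Mapping.lookup \<mu> v)"

text \<open>An orbit of exponent vectors contains at most one strict vector, and its stabilizer is
  trivial. Otherwise take a moved variable v with least second component. Its image and its preimage
  z both lie above v, so \<mu> z = \<nu> v < \<nu> (\<sigma> v) = \<mu> v < \<mu> z.\<close>

lemma strict_expo_rigid:
  assumes \<sigma>: "\<sigma> \<in> sym_group \<gamma>"
    and \<mu>: "strict_expo (dim_vars \<gamma>) \<mu>" and \<nu>: "strict_expo (dim_vars \<gamma>) \<nu>" and eq: "ren \<sigma> \<mu> = \<nu>"
  shows "\<sigma> = id"
proof (rule ccontr)
  assume "\<sigma> \<noteq> id"
  then obtain v0 where "\<sigma> v0 \<noteq> v0" by (auto simp only: fun_eq_iff id_apply)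
  define v where "v = arg_min snd (\<lambda>v. \<sigma> v \<noteq> v)"
  have v: "\<sigma> v \<noteq> v" unfolding v_def by (rule arg_min_natI) fact
  have least: "\<sigma> u = u" if "snd u < snd v" for u
    using arg_min_nat_le[of "\<lambda>v. \<sigma> v \<noteq> v" u snd] that unfolding v_def[symmetric] by linarith
  have inj: "\<sigma> a = \<sigma> b \<longleftrightarrow> a = b" for a b using sym_group_inj[OF \<sigma>] by (simp add: inj_eq)
  have mem: "\<sigma> a \<in> dim_vars \<gamma> \<longleftrightarrow> a \<in> dim_vars \<gamma>" for a
    using permutes_in_image[OF sym_group_permutes[OF \<sigma>]] by blast
  have vd: "v \<in> dim_vars \<gamma>" using v permutes_not_in[OF sym_group_permutes[OF \<sigma>]] by blast
  have look: "Poly_Mapping.lookup \<nu> (\<sigma> u) = Poly_Mapping.lookup \<mu> u" for u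
    unfolding eq[symmetric] by (rule lookup_ren_inj[OF sym_group_inj[OF \<sigma>]])
  obtain z where z: "\<sigma> z = v"
    using permutes_surj[OF sym_group_permutes[OF \<sigma>]] by (metis surjD)
  have fst: "fst z = fst v" "fst (\<sigma> v) = fst v"
    using sym_group_fst[OF \<sigma>, of z] z sym_group_fst[OF \<sigma>] by auto
  have zv: "z \<noteq> v" using z v by metis
  have "\<not> snd z < snd v" using least[of z] z zv by metis
  moreover have "snd z \<noteq> snd v" using zv fst by (metis prod_eqI)
  ultimately have "(v, z) \<in> vpairs (dim_vars \<gamma>)"
    using vd z mem[of z] fst by (simp add: vpairs_def)
  then have 1: "Poly_Mapping.lookup \<mu> v < Poly_Mapping.lookup \<mu> z"
    using \<mu> unfolding strict_expo_def by blast
  have "\<not> snd (\<sigma> v) < snd v" using least[of "\<sigma> v"] v inj by blast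
  moreover have "snd (\<sigma> v) \<noteq> snd v" using v fst by (metis prod_eqI)
  ultimately have "(v, \<sigma> v) \<in> vpairs (dim_vars \<gamma>)"
    using vd mem fst by (simp add: vpairs_def)
  then have "Poly_Mapping.lookup \<nu> v < Poly_Mapping.lookup \<nu> (\<sigma> v)"
    using \<nu> unfolding strict_expo_def by blast
  then show False using 1 look[of v] look[of z] z by simp
qed

text \<open>By rigidity only the identity can carry one strict vector to another. The coefficients
  at strict vectors thus form an identity matrix, which is the linear independence used for
  injectivity.\<close>

lemma lookup_antisymmetrize_strict:
  assumes \<mu>: "strict_expo (dim_vars \<gamma>) \<mu>" and \<nu>: "strict_expo (dim_vars \<gamma>) \<nu>"
  shows "Poly_Mapping.lookup (antisymmetrize \<gamma> (Poly_Mapping.single \<mu> 1)) \<nu> = (if \<mu> = \<nu> then 1 else 0)"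
proof -
  have "Poly_Mapping.lookup (antisymmetrize \<gamma> (Poly_Mapping.single \<mu> 1)) \<nu>
      = (\<Sum>\<sigma>\<in>sym_group \<gamma>. Poly_Mapping.lookup (eps \<gamma> \<sigma> * Poly_Mapping.single (ren \<sigma> \<mu>) 1) \<nu>)"
    by (simp add: antisymmetrize_def lookup_sum)
  also have "\<dots> = (\<Sum>\<sigma>\<in>{id}. Poly_Mapping.lookup (eps \<gamma> \<sigma> * Poly_Mapping.single (ren \<sigma> \<mu>) 1) \<nu>)"
  proof (rule sum.mono_neutral_right)
    show "\<forall>\<sigma>\<in>sym_group \<gamma> - {id}. Poly_Mapping.lookup (eps \<gamma> \<sigma> * Poly_Mapping.single (ren \<sigma> \<mu>) 1) \<nu> = 0"
    proof
      fix \<sigma> assume "\<sigma> \<in> sym_group \<gamma> - {id}"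
      then have "ren \<sigma> \<mu> \<noteq> \<nu>" using strict_expo_rigid[OF _ \<mu> \<nu>] by blast
      then show "Poly_Mapping.lookup (eps \<gamma> \<sigma> * Poly_Mapping.single (ren \<sigma> \<mu>) 1) \<nu> = 0"
        by (simp add: eps_def lookup_single)
    qed
  qed simp_all
  also have "\<dots> = Poly_Mapping.lookup (Poly_Mapping.single \<mu> 1) \<nu>"
    by (simp add: ren_id[unfolded id_def])
  finally show ?thesis by (simp add: lookup_single when_def)
qed

section \<open>The map from the free algebra to the Hall algebra\<close>

abbreviation wgt :: "('v \<times> int) word \<Rightarrow> 'v dimvec" where
  "wgt w \<equiv> wt (map fst (letters w))"

text \<open>Given on words directly instead of through the generators: multiplicativity becomes a
  statement about the concatenation of two words.\<close>

definition hall_map ::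
    "('v::linorder, 'e) pre_digraph \<Rightarrow> ('v \<times> int) ncpoly \<Rightarrow> 'v dimvec \<Rightarrow>\<^sub>0 'v laurent" where
  "hall_map Q p = (\<Sum>w\<in>Poly_Mapping.keys p.
     Poly_Mapping.single (wgt w) (cst (Poly_Mapping.lookup p w) * shuffle_elt Q (letters w)))"

lemma hall_map_single:
  "hall_map Q (Poly_Mapping.single w c) = Poly_Mapping.single (wgt w) (cst c * shuffle_elt Q (letters w))"
  by (simp add: hall_map_def)

lemma hall_map_zero [simp]: "hall_map Q 0 = 0"
  by (simp add: hall_map_def)

lemma hall_map_add: "hall_map Q (p + q) = hall_map Q p + hall_map Q q"
  unfolding hall_map_def
  by (rule setsum_keys_plus_distrib) (simp_all add: single_add distrib_right)

lemma hall_map_uminus: "hall_map Q (- p) = - hall_map Q p"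
  using hall_map_add[of Q p "- p"] by (simp add: eq_neg_iff_add_eq_0 add.commute)

lemma hall_map_diff: "hall_map Q (p - q) = hall_map Q p - hall_map Q q"
  using hall_map_add[of Q p "- q"] by (simp add: hall_map_uminus)

lemma hall_map_sum: "hall_map Q (sum g A) = (\<Sum>a\<in>A. hall_map Q (g a))"
  by (induction A rule: infinite_finite_induct) (simp_all add: hall_map_add)

lemma hall_map_scale: "smult (KHA Q) c (hall_map Q p) = hall_map Q (Poly_Mapping.single 0 c * p)"
proof -
  have "smult (KHA Q) c (hall_map Q p) = Poly_Mapping.single 0 (cst c) * hall_map Q p"
    by (simp add: KHA_def mult_map_scale_conv_mult)
  also have "\<dots> = hall_map Q (Poly_Mapping.single 0 c * p)"
  proof (induction p rule: poly_mapping_add_induct)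
    case (single w d)
    have *: "cst c * (cst d * shuffle_elt Q (letters w)) = cst (c * d) * shuffle_elt Q (letters w)"
      by (simp add: mult_single flip: mult.assoc)
    show ?case by (simp add: hall_map_single mult_single *)
  qed (simp add: hall_map_add distrib_left)
  finally show ?thesis .
qed

lemma single_sum: "Poly_Mapping.single k (sum g A) = (\<Sum>a\<in>A. Poly_Mapping.single k (g a))"
  by (induction A rule: infinite_finite_induct) (simp_all add: single_add)

lemma lookup_hall_map:
  "Poly_Mapping.lookup (hall_map Q p) \<gamma> =
    (\<Sum>w\<in>{w\<in>Poly_Mapping.keys p. wgt w = \<gamma>}. cst (Poly_Mapping.lookup p w) * shuffle_elt Q (letters w))"
  unfolding hall_map_def lookup_sum lookup_single when_def
  by (subst sum.inter_filter) simp_all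

text \<open>Both are bilinearity with an empty sum. They allow the product in \<open>KHA\<close> to
  be summed over degrees whose component has cancelled to 0.\<close>

lemma shuffle_prod_zero:
  fixes Q :: "('v::linorder, 'e) pre_digraph"
  shows "shuffle_prod Q \<alpha> \<beta> 0 g = 0" "shuffle_prod Q \<alpha> \<beta> f 0 = 0"
proof -
  have "shuffle_frac Q \<alpha> \<beta> 0 g = 0"
    using shuffle_frac_sum[of Q \<alpha> \<beta> "\<lambda>_::unit. 0" "{}" "\<lambda>_::unit. g" "{()}"] by simp
  then show "shuffle_prod Q \<alpha> \<beta> 0 g = 0"
    by (intro shuffle_prod_eqI) (simp add: fract_collapse)
  have "shuffle_frac Q \<alpha> \<beta> f 0 = 0"
    using shuffle_frac_sum[of Q \<alpha> \<beta> "\<lambda>_::unit. f" "{()}" "\<lambda>_::unit. 0" "{}"] by simp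
  then show "shuffle_prod Q \<alpha> \<beta> f 0 = 0"
    by (intro shuffle_prod_eqI) (simp add: fract_collapse)
qed

lemma keys_hall_map: "Poly_Mapping.keys (hall_map Q p) \<subseteq> wgt ` Poly_Mapping.keys p"
  unfolding hall_map_def
  by (rule order_trans[OF keys_sum]) auto

lemma hall_map_mult:
  fixes Q :: "('v::linorder, 'e) pre_digraph"
  assumes fin: "finite (verts Q)"
    and p: "\<And>w. w \<in> Poly_Mapping.keys p \<Longrightarrow> fst ` set (letters w) \<subseteq> verts Q"
    and q: "\<And>w. w \<in> Poly_Mapping.keys q \<Longrightarrow> fst ` set (letters w) \<subseteq> verts Q"
  shows "mult (KHA Q) (hall_map Q p) (hall_map Q q) = hall_map Q (p * q)"
proof -
  let ?F = "hall_map Q p" and ?G = "hall_map Q q"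
  let ?P = "Poly_Mapping.keys p" and ?R = "Poly_Mapping.keys q"
  let ?p = "Poly_Mapping.lookup p" and ?q = "Poly_Mapping.lookup q"
  let ?sh = "\<lambda>\<alpha> \<beta>. Poly_Mapping.single (\<alpha> + \<beta>)
      (shuffle_prod Q \<alpha> \<beta> (Poly_Mapping.lookup ?F \<alpha>) (Poly_Mapping.lookup ?G \<beta>))"
  let ?h = "\<lambda>u v. hall_map Q (Poly_Mapping.single (u + v) (?p u * ?q v))"
  have "mult (KHA Q) ?F ?G = (\<Sum>\<alpha>\<in>Poly_Mapping.keys ?F. \<Sum>\<beta>\<in>Poly_Mapping.keys ?G. ?sh \<alpha> \<beta>)"
    by (simp add: KHA_def)
  \<comment> \<open>The weight of a word of \<open>q\<close> can be missing from the support of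
    \<open>?G\<close> because of cancellation; the sum is enlarged by these zero terms, so that it
    can be regrouped by words.\<close>
  also have "\<dots> = (\<Sum>\<alpha>\<in>Poly_Mapping.keys ?F. \<Sum>\<beta>\<in>wgt ` ?R. ?sh \<alpha> \<beta>)"
    by (intro sum.cong refl sum.mono_neutral_left)
      (auto simp: keys_hall_map in_keys_iff shuffle_prod_zero)
  also have "\<dots> = (\<Sum>\<alpha>\<in>wgt ` ?P. \<Sum>\<beta>\<in>wgt ` ?R. ?sh \<alpha> \<beta>)"
    by (intro sum.mono_neutral_left)
      (auto simp: keys_hall_map in_keys_iff shuffle_prod_zero)
  also have "\<dots> = (\<Sum>\<alpha>\<in>wgt ` ?P. \<Sum>\<beta>\<in>wgt ` ?R.
      \<Sum>u\<in>{u\<in>?P. wgt u = \<alpha>}. \<Sum>v\<in>{v\<in>?R. wgt v = \<beta>}. ?h u v)"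
  proof (intro sum.cong refl)
    fix \<alpha> \<beta>
    have "shuffle_prod Q \<alpha> \<beta> (Poly_Mapping.lookup ?F \<alpha>) (Poly_Mapping.lookup ?G \<beta>)
        = (\<Sum>u\<in>{u\<in>?P. wgt u = \<alpha>}. \<Sum>v\<in>{v\<in>?R. wgt v = \<beta>}.
            cst (?p u * ?q v) * shuffle_elt Q (letters u @ letters v))"
      unfolding lookup_hall_map
    proof (rule shuffle_prod_lincomb)
      fix u v assume "u \<in> {u\<in>?P. wgt u = \<alpha>}" "v \<in> {v\<in>?R. wgt v = \<beta>}"
      then show "shuffle_frac Q \<alpha> \<beta> (shuffle_elt Q (letters u)) (shuffle_elt Q (letters v))
          = emb (shuffle_elt Q (letters u @ letters v))"
        using shuffle_frac_shuffle_elt[OF fin p q, of u v] by auto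
    qed
    then show "?sh \<alpha> \<beta> = (\<Sum>u\<in>{u\<in>?P. wgt u = \<alpha>}. \<Sum>v\<in>{v\<in>?R. wgt v = \<beta>}. ?h u v)"
      by (simp add: single_sum hall_map_single plus_word_def)
  qed
  also have "\<dots> = (\<Sum>\<alpha>\<in>wgt ` ?P. \<Sum>u\<in>{u\<in>?P. wgt u = \<alpha>}.
      \<Sum>\<beta>\<in>wgt ` ?R. \<Sum>v\<in>{v\<in>?R. wgt v = \<beta>}. ?h u v)"
    by (intro sum.cong refl sum.swap)
  also have "\<dots> = (\<Sum>\<alpha>\<in>wgt ` ?P. \<Sum>u\<in>{u\<in>?P. wgt u = \<alpha>}. \<Sum>v\<in>?R. ?h u v)"
    by (intro sum.cong refl sum.group) simp_all
  also have "\<dots> = (\<Sum>u\<in>?P. \<Sum>v\<in>?R. ?h u v)"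
    by (rule sum.group) simp_all
  also have "\<dots> = hall_map Q (\<Sum>u\<in>?P. \<Sum>v\<in>?R. Poly_Mapping.single (u + v) (?p u * ?q v))"
    by (simp only: hall_map_sum)
  also have "(\<Sum>u\<in>?P. \<Sum>v\<in>?R. Poly_Mapping.single (u + v) (?p u * ?q v)) = p * q"
  proof -
    have "p * q = (\<Sum>u\<in>?P. Poly_Mapping.single u (?p u)) * (\<Sum>v\<in>?R. Poly_Mapping.single v (?q v))"
      by (simp flip: poly_mapping_sum_single)
    then show ?thesis by (simp add: sum_product mult_single)
  qed
  finally show ?thesis .
qed

section \<open>Presented algebras\<close>

lemma free_algebra_simps [simp]:
  "mult (free_algebra X) = (*)" "one (free_algebra X) = 1"
  "zero (free_algebra X) = 0" "add (free_algebra X) = (+)"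
  by (simp_all add: free_algebra_def)

lemma free_algebra_carrier:
  "p \<in> carrier (free_algebra X) \<longleftrightarrow> (\<forall>w\<in>Poly_Mapping.keys p. set (letters w) \<subseteq> X)"
  by (simp add: free_algebra_def)

lemma free_algebra_add: 
  assumes "p \<in> carrier (free_algebra X)" "q \<in> carrier (free_algebra X)"
  shows "p + q \<in> carrier (free_algebra X)"
  using assms keys_add[of p q] unfolding free_algebra_carrier by blast

lemma free_algebra_mult:
  assumes "p \<in> carrier (free_algebra X)" "q \<in> carrier (free_algebra X)"
  shows "p * q \<in> carrier (free_algebra X)"
  unfolding free_algebra_carrier
proof
  fix w assume "w \<in> Poly_Mapping.keys (p * q)"
  then obtain u v where "w = u + v" "u \<in> Poly_Mapping.keys p" "v \<in> Poly_Mapping.keys q"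
    using keys_mult[of p q] by auto
  then show "set (letters w) \<subseteq> X"
    using assms by (auto simp: plus_word_def free_algebra_carrier)
qed

lemma free_algebra_single: "set l \<subseteq> X \<Longrightarrow> Poly_Mapping.single (Word l) c \<in> carrier (free_algebra X)"
  by (simp add: free_algebra_carrier)

lemma free_algebra_const: "Poly_Mapping.single 0 c \<in> carrier (free_algebra X)"
  by (simp add: free_algebra_carrier zero_word_def)

lemma free_algebra_uminus: "p \<in> carrier (free_algebra X) \<Longrightarrow> - p \<in> carrier (free_algebra X)"
  by (simp add: free_algebra_carrier in_keys_iff)

lemma free_algebra_diff:
  "p \<in> carrier (free_algebra X) \<Longrightarrow> q \<in> carrier (free_algebra X) \<Longrightarrow> p - q \<in> carrier (free_algebra X)"
  using free_algebra_add[of p X "- q"] free_algebra_uminus[of q X] by simp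

lemma free_algebra_sum:
  "(\<And>a. a \<in> A \<Longrightarrow> g a \<in> carrier (free_algebra X)) \<Longrightarrow> sum g A \<in> carrier (free_algebra X)"
  by (induction A rule: infinite_finite_induct) (auto simp: free_algebra_add free_algebra_carrier[of 0])

lemma ring_free_algebra: "ring (free_algebra X)"
proof (rule ringI)
  show "abelian_group (free_algebra X)"
    by (rule abelian_groupI)
      (auto simp: free_algebra_add free_algebra_carrier[of 0] add_ac
        intro!: bexI[OF _ free_algebra_uminus])
  show "monoid (free_algebra X)"
    using free_algebra_const[of 1 X]
    by (intro monoidI) (auto simp: free_algebra_mult mult.assoc)
qed (simp_all add: distrib_left distrib_right)

lemma free_algebra_minus:
  assumes "p \<in> carrier (free_algebra X)" "q \<in> carrier (free_algebra X)"
  shows "a_minus (free_algebra X) p q = p - q"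
proof -
  interpret ring "free_algebra X" by (rule ring_free_algebra)
  have "a_inv (free_algebra X) q = - q"
    using assms by (intro minus_equality) (simp_all add: free_algebra_uminus)
  then show ?thesis by (simp add: a_minus_def)
qed

text \<open>The first isomorphism theorem for algebras. Hypothesis \<open>ker\<close> speaks of
  pairs, so one direction makes the map on cosets well defined and the other makes it
  injective.\<close>

lemma presented_algebra_iso:
  fixes X :: "'x set" and h :: "'x ncpoly \<Rightarrow> 'b"
  defines "F \<equiv> free_algebra X"
  assumes R: "R \<subseteq> carrier F"
    and surj: "h ` carrier F = carrier B"
    and ker: "\<And>p q. p \<in> carrier F \<Longrightarrow> q \<in> carrier F \<Longrightarrow> h p = h q \<longleftrightarrow> p - q \<in> Idl\<^bsub>F\<^esub> R"
    and add: "\<And>p q. p \<in> carrier F \<Longrightarrow> q \<in> carrier F \<Longrightarrow> h (p + q) = h p \<oplus>\<^bsub>B\<^esub> h q"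
    and mult: "\<And>p q. p \<in> carrier F \<Longrightarrow> q \<in> carrier F \<Longrightarrow> h (p * q) = h p \<otimes>\<^bsub>B\<^esub> h q"
    and one: "h 1 = \<one>\<^bsub>B\<^esub>"
    and smult: "\<And>c p. p \<in> carrier F \<Longrightarrow> h (Poly_Mapping.single 0 c * p) = c \<odot>\<^bsub>B\<^esub> h p"
  shows "\<exists>\<phi>\<in>alg_iso (presented_algebra X R) B. \<forall>p\<in>carrier F. \<phi> ((Idl\<^bsub>F\<^esub> R) +>\<^bsub>F\<^esub> p) = h p"
proof -
  interpret F: ring F unfolding F_def by (rule ring_free_algebra)
  define J where "J = Idl\<^bsub>F\<^esub> R"
  interpret J: ideal J F unfolding J_def by (rule F.genideal_ideal[OF R])
  let ?P = "presented_algebra X R"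
  have Fs [simp]: "p \<otimes>\<^bsub>F\<^esub> q = p * q" "p \<oplus>\<^bsub>F\<^esub> q = p + q" "\<one>\<^bsub>F\<^esub> = 1" for p q
    by (simp_all add: F_def)
  have closed: "p + q \<in> carrier F" "p * q \<in> carrier F" if "p \<in> carrier F" "q \<in> carrier F" for p q
    using that F.add.m_closed[of p q] F.m_closed[of p q] by simp_all
  have const: "Poly_Mapping.single 0 c \<in> carrier F" for c
    unfolding F_def by (rule free_algebra_const)
  have coset_eq: "J +>\<^bsub>F\<^esub> p = J +>\<^bsub>F\<^esub> q \<longleftrightarrow> h p = h q" if "p \<in> carrier F" "q \<in> carrier F" for p q
    using F.quotient_eq_iff_same_a_r_cos[OF J.ideal_axioms that] ker[OF that]
      free_algebra_minus[of p X q] that unfolding F_def[symmetric] J_def[symmetric] by simp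
  have car: "carrier ?P = {J +>\<^bsub>F\<^esub> p | p. p \<in> carrier F}"
    by (auto simp: presented_algebra_def Let_def FactRing_def A_RCOSETS_def' F_def[symmetric] J_def[symmetric])
  have P_mult: "(J +>\<^bsub>F\<^esub> p) \<otimes>\<^bsub>?P\<^esub> (J +>\<^bsub>F\<^esub> q) = J +>\<^bsub>F\<^esub> (p * q)"
    if "p \<in> carrier F" "q \<in> carrier F" for p q
    using J.rcoset_mult_add[OF that]
    by (simp add: presented_algebra_def Let_def FactRing_def F_def[symmetric] J_def[symmetric])
  have P_add: "(J +>\<^bsub>F\<^esub> p) \<oplus>\<^bsub>?P\<^esub> (J +>\<^bsub>F\<^esub> q) = J +>\<^bsub>F\<^esub> (p + q)"
    if "p \<in> carrier F" "q \<in> carrier F" for p q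
    using J.a_rcos_sum[OF that]
    by (simp add: presented_algebra_def Let_def FactRing_def F_def[symmetric] J_def[symmetric])
  have P_one: "\<one>\<^bsub>?P\<^esub> = J +>\<^bsub>F\<^esub> 1"
    by (simp add: presented_algebra_def Let_def FactRing_def F_def[symmetric] J_def[symmetric])
  have P_smult: "c \<odot>\<^bsub>?P\<^esub> (J +>\<^bsub>F\<^esub> p) = J +>\<^bsub>F\<^esub> (Poly_Mapping.single 0 c * p)" if "p \<in> carrier F" for c p
    using J.rcoset_mult_add[OF const that]
    by (simp add: presented_algebra_def Let_def FactRing_def F_def[symmetric] J_def[symmetric])
  \<comment> \<open>Any representative will do, since \<open>h\<close> is constant on cosets by
    \<open>coset_eq\<close>.\<close>
  define \<phi> where "\<phi> A = h (SOME p. p \<in> carrier F \<and> A = J +>\<^bsub>F\<^esub> p)" for A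
  have \<phi>: "\<phi> (J +>\<^bsub>F\<^esub> p) = h p" if p: "p \<in> carrier F" for p
  proof -
    let ?q = "SOME q. q \<in> carrier F \<and> J +>\<^bsub>F\<^esub> p = J +>\<^bsub>F\<^esub> q"
    have "\<exists>q. q \<in> carrier F \<and> J +>\<^bsub>F\<^esub> p = J +>\<^bsub>F\<^esub> q" using p by blast
    then have q: "?q \<in> carrier F \<and> J +>\<^bsub>F\<^esub> p = J +>\<^bsub>F\<^esub> ?q"
      by (rule someI_ex)
    then have "h p = h ?q" by (intro coset_eq[OF p, THEN iffD1]) blast+
    then show ?thesis unfolding \<phi>_def by (rule sym)
  qed
  have "\<phi> \<in> ring_hom ?P B"
  proof (rule ring_hom_memI)
    fix A assume "A \<in> carrier ?P"
    then show "\<phi> A \<in> carrier B" using surj by (auto simp: car \<phi>)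
  next
    fix A A' assume "A \<in> carrier ?P" "A' \<in> carrier ?P"
    then obtain p q where "A = J +>\<^bsub>F\<^esub> p" "A' = J +>\<^bsub>F\<^esub> q" "p \<in> carrier F" "q \<in> carrier F"
      unfolding car by blast
    then show "\<phi> (A \<otimes>\<^bsub>?P\<^esub> A') = \<phi> A \<otimes>\<^bsub>B\<^esub> \<phi> A'" "\<phi> (A \<oplus>\<^bsub>?P\<^esub> A') = \<phi> A \<oplus>\<^bsub>B\<^esub> \<phi> A'"
      by (simp_all only: P_mult P_add \<phi> closed mult add)
  next
    show "\<phi> \<one>\<^bsub>?P\<^esub> = \<one>\<^bsub>B\<^esub>" using F.one_closed by (simp add: P_one \<phi> one)
  qed
  moreover have "bij_betw \<phi> (carrier ?P) (carrier B)"
  proof (rule bij_betw_imageI)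
    show "inj_on \<phi> (carrier ?P)"
    proof (rule inj_onI)
      fix A A' assume "A \<in> carrier ?P" "A' \<in> carrier ?P" and eq: "\<phi> A = \<phi> A'"
      then obtain p q where *: "A = J +>\<^bsub>F\<^esub> p" "A' = J +>\<^bsub>F\<^esub> q" "p \<in> carrier F" "q \<in> carrier F"
        unfolding car by blast
      from eq have "h p = h q" unfolding * \<phi>[OF *(3)] \<phi>[OF *(4)] .
      then show "A = A'" unfolding *(1,2) coset_eq[OF *(3,4)] .
    qed
    show "\<phi> ` carrier ?P = carrier B"
      unfolding surj[symmetric] car by (force simp: \<phi> image_iff)
  qed
  moreover have "\<phi> (c \<odot>\<^bsub>?P\<^esub> A) = c \<odot>\<^bsub>B\<^esub> \<phi> A" if A: "A \<in> carrier ?P" for c A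
  proof -
    obtain p where "A = J +>\<^bsub>F\<^esub> p" "p \<in> carrier F" using A unfolding car by blast
    then show ?thesis by (simp only: P_smult \<phi> closed const smult)
  qed
  ultimately have "\<phi> \<in> alg_iso ?P B"
    by (simp add: alg_iso_def ring_iso_def)
  with \<phi> show ?thesis unfolding J_def by blast
qed

lemma Idl_closed:
  fixes X :: "'x set" and R
  defines "F \<equiv> free_algebra X"
  defines "J \<equiv> Idl\<^bsub>F\<^esub> R"
  assumes R: "R \<subseteq> carrier F"
  shows "R \<subseteq> J" "J \<subseteq> carrier F" "0 \<in> J"
    and "p \<in> J \<Longrightarrow> q \<in> J \<Longrightarrow> p + q \<in> J" "p \<in> J \<Longrightarrow> q \<in> J \<Longrightarrow> p - q \<in> J"
    and "a \<in> carrier F \<Longrightarrow> p \<in> J \<Longrightarrow> a * p \<in> J" "a \<in> carrier F \<Longrightarrow> p \<in> J \<Longrightarrow> p * a \<in> J"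
proof -
  interpret F: ring F unfolding F_def by (rule ring_free_algebra)
  interpret J: ideal J F unfolding J_def by (rule F.genideal_ideal[OF R])
  have Fs: "mult F = (*)" "add F = (+)" "zero F = 0" by (simp_all add: F_def)
  show "R \<subseteq> J" unfolding J_def by (rule F.genideal_self[OF R])
  show sub: "J \<subseteq> carrier F" by (rule J.a_subset)
  show "0 \<in> J" using J.zero_closed by (simp add: Fs)
  show add: "p \<in> J \<Longrightarrow> q \<in> J \<Longrightarrow> p + q \<in> J" for p q
    using J.a_closed[of p q] by (simp add: Fs)
  show l: "a \<in> carrier F \<Longrightarrow> p \<in> J \<Longrightarrow> a * p \<in> J" for a p
    using J.I_l_closed[of p a] by (simp add: Fs)
  show "a \<in> carrier F \<Longrightarrow> p \<in> J \<Longrightarrow> p * a \<in> J" for a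
    using J.I_r_closed[of p a] by (simp add: Fs)
  show "p \<in> J \<Longrightarrow> q \<in> J \<Longrightarrow> p - q \<in> J"
  proof -
    assume "p \<in> J" "q \<in> J"
    moreover have "- (1 :: 'x ncpoly) \<in> carrier F"
      using free_algebra_uminus[OF free_algebra_const[of 1]] unfolding F_def by simp
    ultimately have "p + (- 1) * q \<in> J" by (intro add l)
    then show ?thesis by simp
  qed
qed

text \<open>The kernel is an ideal that contains \<open>R\<close>, and the generated ideal is the
  least such. Multiplicativity enters as absorption by the kernel because the Hall product is a
  record operation, distinct from the multiplication of its type.\<close>

lemma Idl_subset_kernel:
  fixes X :: "'x set" and h :: "'x ncpoly \<Rightarrow> 'b::ab_group_add"
  defines "F \<equiv> free_algebra X"
  assumes RF: "R \<subseteq> carrier F" and R: "\<And>p. p \<in> R \<Longrightarrow> h p = 0"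
    and add: "\<And>p q. h (p + q) = h p + h q"
    and mult: "\<And>p q. p \<in> carrier F \<Longrightarrow> q \<in> carrier F \<Longrightarrow> h p = 0 \<or> h q = 0 \<Longrightarrow> h (p * q) = 0"
    and p: "p \<in> Idl\<^bsub>F\<^esub> R"
  shows "h p = 0"
proof -
  interpret F: ring F unfolding F_def by (rule ring_free_algebra)
  let ?K = "{p \<in> carrier F. h p = 0}"
  have Fs: "mult F = (*)" "add F = (+)" "zero F = 0" by (simp_all add: F_def)
  have h0: "h 0 = 0" using add[of 0 0] by simp
  have hm: "h (- p) = - h p" for p using add[of p "- p"] h0 by (simp add: eq_neg_iff_add_eq_0 add.commute)
  have "ideal ?K F"
  proof (rule idealI)
    show "ring F" by (rule F.ring_axioms)
    show "subgroup ?K (add_monoid F)"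
    proof (rule F.add.subgroupI)
      show "?K \<noteq> {}" using F.zero_closed h0 by (auto simp: Fs)
      fix a assume a: "a \<in> ?K"
      have "a_inv F a = - a"
        using a by (intro F.minus_equality) (simp_all add: Fs F_def free_algebra_uminus)
      then show "a_inv F a \<in> ?K"
        using a by (simp add: hm F_def free_algebra_uminus)
      fix b assume "b \<in> ?K"
      then show "a \<oplus>\<^bsub>F\<^esub> b \<in> ?K" using a F.add.m_closed[of a b] by (simp add: Fs add)
    qed auto
    fix a x assume "a \<in> ?K" "x \<in> carrier F"
    then show "x \<otimes>\<^bsub>F\<^esub> a \<in> ?K" "a \<otimes>\<^bsub>F\<^esub> x \<in> ?K"
      using F.m_closed[of x a] F.m_closed[of a x] by (simp_all add: Fs mult)
  qed
  then have "Idl\<^bsub>F\<^esub> R \<subseteq> ?K"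
    using RF R by (intro F.genideal_minimal) auto
  with p show ?thesis by blast
qed

section \<open>Normal words\<close>

text \<open>The second index must decrease because it enters the exponent with a minus sign.\<close>

definition normal_list :: "('v::linorder \<times> int) list \<Rightarrow> bool" where
  "normal_list l \<longleftrightarrow> sorted_wrt (\<lambda>a b. fst a < fst b \<or> fst a = fst b \<and> snd b \<le> snd a) l"

lemma normal_sorted: "normal_list w \<Longrightarrow> sorted (map fst w)"
  unfolding normal_list_def sorted_map by (rule sorted_wrt_mono_rel[rotated], assumption) auto

text \<open>The order is transitive, so a violation already occurs between neighbouring letters,
  where a relation of length two applies.\<close>

lemma not_normal_split:
  assumes "\<not> normal_list l"
  shows "\<exists>u j s i r v. l = u @ [(j, s), (i, r)] @ v \<and> (i < j \<or> i = j \<and> s < r)"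
proof -
  let ?R = "\<lambda>a b :: 'a \<times> int. fst a < fst b \<or> fst a = fst b \<and> snd b \<le> snd a"
  have "transp ?R" by (rule transpI) auto
  then have "\<not> successively ?R l" using assms by (simp add: normal_list_def successively_conv_sorted_wrt)
  then have "\<exists>u a b v. l = u @ [a, b] @ v \<and> \<not> ?R a b"
  proof (induction l)
    case (Cons a l)
    show ?case
    proof (cases "successively ?R l")
      case True
      with Cons.prems obtain b v where "l = b # v" "\<not> ?R a b"
        by (cases l) auto
      then show ?thesis by (intro exI[of _ "[]"]) auto
    next
      case False
      from Cons.IH[OF this] obtain u a' b v where "l = u @ [a', b] @ v" "\<not> ?R a' b" by blast
      then have "a # l = (a # u) @ [a', b] @ v \<and> \<not> ?R a' b" by simp
      then show ?thesis by blast
    qed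
  qed simp
  then obtain u a b v where "l = u @ [a, b] @ v" "\<not> ?R a b" by blast
  then show ?thesis
    by (intro exI[of _ u] exI[of _ "fst a"] exI[of _ "snd a"] exI[of _ "fst b"] exI[of _ "snd b"] exI[of _ v])
      auto
qed

lemma nth_lab:
  assumes "p < length w"
  shows "lab w ! p = (pos (map fst w) ! p, - snd (w ! p))"
    and "(pos (map fst w) ! p, - snd (w ! p)) \<in> set (lab w)"
proof -
  show *: "lab w ! p = (pos (map fst w) ! p, - snd (w ! p))"
    using assms by (simp add: lab_def)
  have "p < length (lab w)" using assms by (simp add: lab_def)
  then show "(pos (map fst w) ! p, - snd (w ! p)) \<in> set (lab w)"
    unfolding *[symmetric] by (rule nth_mem)
qed

text \<open>Along a vertex -r increases weakly and the occurrence number strictly; the exponent is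
  their sum minus 1.\<close>

lemma normal_strict_expo:
  assumes "normal_list w"
  shows "strict_expo (dim_vars (wt (map fst w))) (expo (lab w))"
  unfolding strict_expo_def
proof (intro ballI, clarify)
  let ?ps = "pos (map fst w)"
  fix i j i' k assume "((i, j), (i', k)) \<in> vpairs (dim_vars (wt (map fst w)))"
  then have *: "i' = i" "j < k" "(i, j) \<in> set ?ps" "(i, k) \<in> set ?ps"
    by (auto simp: vpairs_def set_pos)
  then obtain p q where p: "p < length w" "?ps ! p = (i, j)" and q: "q < length w" "?ps ! q = (i, k)"
    by (auto simp: in_set_conv_nth)
  have "p \<noteq> q" using p q * by auto
  \<comment> \<open>At one vertex the smaller occurrence number stands further to the left.\<close>
  moreover have "\<not> q < p"
    using sorted_wrt_nth_less[OF sorted_pos, of q p "map fst w"] p q * by auto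
  ultimately have "p < q" by simp
  have fst: "fst (w ! x) = fst (?ps ! x)" if "x < length w" for x
  proof -
    have "map fst ?ps ! x = map fst w ! x" by (simp only: map_fst_pos)
    then show ?thesis using that by (simp del: map_fst_pos)
  qed
  have "snd (w ! q) \<le> snd (w ! p)"
    using sorted_wrt_nth_less[OF assms[unfolded normal_list_def] \<open>p < q\<close> q(1)] fst[OF p(1)] fst[OF q(1)] p q
    by simp
  then show "Poly_Mapping.lookup (expo (lab w)) (i, j) < Poly_Mapping.lookup (expo (lab w)) (i', k)"
    using lookup_expo_lab[OF nth_lab(2)[OF p(1)]] lookup_expo_lab[OF nth_lab(2)[OF q(1)]]
      p q * by simp
qed

text \<open>The weight determines the multiset of vertices, hence the sorted sequence of vertices
  and the variable at each position; the exponent of that variable then returns the second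
  index.\<close>

lemma normal_word_unique:
  assumes "normal_list w" "normal_list w'" and wt: "wt (map fst w) = wt (map fst w')"
    and expo: "expo (lab w) = expo (lab w')"
  shows "w = w'"
proof -
  have "mset (map fst w) = mset (map fst w')"
    by (rule multiset_eqI) (simp only: count_mset lookup_wt[symmetric] wt)
  then have fst: "map fst w = map fst w'"
    using normal_sorted[OF assms(1)] normal_sorted[OF assms(2)] by (metis properties_for_sort sorted_sort_id)
  then have len: "length w = length w'" by (metis length_map)
  show ?thesis
  proof (rule nth_equalityI[OF len])
    fix p assume p: "p < length w"
    have p': "p < length w'" using p len by simp
    have "- snd (w ! p) = - snd (w' ! p)"
      using lookup_expo_lab[OF nth_lab(2)[OF p]] lookup_expo_lab[OF nth_lab(2)[OF p']] expo fst
      by simp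
    moreover have "fst (w ! p) = fst (w' ! p)"
      using arg_cong[OF fst, of "\<lambda>xs. xs ! p"] p len by simp
    ultimately show "w ! p = w' ! p" by (simp add: prod_eq_iff)
  qed
qed

lemma lookup_scale: "Poly_Mapping.lookup (Poly_Mapping.single 0 c * f) k = c * Poly_Mapping.lookup f k"
  by (simp add: Poly_Mapping.map.rep_eq when_def flip: mult_map_scale_conv_mult)

text \<open>In the degree of a word \<open>w0\<close> of \<open>q\<close>, multiply by the
  Vandermonde product and read off the coefficient at the exponents of \<open>w0\<close>: only
  \<open>w0\<close> itself contributes, so its coefficient in \<open>q\<close> is 0.\<close>

lemma hall_map_normal_inj:
  assumes normal: "\<And>w. w \<in> Poly_Mapping.keys q \<Longrightarrow> normal_list (letters w)"
    and 0: "hall_map (quiver_A m) q = 0"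
  shows "q = 0"
proof (rule ccontr)
  let ?Q = "quiver_A m"
  assume "q \<noteq> 0"
  then obtain w0 where w0: "w0 \<in> Poly_Mapping.keys q"
    by (metis lookup_zero in_keys_iff poly_mapping_eqI)
  let ?\<gamma> = "wgt w0"
  let ?W = "{w\<in>Poly_Mapping.keys q. wgt w = ?\<gamma>}"
  let ?V = "vandermonde (dim_vars ?\<gamma>)"
  let ?\<mu> = "\<lambda>w. expo (lab (letters w))"
  have "0 = ?V * Poly_Mapping.lookup (hall_map ?Q q) ?\<gamma>" by (simp add: 0)
  also have "\<dots> = (\<Sum>w\<in>?W. cst (Poly_Mapping.lookup q w) * (?V * shuffle_elt ?Q (letters w)))"
    by (simp only: lookup_hall_map sum_distrib_left mult.left_commute[of _ ?V])
  also have "\<dots> = (\<Sum>w\<in>?W. cst (Poly_Mapping.lookup q w) * antisymmetrize ?\<gamma> (Poly_Mapping.single (?\<mu> w) 1))"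
  proof (intro sum.cong refl)
    fix w assume w: "w \<in> ?W"
    then have "sorted (map fst (letters w))" using normal normal_sorted by blast
    then have "?V * shuffle_elt ?Q (letters w) = antisymmetrize ?\<gamma> (Poly_Mapping.single (?\<mu> w) 1)"
      using vandermonde_shuffle_elt[of "letters w" ?Q] word_num_sorted[OF sorted_lab, of "letters w" m] w
      by simp
    then show "cst (Poly_Mapping.lookup q w) * (?V * shuffle_elt ?Q (letters w))
        = cst (Poly_Mapping.lookup q w) * antisymmetrize ?\<gamma> (Poly_Mapping.single (?\<mu> w) 1)" by simp
  qed
  finally have "0 = Poly_Mapping.lookup \<dots> (?\<mu> w0)" by simp
  also have "\<dots> = (\<Sum>w\<in>?W. Poly_Mapping.lookup q w *
      Poly_Mapping.lookup (antisymmetrize ?\<gamma> (Poly_Mapping.single (?\<mu> w) 1)) (?\<mu> w0))"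
    by (simp only: lookup_sum lookup_scale)
  also have "\<dots> = (\<Sum>w\<in>?W. if w = w0 then Poly_Mapping.lookup q w else 0)"
  proof (intro sum.cong refl)
    fix w assume w: "w \<in> ?W"
    have "strict_expo (dim_vars ?\<gamma>) (?\<mu> w)" "strict_expo (dim_vars ?\<gamma>) (?\<mu> w0)"
      using normal_strict_expo[OF normal, of w] normal_strict_expo[OF normal, of w0] w w0 by auto
    note look = lookup_antisymmetrize_strict[OF this]
    have "letters w = letters w0" if "?\<mu> w = ?\<mu> w0"
      using normal_word_unique[OF normal normal _ that] w w0 by auto
    then have "?\<mu> w = ?\<mu> w0 \<longleftrightarrow> w = w0" by (auto intro: word.expand)
    then show "Poly_Mapping.lookup q w * Poly_Mapping.lookup (antisymmetrize ?\<gamma> (Poly_Mapping.single (?\<mu> w) 1)) (?\<mu> w0)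
        = (if w = w0 then Poly_Mapping.lookup q w else 0)"
      by (simp add: look)
  qed
  also have "\<dots> = Poly_Mapping.lookup q w0"
    using w0 by (simp add: sum.delta)
  finally show False using w0 by (simp add: in_keys_iff)
qed

section \<open>Straightening\<close>

abbreviation ncmon :: "'x list \<Rightarrow> 'x ncpoly" where
  "ncmon l \<equiv> Poly_Mapping.single (Word l) 1"

lemma mon_mult: "ncmon u * ncmon v = ncmon (u @ v)"
  by (simp add: mult_single plus_word_def)

lemma nc_var_mult: "nc_var x * nc_var y = ncmon [x, y]"
  by (simp add: nc_var_def mon_mult)

text \<open>
  Moving a smaller vertex to the left decreases the first measure; the relation at a single vertex
  preserves the first and decreases the second.
\<close>

fun vertex_measure :: "(nat \<times> int) list \<Rightarrow> nat" where
  "vertex_measure [] = 0"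
| "vertex_measure (a # l) = fst a * Suc (length l) + vertex_measure l"

lemma vertex_measure_append:
  "vertex_measure (u @ v) = vertex_measure u + sum_list (map fst u) * length v + vertex_measure v"
  by (induction u) (simp_all add: algebra_simps)

definition square_measure :: "(nat \<times> int) list \<Rightarrow> nat" where
  "square_measure l = (\<Sum>a\<leftarrow>l. nat (snd a * snd a))"

definition U_ideal :: "nat \<Rightarrow> (nat \<times> int) ncpoly set" where
  "U_ideal n = Idl\<^bsub>free_algebra (U_gens n)\<^esub> (U_rels n)"

lemma U_rels_cases:
  assumes "p \<in> U_rels n"
  obtains (same) i r s where "1 \<le> i" "i \<le> n - 1"
      "p = ncmon [(i, r), (i, s)] + ncmon [(i, s - 1), (i, r + 1)]"
  | (arrow) i r s where "1 \<le> i" "i \<le> n - 2"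
      "p = ncmon [(i + 1, s), (i, r)] - (ncmon [(i, r), (i + 1, s)] - ncmon [(i, r + 1), (i + 1, s - 1)])"
  | (far) i j r s where "1 \<le> i" "i \<le> n - 1" "1 \<le> j" "j \<le> n - 1" "\<bar>int i - int j\<bar> \<ge> 2"
      "p = ncmon [(i, r), (j, s)] - ncmon [(j, s), (i, r)]"
  using assms unfolding U_rels_def nc_var_mult by (auto simp only: diff_minus_eq_add Un_iff mem_Collect_eq)

lemma U_rels_same:
  "1 \<le> i \<Longrightarrow> i \<le> n - 1 \<Longrightarrow> ncmon [(i, r), (i, s)] + ncmon [(i, s - 1), (i, r + 1)] \<in> U_rels n"
  unfolding U_rels_def nc_var_mult diff_minus_eq_add by blast

lemma U_rels_arrow:
  "1 \<le> i \<Longrightarrow> i \<le> n - 2 \<Longrightarrow>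
    ncmon [(i + 1, s), (i, r)] - (ncmon [(i, r), (i + 1, s)] - ncmon [(i, r + 1), (i + 1, s - 1)]) \<in> U_rels n"
  unfolding U_rels_def nc_var_mult by blast

lemma U_rels_far:
  "1 \<le> i \<Longrightarrow> i \<le> n - 1 \<Longrightarrow> 1 \<le> j \<Longrightarrow> j \<le> n - 1 \<Longrightarrow> \<bar>int i - int j\<bar> \<ge> 2 \<Longrightarrow>
    ncmon [(i, r), (j, s)] - ncmon [(j, s), (i, r)] \<in> U_rels n"
  unfolding U_rels_def nc_var_mult by blast

lemma U_rels_carrier: "U_rels n \<subseteq> carrier (free_algebra (U_gens n))"
proof
  fix p assume "p \<in> U_rels n"
  then show "p \<in> carrier (free_algebra (U_gens n))"
    by (cases rule: U_rels_cases)
      (auto simp: U_gens_def intro!: free_algebra_add free_algebra_diff free_algebra_single)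
qed

lemmas U_ideal_closed = Idl_closed[OF U_rels_carrier, folded U_ideal_def]

lemma U_ideal_context:
  assumes "p \<in> U_rels n" "set u \<subseteq> U_gens n" "set v \<subseteq> U_gens n"
  shows "ncmon u * p * ncmon v \<in> U_ideal n"
  using assms U_ideal_closed(1)
  by (intro U_ideal_closed(6,7) free_algebra_single) auto

lemma wf_straighten:
  "wf (inv_image (less_than <*lex*> less_than) (\<lambda>l. (vertex_measure l, square_measure l)))"
  by (intro wf_inv_image wf_lex_prod wf_less_than)

text \<open>The relations rewrite a violating pair of neighbours, at a common vertex, at adjacent
  vertices, or at distant vertices; the induction runs over the lexicographic order of the two
  measures.\<close>

lemma straighten_word:
  assumes "set l \<subseteq> U_gens n"
  shows "\<exists>q. (\<forall>w\<in>Poly_Mapping.keys q. set (letters w) \<subseteq> U_gens n \<and> normal_list (letters w)) \<and>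
    ncmon l - q \<in> U_ideal n"
  using assms
proof (induction l rule: wf_induct_rule[OF wf_straighten])
  case (1 l)
  let ?N = "\<lambda>q. \<forall>w\<in>Poly_Mapping.keys q. set (letters w) \<subseteq> U_gens n \<and> normal_list (letters w)"
  have IH: "\<exists>q. ?N q \<and> ncmon l' - q \<in> U_ideal n"
    if "vertex_measure l' < vertex_measure l \<or>
        vertex_measure l' = vertex_measure l \<and> square_measure l' < square_measure l"
      "set l' \<subseteq> U_gens n" for l'
    using 1(1)[of l'] that by auto
  have N_diff: "?N (q - q')" if "?N q" "?N q'" for q q'
    using that keys_diff[of q q'] by blast
  show ?case
  proof (cases "normal_list l")
    case True
    then show ?thesis
      using 1(2) U_ideal_closed(3) by (intro exI[of _ "ncmon l"]) auto
  next
    case False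
    then obtain u j s i r v where l: "l = u @ [(j, s), (i, r)] @ v" and ij: "i < j \<or> i = j \<and> s < r"
      using not_normal_split by blast
    have uv: "set u \<subseteq> U_gens n" "set v \<subseteq> U_gens n"
      and gens: "1 \<le> i" "i \<le> n - 1" "1 \<le> j" "j \<le> n - 1"
      using 1(2) by (auto simp: l U_gens_def)
    have in_gens: "set (u @ [(a, x), (b, y)] @ v) \<subseteq> U_gens n" if "a \<in> {i, j}" "b \<in> {i, j}" for a b x y
      using uv gens that by (auto simp: U_gens_def)
    have vm: "vertex_measure (u @ [(i, x), (j, y)] @ v) < vertex_measure l" if "i < j" for x y
      using that by (simp add: l vertex_measure_append algebra_simps)
    \<comment> \<open>The second indices are arbitrary since \<open>vertex_measure\<close> sees only
      the vertices; this also covers the shifted word of the arrow relation.\<close>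
    have swap: "\<exists>q. ?N q \<and> ncmon (u @ [(i, x), (j, y)] @ v) - q \<in> U_ideal n" if "i < j" for x y
      using vm[OF that, of x y] in_gens[of i j x y] by (intro IH) simp_all
    consider "i = j" "r = s + 1" | "i = j" "s + 1 < r" | "j = i + 1" | "j \<ge> i + 2"
      using ij by fastforce
    then show ?thesis
    proof cases
      case 1
      \<comment> \<open>For r = s + 1 the relation maps the pair to its own negative, so twice the
        word lies in the ideal and the word straightens to 0.\<close>
      then have "ncmon [(i, s), (i, r)] + ncmon [(i, s), (i, r)] \<in> U_rels n"
        using U_rels_same[OF gens(1,2), of s r] by simp
      from U_ideal_context[OF this uv] have "ncmon l + ncmon l \<in> U_ideal n"
        by (simp add: distrib_left distrib_right mon_mult l 1)
      then have "Poly_Mapping.single 0 (1/2) * (ncmon l + ncmon l) \<in> U_ideal n"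
        by (rule U_ideal_closed(6)[OF free_algebra_const])
      moreover have "Poly_Mapping.single 0 (1/2) * (ncmon l + ncmon l) = ncmon l"
        by (simp add: distrib_left mult_single flip: single_add)
      ultimately show ?thesis by (intro exI[of _ 0]) simp
    next
      case 2
      let ?l = "u @ [(i, r - 1), (i, s + 1)] @ v"
      have "ncmon [(i, s), (i, r)] + ncmon [(i, r - 1), (i, s + 1)] \<in> U_rels n"
        by (rule U_rels_same[OF gens(1,2)])
      from U_ideal_context[OF this uv] have rel: "ncmon l + ncmon ?l \<in> U_ideal n"
        by (simp add: distrib_left distrib_right mon_mult l 2)
      have "vertex_measure ?l = vertex_measure l"
        by (simp add: l vertex_measure_append 2)
      moreover have "square_measure ?l < square_measure l"
      proof -
        \<comment> \<open>The sum of squares drops by 2 (r - s - 1), which is positive because r > s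
          + 1.\<close>
        have "(r - 1) * (r - 1) + (s + 1) * (s + 1) < s * s + r * r"
          using 2 by (simp add: algebra_simps)
        then have "nat ((r - 1) * (r - 1)) + nat ((s + 1) * (s + 1)) < nat (s * s) + nat (r * r)"
          by (simp only: nat_add_distrib[symmetric] zero_le_square nat_less_eq_zless add_nonneg_nonneg)
        then show ?thesis by (simp add: square_measure_def l)
      qed
      ultimately obtain q where q: "?N q" "ncmon ?l - q \<in> U_ideal n"
        using IH[of ?l] in_gens 2 by auto
      have "?N (0 - q)" by (rule N_diff) (simp_all add: q(1))
      moreover have "ncmon l - (0 - q) \<in> U_ideal n"
        using U_ideal_closed(5)[OF rel q(2)] by (simp add: algebra_simps)
      ultimately show ?thesis by blast
    next
      case 3
      let ?l1 = "u @ [(i, r), (i + 1, s)] @ v" and ?l2 = "u @ [(i, r + 1), (i + 1, s - 1)] @ v"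
      have "ncmon [(i + 1, s), (i, r)] - (ncmon [(i, r), (i + 1, s)] - ncmon [(i, r + 1), (i + 1, s - 1)]) \<in> U_rels n"
        using gens 3 by (intro U_rels_arrow) auto
      from U_ideal_context[OF this uv] have rel: "ncmon l - (ncmon ?l1 - ncmon ?l2) \<in> U_ideal n"
        by (simp add: left_diff_distrib right_diff_distrib mon_mult l 3)
      obtain q1 q2 where q: "?N q1" "ncmon ?l1 - q1 \<in> U_ideal n" "?N q2" "ncmon ?l2 - q2 \<in> U_ideal n"
        using swap[of r s] swap[of "r + 1" "s - 1"] unfolding 3 by force
      have "ncmon l - (q1 - q2) = (ncmon l - (ncmon ?l1 - ncmon ?l2)) + ((ncmon ?l1 - q1) - (ncmon ?l2 - q2))"
        by (simp add: algebra_simps)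
      also have "\<dots> \<in> U_ideal n"
        by (intro U_ideal_closed(4,5) rel q)
      finally show ?thesis using N_diff[OF q(1,3)] by blast
    next
      case 4
      let ?l = "u @ [(i, r), (j, s)] @ v"
      have "ncmon [(j, s), (i, r)] - ncmon [(i, r), (j, s)] \<in> U_rels n"
        using gens 4 by (intro U_rels_far) auto
      from U_ideal_context[OF this uv] have rel: "ncmon l - ncmon ?l \<in> U_ideal n"
        by (simp add: left_diff_distrib right_diff_distrib mon_mult l)
      obtain q where q: "?N q" "ncmon ?l - q \<in> U_ideal n"
        using swap[of r s] 4 by force
      have "ncmon l - q \<in> U_ideal n"
        using U_ideal_closed(4)[OF rel q(2)] by simp
      then show ?thesis using q(1) by blast
    qed
  qed
qed

lemma straighten:
  assumes "p \<in> carrier (free_algebra (U_gens n))"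
  shows "\<exists>q. (\<forall>w\<in>Poly_Mapping.keys q. set (letters w) \<subseteq> U_gens n \<and> normal_list (letters w)) \<and>
    p - q \<in> U_ideal n"
proof -
  let ?N = "\<lambda>q. \<forall>w\<in>Poly_Mapping.keys q. set (letters w) \<subseteq> U_gens n \<and> normal_list (letters w)"
  have "\<forall>w\<in>Poly_Mapping.keys p. \<exists>q. ?N q \<and> ncmon (letters w) - q \<in> U_ideal n"
    using assms unfolding free_algebra_carrier by (intro ballI straighten_word) blast
  then obtain f where f: "?N (f w)" "ncmon (letters w) - f w \<in> U_ideal n" if "w \<in> Poly_Mapping.keys p" for w
    by metis
  let ?c = "\<lambda>w. Poly_Mapping.single 0 (Poly_Mapping.lookup p w) :: (nat \<times> int) ncpoly"
  let ?q = "\<Sum>w\<in>Poly_Mapping.keys p. ?c w * f w"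
  have "?N ?q"
  proof
    fix w assume "w \<in> Poly_Mapping.keys ?q"
    then obtain w' where w': "w' \<in> Poly_Mapping.keys p" "w \<in> Poly_Mapping.keys (?c w' * f w')"
      using keys_sum[of "\<lambda>w. ?c w * f w" "Poly_Mapping.keys p"] by blast
    then have "w \<in> Poly_Mapping.keys (f w')"
      using keys_mult[of "?c w'" "f w'"] by (auto split: if_splits)
    with f(1)[OF w'(1)] show "set (letters w) \<subseteq> U_gens n \<and> normal_list (letters w)" by blast
  qed
  moreover have "p - ?q \<in> U_ideal n"
  proof -
    have "p = (\<Sum>w\<in>Poly_Mapping.keys p. ?c w * ncmon (letters w))"
      by (subst poly_mapping_sum_single) (simp add: mult_single)
    then have "p - ?q = (\<Sum>w\<in>Poly_Mapping.keys p. ?c w * (ncmon (letters w) - f w))"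
      by (simp add: right_diff_distrib sum_subtractf)
    moreover have "(\<Sum>w\<in>A. ?c w * (ncmon (letters w) - f w)) \<in> U_ideal n" if "A \<subseteq> Poly_Mapping.keys p" for A
      using that
    proof (induction A rule: infinite_finite_induct)
      case (insert w A)
      then show ?case
        unfolding sum.insert[OF insert(1,2)]
        by (intro U_ideal_closed(4) U_ideal_closed(6)[OF free_algebra_const f(2)]) auto
    qed (simp_all add: U_ideal_closed(3))
    ultimately show ?thesis by simp
  qed
  ultimately show ?thesis by blast
qed

section \<open>The isomorphism\<close>

lemma hall_map_mon: "hall_map Q (ncmon l) = Poly_Mapping.single (wt (map fst l)) (shuffle_elt Q l)"
  by (simp add: hall_map_single)

lemma hall_map_U_rels:
  assumes "p \<in> U_rels n"
  shows "hall_map (quiver_A (n - 1)) p = 0"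
  using assms
proof (cases rule: U_rels_cases)
  case (same i r s)
  have "shuffle_elt (quiver_A (n - 1)) [(i, r), (i, s)]
      = - shuffle_elt (quiver_A (n - 1)) [(i, s - 1), (i, r + 1)]"
    by (rule shuffle_elt_same_vertex) (simp add: num_arrows_quiver_A)
  then show ?thesis by (simp add: same hall_map_add hall_map_mon single_uminus)
next
  case (arrow i r s)
  have *: "shuffle_elt (quiver_A (n - 1)) [(i + 1, s), (i, r)]
      = shuffle_elt (quiver_A (n - 1)) [(i, r), (i + 1, s)]
        - shuffle_elt (quiver_A (n - 1)) [(i, r + 1), (i + 1, s - 1)]"
    \<comment> \<open>The arrow from i + 1 to i exists for 1 \<le> i < n - 1, which is the range of
      relation (ii).\<close>
    using arrow by (intro shuffle_elt_arrow) (auto simp: num_arrows_quiver_A)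
  show ?thesis
    unfolding arrow hall_map_diff hall_map_mon * by (simp add: single_diff add.commute)
next
  case (far i j r s)
  have *: "shuffle_elt (quiver_A (n - 1)) [(i, r), (j, s)] = shuffle_elt (quiver_A (n - 1)) [(j, s), (i, r)]"
    using far by (intro shuffle_elt_no_arrow) (auto simp: num_arrows_quiver_A)
  show ?thesis
    unfolding far hall_map_diff hall_map_mon * by (simp add: add.commute)
qed

lemma quiver_A_verts: "verts (quiver_A m) = {1..m}"
  by (simp add: quiver_A_def)

lemma U_gens_verts: "set l \<subseteq> U_gens n \<longleftrightarrow> fst ` set l \<subseteq> verts (quiver_A (n - 1))"
  by (auto simp: U_gens_def quiver_A_verts)

lemma hall_map_mult_free:
  assumes "p \<in> carrier (free_algebra (U_gens n))" "q \<in> carrier (free_algebra (U_gens n))"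
  shows "hall_map (quiver_A (n - 1)) (p * q)
    = mult (KHA (quiver_A (n - 1))) (hall_map (quiver_A (n - 1)) p) (hall_map (quiver_A (n - 1)) q)"
  using assms unfolding free_algebra_carrier U_gens_verts
  by (intro hall_map_mult[symmetric]) (auto simp: quiver_A_verts)

text \<open>Straightening replaces p by a combination q of normal words with the same image; if that
  image is 0, then q = 0 by \<open>hall_map_normal_inj\<close>, so p itself lies in the
  ideal.\<close>

lemma hall_map_ker:
  assumes "p \<in> carrier (free_algebra (U_gens n))"
  shows "hall_map (quiver_A (n - 1)) p = 0 \<longleftrightarrow> p \<in> U_ideal n"
proof
  let ?h = "hall_map (quiver_A (n - 1))"
  have mult_0: "?h (p * q) = 0" if "p \<in> carrier (free_algebra (U_gens n))" "q \<in> carrier (free_algebra (U_gens n))"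
      "?h p = 0 \<or> ?h q = 0" for p q
    using that unfolding hall_map_mult_free[OF that(1,2)] by (auto simp: KHA_def)
  have vanish: "?h p = 0" if "p \<in> U_ideal n" for p
    using that unfolding U_ideal_def
    by (rule Idl_subset_kernel[OF U_rels_carrier, rotated -1]) (auto simp: hall_map_U_rels hall_map_add simp del: One_nat_def intro: mult_0)
  then show "p \<in> U_ideal n \<Longrightarrow> ?h p = 0" .
  assume 0: "?h p = 0"
  obtain q where q: "\<And>w. w \<in> Poly_Mapping.keys q \<Longrightarrow> normal_list (letters w)" "p - q \<in> U_ideal n"
    using straighten[OF assms] by blast
  have "?h q = 0" using vanish[OF q(2)] 0 by (simp add: hall_map_diff)
  then have "q = 0" using hall_map_normal_inj[OF q(1)] by blast
  with q(2) show "p \<in> U_ideal n" by simp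
qed

lemma hall_map_surj:
  "hall_map (quiver_A (n - 1)) ` carrier (free_algebra (U_gens n)) = carrier (KHA (quiver_A (n - 1)))"
proof (intro subset_antisym subsetI)
  let ?Q = "quiver_A (n - 1)"
  let ?h = "hall_map ?Q"
  fix F assume "F \<in> ?h ` carrier (free_algebra (U_gens n))"
  then obtain p where p: "p \<in> carrier (free_algebra (U_gens n))" "F = ?h p" by blast
  show "F \<in> carrier (KHA ?Q)"
    unfolding KHA_def partial_object.simps mem_Collect_eq
  proof (intro ballI conjI)
    fix \<alpha> assume "\<alpha> \<in> Poly_Mapping.keys F"
    then obtain w where w: "w \<in> Poly_Mapping.keys p" "\<alpha> = wgt w"
      using keys_hall_map[of ?Q p] p by blast
    then have "fst ` set (letters w) \<subseteq> verts ?Q"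
      using p unfolding free_algebra_carrier U_gens_verts by blast
    moreover have "Poly_Mapping.keys \<alpha> \<subseteq> fst ` set (letters w)"
      by (auto simp: w(2) in_keys_iff lookup_wt count_list_0_iff)
    ultimately show "Poly_Mapping.keys \<alpha> \<subseteq> verts ?Q" by blast
    show "Poly_Mapping.lookup F \<alpha> \<in> K_Rep \<alpha>"
      unfolding p(2) lookup_hall_map
      by (rule K_Rep_lincomb) (use shuffle_elt_K_Rep in blast)
  qed
next
  let ?Q = "quiver_A (n - 1)"
  let ?h = "hall_map ?Q"
  fix F assume F: "F \<in> carrier (KHA ?Q)"
  have "\<exists>p\<in>carrier (free_algebra (U_gens n)). ?h p = Poly_Mapping.single \<alpha> (Poly_Mapping.lookup F \<alpha>)"
    if \<alpha>: "\<alpha> \<in> Poly_Mapping.keys F" for \<alpha>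
  proof -
    have K: "Poly_Mapping.lookup F \<alpha> \<in> K_Rep \<alpha>" and verts: "Poly_Mapping.keys \<alpha> \<subseteq> verts ?Q"
      using F \<alpha> by (auto simp: KHA_def)
    obtain A c where "\<forall>w\<in>A. wt (map fst w) = \<alpha>"
      and f: "Poly_Mapping.lookup F \<alpha> = (\<Sum>w\<in>A. cst (c w) * shuffle_elt ?Q w)"
      using K_Rep_lincomb_shuffle_elt[OF K, of "n - 1"] by (elim exE conjE)
    then have A: "wt (map fst w) = \<alpha>" if "w \<in> A" for w using that by blast
    show ?thesis
    proof (intro bexI)
      have "fst ` set w \<subseteq> Poly_Mapping.keys \<alpha>" if "w \<in> A" for w
        unfolding A[OF that, symmetric] by (simp add: subset_iff in_keys_iff lookup_wt count_list_0_iff)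
      then show "(\<Sum>w\<in>A. Poly_Mapping.single (Word w) (c w)) \<in> carrier (free_algebra (U_gens n))"
        using verts by (intro free_algebra_sum free_algebra_single) (auto simp: U_gens_verts)
      show "?h (\<Sum>w\<in>A. Poly_Mapping.single (Word w) (c w)) = Poly_Mapping.single \<alpha> (Poly_Mapping.lookup F \<alpha>)"
        unfolding f hall_map_sum hall_map_single single_sum using A by simp
    qed
  qed
  then obtain P where P: "P \<alpha> \<in> carrier (free_algebra (U_gens n))"
      "?h (P \<alpha>) = Poly_Mapping.single \<alpha> (Poly_Mapping.lookup F \<alpha>)" if "\<alpha> \<in> Poly_Mapping.keys F" for \<alpha>
    by metis
  have "?h (\<Sum>\<alpha>\<in>Poly_Mapping.keys F. P \<alpha>) = F"
    unfolding hall_map_sum by (subst (2) poly_mapping_sum_single) (intro sum.cong refl P)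
  moreover have "(\<Sum>\<alpha>\<in>Poly_Mapping.keys F. P \<alpha>) \<in> carrier (free_algebra (U_gens n))"
    by (intro free_algebra_sum P)
  ultimately show "F \<in> ?h ` carrier (free_algebra (U_gens n))" by (metis image_eqI)
qed

theorem theorem1:
  fixes n :: nat
  assumes "n \<ge> 2"
  shows "\<exists>\<phi> \<in> alg_iso (U_plus n) (KHA (quiver_A (n - 1))).
           \<forall>i \<in> {1..n - 1}. \<forall>r :: int.
             \<phi> (U_gen n i r) = Poly_Mapping.single (unit_dim i) (xpow i 1 (- r))"
proof -
  let ?h = "hall_map (quiver_A (n - 1))" and ?F = "free_algebra (U_gens n)"
  have "\<exists>\<phi>\<in>alg_iso (presented_algebra (U_gens n) (U_rels n)) (KHA (quiver_A (n - 1))).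
      \<forall>p\<in>carrier ?F. \<phi> ((Idl\<^bsub>?F\<^esub> (U_rels n)) +>\<^bsub>?F\<^esub> p) = ?h p"
  proof (rule presented_algebra_iso[OF U_rels_carrier hall_map_surj])
    fix p q assume pq: "p \<in> carrier ?F" "q \<in> carrier ?F"
    show "?h p = ?h q \<longleftrightarrow> p - q \<in> Idl\<^bsub>?F\<^esub> (U_rels n)"
      using hall_map_ker[OF free_algebra_diff[OF pq]] by (simp add: hall_map_diff U_ideal_def)
    show "?h (p * q) = ?h p \<otimes>\<^bsub>KHA (quiver_A (n - 1))\<^esub> ?h q"
      by (rule hall_map_mult_free[OF pq])
    show "?h (p + q) = ?h p \<oplus>\<^bsub>KHA (quiver_A (n - 1))\<^esub> ?h q"
      by (simp add: KHA_def hall_map_add)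
  next
    show "?h 1 = \<one>\<^bsub>KHA (quiver_A (n - 1))\<^esub>"
      using hall_map_mon[of "quiver_A (n - 1)" "[]"]
      by (simp add: KHA_def shuffle_elt_Nil flip: zero_word_def)
  qed (rule hall_map_scale[symmetric])
  then obtain \<phi> where \<phi>: "\<phi> \<in> alg_iso (U_plus n) (KHA (quiver_A (n - 1)))"
    "\<And>p. p \<in> carrier ?F \<Longrightarrow> \<phi> ((Idl\<^bsub>?F\<^esub> (U_rels n)) +>\<^bsub>?F\<^esub> p) = ?h p"
    unfolding U_plus_def by blast
  have "\<phi> (U_gen n i r) = Poly_Mapping.single (unit_dim i) (xpow i 1 (- r))" if "i \<in> {1..n - 1}" for i r
  proof -
    have "ncmon [(i, r)] \<in> carrier ?F"
      using that by (intro free_algebra_single) (auto simp: U_gens_def)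
    then show ?thesis
      unfolding U_gen_def presented_gen_def nc_var_def
      by (simp add: \<phi>(2) hall_map_mon shuffle_elt_single xpow_eq_xvar)
  qed
  with \<phi>(1) show ?thesis by blast
qed

end
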